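(* Let $\omega\in\mathcal{D}$, $0<p<\infty$ and $n\in\mathbb{N}\cup\{0\}$. Let $\varphi$ be an analytic self-map of $\mathbb{D}$ and $u\in H^\infty$. Let $D^n_{\varphi,u}$ be the operator $D^n_{\varphi,u}f=u\cdot(f^{(n)}\circ\varphi)$. Then $D^n_{\varphi,u}:A^p_\omega\to H^\infty$ is bounded if and only if $$\sup_{z\in\mathbb{D}}\frac{|u(z)|}{\omega(S(\varphi(z)))^{\frac1p}(1-|\varphi(z)|)^n}<\infty.$$ Moreover, if $D^n_{\varphi,u}:A^p_\omega\to H^\infty$ is bounded, then $$\|D^n_{\varphi,u}\|\asymp\sup_{z\in\mathbb{D}}\frac{|u(z)|}{\omega(S(\varphi(z)))^{\frac1p}(1-|\varphi(z)|)^n}.$$ Furthermore, for $\omega\in\mathcal{D}$, $0<p<\infty$, $n\in\mathbb{N}\cup\{0\}$, $\varphi$ an analytic self-map of $\mathbb{D}$ and $u\in H^\infty$, the following are equivalent: (i) $D^n_{\varphi,u}:A^p_\omega\to H^\infty$ is compact; (ii) $\sup_{z\in\mathbb{D}}|\varphi(z)|<1$ or $$\lim_{|\varphi(z)|\to1}\frac{|u(z)|}{\omega(S(\varphi(z)))^{\frac1p}(1-|\varphi(z)|)^n}=0.$$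
   Context: $\mathbb{D}=\{z\in\mathbb{C}:|z|<1\}$; $\mathcal{H}(\mathbb{D})$ is the space of analytic functions on $\mathbb{D}$; $dA(z)=\frac{dx\,dy}{\pi}$ is normalized area measure. An analytic self-map of $\mathbb{D}$ is an analytic function $\varphi:\mathbb{D}\to\mathbb{D}$. $H^\infty$ is the space of bounded analytic functions on $\mathbb{D}$ with the sup norm. A weight is an integrable function $\omega:\mathbb{D}\to[0,\infty)$; it is radial if $\omega(z)=\omega(|z|)$ for all $z\in\mathbb{D}$. For a radial weight, $\widehat{\omega}(z)=\int_{|z|}^1\omega(s)\,ds$ for $z\in\mathbb{D}$; radial weights are taken to be nontrivial (not almost everywhere zero). The class $\mathcal{D}$ of doubling weights consists of the radial weights $\omega$ satisfying both: (1) there is a constant $C=C(\omega)\ge 1$ with $\widehat{\omega}(r)\le C\,\widehat{\omega}\left(\frac{1+r}{2}\right)$ for all $0\le r<1$; (2) there are constants $K=K(\omega)>1$ and $C=C(\omega)>1$ with $\widehat{\omega}(r)\ge C\,\widehat{\omega}\left(1-\frac{1-r}{K}\right)$ for all $0\le r<1$. For $0<p<\infty$ and a weight $\omega$, the weighted Bergman space $A^p_\omega$ consists of $f\in\mathcal{H}(\mathbb{D})$ with $\|f\|^p_{A^p_\omega}=\int_{\mathbb{D}}|f|^p\omega\,dA<\infty$. For measurable $E\subset\mathbb{D}$, $\omega(E)=\int_E\omega\,dA$. The Carleson square is $S(z)=\{\zeta\in\mathbb{D}:|z|<|\zeta|,\ |\arg\zeta-\arg z|<(1-|z|)/2\}$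 for $z\in\mathbb{D}\setminus\{0\}$ (arguments compared modulo $2\pi$), and $S(0)=\mathbb{D}$. $\|D^n_{\varphi,u}\|=\sup\{\|D^n_{\varphi,u}f\|_{H^\infty}:\|f\|_{A^p_\omega}\le1\}$ is the operator norm. $a\asymp b$ means $C^{-1}b\le a\le Cb$ for a constant $C\geq 1$; here $C$ depends only on $\omega,p,n$ (not on $\varphi$ or $u$). The limit as $|\varphi(z)|\to1$ being $0$ means: for every $\varepsilon>0$ there is $r\in(0,1)$ such that the quotient is less than $\varepsilon$ for all $z\in\mathbb{D}$ with $r<|\varphi(z)|<1$. *)

theory Defs
  imports "HOL-Complex_Analysis.Complex_Analysis"
begin

text \<open>
  Functions on the unit disc are total functions on \<^typ>\<open>complex\<close>; every notion below depends
  only on their values inside the disc.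
\<close>

abbreviation unit_disc :: "complex set" where
  "unit_disc \<equiv> ball 0 1"

definition area_measure :: "complex measure" where
  "area_measure = scale_measure (ennreal (1 / pi)) (lebesgue_on unit_disc)"

definition self_map :: "(complex \<Rightarrow> complex) \<Rightarrow> bool" where
  "self_map \<phi> \<longleftrightarrow> \<phi> holomorphic_on unit_disc \<and> \<phi> ` unit_disc \<subseteq> unit_disc"

definition weight :: "(complex \<Rightarrow> real) \<Rightarrow> bool" where
  "weight \<omega> \<longleftrightarrow> integrable area_measure \<omega> \<and> (\<forall>z\<in>unit_disc. 0 \<le> \<omega> z)"

definition radial_weight :: "(complex \<Rightarrow> real) \<Rightarrow> bool" where
  "radial_weight \<omega> \<longleftrightarrow>
     weight \<omega> \<and> (\<forall>z\<in>unit_disc. \<omega> z = \<omega> (of_real (cmod z))) \<and>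
     \<not> (AE z in area_measure. \<omega> z = 0)"

text \<open>
  The tail integral is extended-valued: area-integrability of a radial weight does not exclude
  that its tail integral at the origin is infinite.
\<close>

definition weight_tail :: "(complex \<Rightarrow> real) \<Rightarrow> complex \<Rightarrow> ennreal" where
  "weight_tail \<omega> z = (\<integral>\<^sup>+ s \<in> {cmod z..<1}. ennreal (\<omega> (of_real s)) \<partial>lebesgue)"

definition doubling_weights :: "(complex \<Rightarrow> real) set" where
  "doubling_weights = {\<omega>. radial_weight \<omega> \<and>
     (\<exists>C::real\<ge>1. \<forall>r::real\<in>{0..<1}.
        weight_tail \<omega> (of_real r) \<le> ennreal C * weight_tail \<omega> (of_real ((1 + r) / 2))) \<and>
     (\<exists>K::real>1. \<exists>C::real>1. \<forall>r::real\<in>{0..<1}.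
        weight_tail \<omega> (of_real r) \<ge> ennreal C * weight_tail \<omega> (of_real (1 - (1 - r) / K)))}"

definition weight_of :: "(complex \<Rightarrow> real) \<Rightarrow> complex set \<Rightarrow> real" where
  "weight_of \<omega> E = (LINT z:E|area_measure. \<omega> z)"

definition carleson_square :: "complex \<Rightarrow> complex set" where
  "carleson_square z =
     (if z = 0 then unit_disc
      else {\<zeta>\<in>unit_disc. cmod z < cmod \<zeta> \<and>
              (\<exists>k::int. \<bar>Arg \<zeta> - Arg z - 2 * pi * of_int k\<bar> < (1 - cmod z) / 2)})"

definition bergman :: "real \<Rightarrow> (complex \<Rightarrow> real) \<Rightarrow> (complex \<Rightarrow> complex) set" where
  "bergman p \<omega> = {f. f holomorphic_on unit_disc \<and>
                      integrable area_measure (\<lambda>z. cmod (f z) powr p * \<omega> z)}"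

definition bergman_norm :: "real \<Rightarrow> (complex \<Rightarrow> real) \<Rightarrow> (complex \<Rightarrow> complex) \<Rightarrow> real" where
  "bergman_norm p \<omega> f = (LINT z|area_measure. cmod (f z) powr p * \<omega> z) powr (1 / p)"

definition H_infinity :: "(complex \<Rightarrow> complex) set" where
  "H_infinity = {f. f holomorphic_on unit_disc \<and> bounded (f ` unit_disc)}"

definition sup_norm :: "(complex \<Rightarrow> complex) \<Rightarrow> real" where
  "sup_norm f = (SUP z\<in>unit_disc. cmod (f z))"

type_synonym operator = "(complex \<Rightarrow> complex) \<Rightarrow> (complex \<Rightarrow> complex)"

definition weighted_diff_comp ::
  "nat \<Rightarrow> (complex \<Rightarrow> complex) \<Rightarrow> (complex \<Rightarrow> complex) \<Rightarrow> operator" where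
  "weighted_diff_comp n \<phi> u f = (\<lambda>z. u z * (deriv ^^ n) f (\<phi> z))"

definition bounded_operator :: "real \<Rightarrow> (complex \<Rightarrow> real) \<Rightarrow> operator \<Rightarrow> bool" where
  "bounded_operator p \<omega> T \<longleftrightarrow>
     (\<forall>f\<in>bergman p \<omega>. T f \<in> H_infinity) \<and>
     (\<exists>M. \<forall>f\<in>bergman p \<omega>. sup_norm (T f) \<le> M * bergman_norm p \<omega> f)"

definition operator_norm :: "real \<Rightarrow> (complex \<Rightarrow> real) \<Rightarrow> operator \<Rightarrow> real" where
  "operator_norm p \<omega> T = (SUP f\<in>{f\<in>bergman p \<omega>. bergman_norm p \<omega> f \<le> 1}. sup_norm (T f))"

text \<open>
  Compactness: every norm-bounded sequence in the (for p < 1 only quasi-normed) Bergman space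
  has a subsequence whose image converges in the supremum norm to a bounded analytic function.
\<close>

definition compact_operator :: "real \<Rightarrow> (complex \<Rightarrow> real) \<Rightarrow> operator \<Rightarrow> bool" where
  "compact_operator p \<omega> T \<longleftrightarrow>
     (\<forall>f\<in>bergman p \<omega>. T f \<in> H_infinity) \<and>
     (\<forall>F :: nat \<Rightarrow> complex \<Rightarrow> complex.
        (\<forall>k. F k \<in> bergman p \<omega>) \<and> (\<exists>M. \<forall>k. bergman_norm p \<omega> (F k) \<le> M) \<longrightarrow>
        (\<exists>r g. strict_mono (r :: nat \<Rightarrow> nat) \<and> g \<in> H_infinity \<and>
           (\<lambda>k. sup_norm (\<lambda>z. T (F (r k)) z - g z)) \<longlonglongrightarrow> 0))"

text \<open>
  For doubling weights all Carleson squares have positive weight, so the denominator below is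
  positive whenever \<^term>\<open>\<phi>\<close> maps the disc into itself.
\<close>

definition test_quotient ::
  "real \<Rightarrow> (complex \<Rightarrow> real) \<Rightarrow> nat \<Rightarrow> (complex \<Rightarrow> complex) \<Rightarrow> (complex \<Rightarrow> complex) \<Rightarrow> complex \<Rightarrow> real"
  where
  "test_quotient p \<omega> n \<phi> u z =
     cmod (u z) / (weight_of \<omega> (carleson_square (\<phi> z)) powr (1 / p) * (1 - cmod (\<phi> z)) ^ n)"

end

theory Submission
  imports Defs
begin

text \<open>
  The theorem reduces to sharp bounds for the functionals \<open>f \<mapsto> f\<^sup>(\<^sup>n\<^sup>)(a)\<close> on the Bergman space. Write
  \<open>d(a) = \<omega>(S(a))\<^sup>1\<^sup>/\<^sup>p (1 - |a|)\<^sup>n\<close>, so that the test quotient at \<open>z\<close> is \<open>|u(z)| / d(\<phi>(z))\<close>. If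
  \<open>|f\<^sup>(\<^sup>n\<^sup>)(a)| \<lesssim> \<parallel>f\<parallel> / d(a)\<close> for all \<open>f\<close>, and some \<open>h\<close> in the unit ball attains
  \<open>1 / d(a)\<close> up to a constant at \<open>a\<close>, then boundedness and the size of the norm can be read off
  at the points \<open>a = \<phi>(z)\<close>. Compactness needs two more facts: the unit ball is a normal family, and the
  extremal functions \<open>k\<^sub>a\<close> can be chosen with \<open>k\<^sub>a\<^sup>(\<^sup>n\<^sup>) \<rightarrow> 0\<close> pointwise as \<open>|a| \<rightarrow> 1\<close>. This
  bookkeeping is the locale \<open>bergman_derivative_estimates\<close>.

  All estimates rest on averaging over rotations, under which a radial weight is invariant. Let \<open>\<mu>\<close> be
  the measure \<open>\<omega> dA\<close> and \<open>V(r) = \<mu>{|z| > r}\<close>. Up to constants \<open>V\<close> is the tail integral of \<open>\<omega>\<close>, so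
  the first doubling condition becomes \<open>V(1 - 2t) \<le> D V(1 - t)\<close>, and averaging the indicator of a Carleson
  square gives \<open>\<omega>(S(a)) \<asymp> (1 - |a|) V(|a|)\<close>.

  \<^item> Upper bound. On the circle of radius \<open>\<rho> > |a|\<close> the mean of \<open>|f|\<^sup>p\<close> is at least
    \<open>(1 - |a|/\<rho>) |f(a)|\<^sup>p\<close> (\<open>power_mean_circle\<close>): after division by Blaschke factors \<open>f\<close> has a
    holomorphic \<open>p\<close>-th power, and Cauchy's formula applies. Averaging over \<open>\<rho> > (1 + |a|)/2\<close> against \<open>\<mu>\<close>
    bounds \<open>|f(a)|\<close> by \<open>\<parallel>f\<parallel> / \<omega>(S(a))\<^sup>1\<^sup>/\<^sup>p\<close>, and Cauchy's inequality on a disc of radius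
    \<open>(1 - |a|)/2\<close> passes to derivatives (\<open>higher_deriv_le\<close>).

  \<^item> Lower bound. For large \<open>m\<close> the functions \<open>((1 - |a|) / (1 - cnj a z))\<^sup>m\<close> have
    \<open>p\<close>-th power integral at most a constant times \<open>\<omega>(S(a))\<close> (\<open>kernel_integral_le\<close>): the
    angular integral is controlled by the Poisson kernel, and the remaining radial integral is a geometric
    series over dyadic annuli whose ratio is small once \<open>2\<^sup>m\<^sup>p\<close> beats the doubling constant. Their \<open>n\<close>-th
    derivative at \<open>a\<close> carries a factor of modulus \<open>|a|\<^sup>n\<close>, so near the origin \<open>z\<^sup>n\<close> is used instead.
    The same integral bound forces \<open>\<omega>(S(a)) \<gtrsim> (1 - |a|)\<^sup>m\<^sup>p\<close>; hence with one more power the normalized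
    functions tend to zero pointwise as \<open>|a| \<rightarrow> 1\<close>, as compactness requires.
\<close>

section \<open>Lebesgue measure and rotations\<close>

text \<open>
  The classical argument for uniqueness of Haar measure: the double integral of
  \<open>1\<^sub>A(x) 1\<^sub>B(x + y)\<close> over \<open>x\<close> and \<open>y\<close> equals \<open>\<mu>(A) \<lambda>(B)\<close>, where \<open>\<lambda>\<close> is
  Lebesgue measure; invariance of \<open>\<mu>\<close> permits the shift of \<open>x\<close> by \<open>- y\<close>, after which the same integral
  is \<open>\<lambda>(A) \<mu>(B)\<close>. A single test set \<open>B\<close> on which the measures agree fixes the
  proportionality constant.
\<close>

lemma translation_invariant_measure_unique:
  fixes \<mu> :: "'a::euclidean_space measure"
  assumes sets: "sets \<mu> = sets borel"
    and fin: "sigma_finite_measure \<mu>"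
    and trans: "\<And>c. distr \<mu> borel (\<lambda>x. c + x) = \<mu>"
    and B: "B \<in> sets borel" and eqB: "emeasure \<mu> B = emeasure lborel B"
    and B0: "emeasure lborel B \<noteq> 0" "emeasure lborel B \<noteq> \<infinity>"
  shows "\<mu> = lborel"
proof (rule measure_eqI)
  fix A assume "A \<in> sets \<mu>"
  then have A [measurable]: "A \<in> sets borel" using sets by simp
  note B [measurable] sets [measurable_cong]
  interpret sigma_finite_measure \<mu> by fact
  interpret pair_sigma_finite \<mu> "lborel :: 'a measure" ..
  have tr: "(\<integral>\<^sup>+x. h (c + x) \<partial>\<mu>) = (\<integral>\<^sup>+x. h x \<partial>\<mu>)"
    if [measurable]: "h \<in> borel_measurable borel" for h :: "'a \<Rightarrow> ennreal" and c
    by (subst (2) trans[symmetric, of c], subst nn_integral_distr) (auto simp: measurable_cong_sets[OF sets refl])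
  have trl: "(\<integral>\<^sup>+x. h (c + x) \<partial>lborel) = (\<integral>\<^sup>+x. h x \<partial>lborel)"
    if [measurable]: "h \<in> borel_measurable borel" for h :: "'a \<Rightarrow> ennreal" and c
  proof -
    have "distr lborel borel (\<lambda>x. c + x) = (lborel :: 'a measure)"
      using lborel_affine[of 1 c] by (simp add: density_1)
    then show ?thesis
      using nn_integral_distr[of "\<lambda>x. c + x" lborel borel h] by simp
  qed
  have ref: "(\<integral>\<^sup>+x. h (- x) \<partial>lborel) = (\<integral>\<^sup>+x. h x \<partial>lborel)"
    if [measurable]: "h \<in> borel_measurable borel" for h :: "'a \<Rightarrow> ennreal"
    by (subst (2) lborel_affine[of "-1" 0]) (auto simp: density_1 nn_integral_distr)
  have "emeasure \<mu> A * emeasure lborel B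
      = (\<integral>\<^sup>+x. indicator A x * (\<integral>\<^sup>+y. indicator B (x + y) \<partial>lborel) \<partial>\<mu>)"
    by (simp add: trl nn_integral_multc)
  also have "\<dots> = (\<integral>\<^sup>+x. (\<integral>\<^sup>+y. indicator A x * indicator B (x + y) \<partial>lborel) \<partial>\<mu>)"
    by (simp add: nn_integral_cmult)
  also have "\<dots> = (\<integral>\<^sup>+y. (\<integral>\<^sup>+x. indicator A x * indicator B (x + y) \<partial>\<mu>) \<partial>lborel)"
    by (rule Fubini'[symmetric]) simp
  also have "\<dots> = (\<integral>\<^sup>+y. (\<integral>\<^sup>+x. indicator A (- y + x) * indicator B x \<partial>\<mu>) \<partial>lborel)"
  proof (rule nn_integral_cong)
    fix y
    have "(\<lambda>x. indicator A x * indicator B (x + y) :: ennreal) \<in> borel_measurable borel" by simp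
    from tr[OF this, of "- y"]
    show "(\<integral>\<^sup>+x. indicator A x * indicator B (x + y) \<partial>\<mu>)
        = (\<integral>\<^sup>+x. indicator A (- y + x) * indicator B x \<partial>\<mu>)" by (simp add: add_ac)
  qed
  also have "\<dots> = (\<integral>\<^sup>+x. (\<integral>\<^sup>+y. indicator A (- y + x) * indicator B x \<partial>lborel) \<partial>\<mu>)"
    by (rule Fubini') simp
  also have "\<dots> = (\<integral>\<^sup>+x. emeasure lborel A * indicator B x \<partial>\<mu>)"
  proof (intro nn_integral_cong)
    fix x
    have "(\<integral>\<^sup>+y. indicator A (- y + x) \<partial>lborel) = (\<integral>\<^sup>+y. indicator A (x + y) \<partial>(lborel :: 'a measure))"
      using ref[of "\<lambda>y. indicator A (x + y)"] by (simp add: add_ac)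
    also have "\<dots> = emeasure lborel A" by (simp add: trl)
    finally show "(\<integral>\<^sup>+y. indicator A (- y + x) * indicator B x \<partial>lborel) = emeasure lborel A * indicator B x"
      by (simp add: nn_integral_multc)
  qed
  also have "\<dots> = emeasure lborel A * emeasure lborel B"
    by (simp add: nn_integral_cmult eqB)
  finally show "emeasure \<mu> A = emeasure lborel A"
    using B0 by (metis ennreal_mult_cancel_left infinity_ennreal_def mult.commute)
qed (simp add: sets)

text \<open>
  The image measure is again translation invariant, since the map is linear and onto, and
  it agrees with Lebesgue measure on the unit ball, which the map preserves.
\<close>

lemma lborel_distr_orthogonal:
  fixes T :: "'a::euclidean_space \<Rightarrow> 'a"
  assumes T: "orthogonal_transformation T"
  shows "distr lborel borel T = lborel"
proof (rule translation_invariant_measure_unique)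
  have lin: "linear T" using T by (rule orthogonal_transformation_linear)
  have [measurable]: "T \<in> borel_measurable borel"
    using lin by (intro borel_measurable_continuous_onI linear_continuous_on linear_conv_bounded_linear[THEN iffD1])
  have nrm: "norm (T x) = norm x" for x using T by (rule orthogonal_transformation_norm)
  have ball: "emeasure (distr lborel borel T) (ball 0 r) = emeasure lborel (ball (0::'a) r)" for r
  proof -
    have "T -` ball 0 r = ball (0::'a) r" by (auto simp: nrm)
    then show ?thesis by (subst emeasure_distr) auto
  qed
  show "emeasure (distr lborel borel T) (ball 0 1) = emeasure lborel (ball (0::'a) 1)" by (rule ball)
  show "emeasure lborel (ball (0::'a) 1) \<noteq> 0"
    by (simp add: emeasure_ball unit_ball_vol_pos[THEN less_imp_neq, symmetric])
  show "emeasure lborel (ball (0::'a) 1) \<noteq> \<infinity>" by (simp add: emeasure_ball)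
  show "sigma_finite_measure (distr lborel borel T)"
  proof (rule sigma_finite_measure.intro, intro exI[of _ "range (\<lambda>n::nat. ball 0 (real n))"] conjI)
    show "\<Union> (range (\<lambda>n::nat. ball 0 (real n))) = space (distr lborel borel T)"
      by (auto simp: reals_Archimedean2)
    show "\<forall>a\<in>range (\<lambda>n::nat. ball 0 (real n)). emeasure (distr lborel borel T) a \<noteq> \<infinity>"
      by (auto simp: ball emeasure_ball)
  qed auto
  show "distr (distr lborel borel T) borel (\<lambda>x. c + x) = distr lborel borel T" for c
  proof -
    obtain d where d: "T d = c"
      using orthogonal_transformation_surj[OF T] by (metis surjD)
    have "distr (distr lborel borel T) borel (\<lambda>x. c + x) = distr lborel borel (\<lambda>x. c + T x)"
      by (simp add: distr_distr o_def)
    also have "\<dots> = distr lborel borel (\<lambda>x. T (d + x))"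
      by (simp add: linear_add[OF lin] d)
    also have "\<dots> = distr (distr lborel borel (\<lambda>x. d + x)) borel T"
      by (simp add: distr_distr o_def)
    also have "distr lborel borel (\<lambda>x. d + x) = lborel"
      using lborel_affine[of 1 d] by (simp add: density_1)
    finally show ?thesis .
  qed
qed auto


section \<open>Radial functions and polar coordinates\<close>

lemma emeasure_distr_cmod_disc:
  assumes [measurable]: "N \<in> sets borel"
  shows "emeasure (distr (density lborel (indicator (ball (0::complex) 1))) borel cmod) N
     = emeasure lborel {z. cmod z < 1 \<and> cmod z \<in> N}"
proof -
  have [measurable]: "cmod -` N \<in> sets borel"
    using measurable_sets[OF borel_measurable_continuous_onI assms, of cmod] by (simp add: continuous_on_norm_id)
  have *: "{z. cmod z < 1 \<and> cmod z \<in> N} = ball 0 1 \<inter> cmod -` N"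
    by auto
  show ?thesis
    by (subst emeasure_distr, measurable, subst emeasure_density)
       (auto simp: * indicator_inter_arith[symmetric] Int_commute intro!: borel_measurable_indicator)
qed

text \<open>
  Polar coordinates for radial functions. Only the areas of discs are needed, because a measure on
  the line is determined by its values on half-lines.
\<close>

lemma distr_cmod_lborel:
  "distr (density lborel (indicator (ball (0::complex) 1))) borel cmod
     = density lborel (\<lambda>r. ennreal (2 * pi * r) * indicator {0<..<1} r)" (is "?M = ?N")
proof (rule measure_eqI_lessThan)
  fix x :: real
  have M: "emeasure ?M {x<..} = emeasure lborel (ball (0::complex) 1 \<inter> {z. x < cmod z})"
    by (subst emeasure_distr_cmod_disc) (auto intro!: arg_cong[where f="emeasure lborel"])
  then show "emeasure ?M {x<..} < \<infinity>"
    by (metis bounded_Int bounded_ball emeasure_bounded_finite infinity_ennreal_def)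
  show "emeasure ?M {x<..} = emeasure ?N {x<..}"
  proof -
    define y where "y = max 0 x"
    have N: "emeasure ?N {x<..} = (\<integral>\<^sup>+r. ennreal (2 * pi * r) * indicator {y..1} r \<partial>lborel)"
    proof (subst emeasure_density)
      have "AE r in lborel. r \<noteq> y \<and> r \<noteq> (1::real)" 
        by (auto intro: AE_lborel_singleton)
      then show "(\<integral>\<^sup>+r. ennreal (2 * pi * r) * indicator {0<..<1} r * indicator {x<..} r \<partial>lborel)
        = (\<integral>\<^sup>+r. ennreal (2 * pi * r) * indicator {y..1} r \<partial>lborel)"
        by (intro nn_integral_cong_AE, elim eventually_mono) (auto simp: y_def split: split_indicator)
    qed auto
    show ?thesis
    proof (cases "x < 1")
      case True
      then have y: "0 \<le> y" "y \<le> 1" by (auto simp: y_def)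
      have "(\<integral>\<^sup>+r. ennreal (2 * pi * r) * indicator {y..1} r \<partial>lborel) = ennreal (pi * 1^2 - pi * y^2)"
        using y by (intro nn_integral_FTC_Icc[where F="\<lambda>r. pi * r^2"]) (auto intro!: derivative_eq_intros)
      moreover have "emeasure lborel (ball (0::complex) 1 \<inter> {z. x < cmod z}) = ennreal (pi - pi * y^2)"
      proof -
        have "ball (0::complex) 1 \<inter> {z. x < cmod z} = ball 0 1 - (if x < 0 then {} else cball 0 y)"
          by (auto simp: y_def intro: less_le_trans[of _ 0])
        also have "emeasure lborel \<dots> = ennreal (pi - pi * y^2)"
        proof (cases "x < 0")
          case True
          then show ?thesis by (simp add: y_def emeasure_ball unit_ball_vol_2)
        next
          case False
          then have "emeasure lborel (ball (0::complex) 1 - cball 0 y) = ennreal (pi * 1^2) - ennreal (pi * y^2)"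
            using y \<open>x < 1\<close> by (subst emeasure_Diff) (auto simp: emeasure_ball emeasure_cball unit_ball_vol_2 y_def)
          then show ?thesis using y False by (simp add: ennreal_minus)
        qed
        finally show ?thesis .
      qed
      ultimately show ?thesis by (simp add: M N)
    next
      case False
      then have "ball (0::complex) 1 \<inter> {z. x < cmod z} = {}" by auto
      moreover have "(\<integral>\<^sup>+r. ennreal (2 * pi * r) * indicator {y..1} r \<partial>lborel) = 0"
      proof -
        have "AE r in lborel. r \<noteq> (1::real)" by (auto intro: AE_lborel_singleton)
        then have "AE r in lborel. ennreal (2 * pi * r) * indicator {y..1} r = 0"
          by eventually_elim (use False in \<open>auto simp: y_def split: split_indicator\<close>)
        then show ?thesis by (subst nn_integral_0_iff_AE) auto
      qed
      ultimately show ?thesis by (simp add: M N)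
    qed
  qed
qed auto

lemma null_sets_cmod_vimage_iff:
  assumes [measurable]: "N \<in> sets borel"
  shows "{z. cmod z < 1 \<and> cmod z \<in> N} \<in> null_sets lborel \<longleftrightarrow> N \<inter> {0<..<1} \<in> null_sets lborel"
proof -
  note emeasure_distr_cmod_disc[OF assms]
  then have "{z. cmod z < 1 \<and> cmod z \<in> N} \<in> null_sets lborel \<longleftrightarrow>
     (\<integral>\<^sup>+r. ennreal (2 * pi * r) * indicator {0<..<1} r * indicator N r \<partial>lborel) = 0"
    by (simp add: null_sets_def distr_cmod_lborel emeasure_density)
  also have "\<dots> \<longleftrightarrow> (AE r in lborel. ennreal (2 * pi * r) * indicator {0<..<1} r * indicator N r = 0)"
    by (rule nn_integral_0_iff_AE) simp
  also have "\<dots> \<longleftrightarrow> (AE r in lborel. r \<notin> N \<inter> {0<..<1})"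
    by (intro AE_cong) (use pi_gt_zero in \<open>auto split: split_indicator simp: ennreal_eq_0_iff mult_le_0_iff simp del: pi_gt_zero\<close>)
  also have "\<dots> \<longleftrightarrow> N \<inter> {0<..<1} \<in> null_sets lborel"
    by (subst AE_iff_null_sets[symmetric]) auto
  finally show ?thesis .
qed


text \<open>
  Measurability of a rotation-invariant planar set passes to its radial profile. Up to a null set
  such a set is a countable union of compact sets, whose image under the modulus is again a
  countable union of compact sets; applying this to the set and to its complement squeezes \<open>E\<close> between two Borel
  sets whose difference is null by polar coordinates.
\<close>

lemma sets_lebesgue_of_cmod_vimage:
  assumes E: "E \<subseteq> {0<..<1}" and A: "{z. cmod z \<in> E} \<in> sets lebesgue"
  shows "E \<in> sets lebesgue"
proof -
  have inner: "\<exists>F. F \<in> sets borel \<and> F \<subseteq> H \<and> {z. cmod z \<in> H - F} \<in> null_sets lebesgue"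
    if H: "{z. cmod z \<in> H} \<in> sets lebesgue" for H :: "real set"
  proof -
    obtain C T where C: "fsigma C" "T \<in> null_sets lebesgue" "C \<union> T = {z. cmod z \<in> H}"
      using lebesgue_set_almost_fsigma[OF H] by metis
    obtain K :: "nat \<Rightarrow> complex set" where K: "\<And>n. compact (K n)" "C = (\<Union>n. K n)"
      using C(1) unfolding fsigma_Union_compact by (metis mem_Collect_eq range_subsetD)
    have "cmod ` C = (\<Union>n. cmod ` K n)" using K(2) by auto
    moreover have "cmod ` K n \<in> sets borel" for n
      using K(1)[of n] by (intro borel_compact compact_continuous_image continuous_intros)
    ultimately have "cmod ` C \<in> sets borel" by auto
    moreover have "cmod ` C \<subseteq> H" using C(3) by auto
    moreover have "{z. cmod z \<in> H - cmod ` C} \<subseteq> T" using C(3) by auto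
    then have "{z. cmod z \<in> H - cmod ` C} \<in> null_sets lebesgue"
      using C(2) by (rule null_sets_completion_subset)
    ultimately show ?thesis by blast
  qed
  \<comment> \<open>\<open>F\<close> and the complement of \<open>F'\<close> are the Borel sets between which \<open>E\<close> is squeezed.\<close>
  obtain F where F: "F \<in> sets borel" "F \<subseteq> E" "{z. cmod z \<in> E - F} \<in> null_sets lebesgue"
    using inner[OF A] by blast
  have "{z. cmod z \<in> {0<..<1} - E} = (ball 0 1 - {0}) - {z. cmod z \<in> E}"
    using E by auto
  also have "\<dots> \<in> sets lebesgue" using A by (intro sets.Diff) auto
  finally obtain F' where F': "F' \<in> sets borel" "F' \<subseteq> {0<..<1} - E"
      "{z. cmod z \<in> {0<..<1} - E - F'} \<in> null_sets lebesgue"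
    using inner by blast
  define N where "N = {0<..<1} - F - F'"
  have N: "N \<in> sets borel" using F(1) F'(1) by (auto simp: N_def)
  have "{z. cmod z < 1 \<and> cmod z \<in> N} \<subseteq> {z. cmod z \<in> E - F} \<union> {z. cmod z \<in> {0<..<1} - E - F'}"
    by (auto simp: N_def)
  then have "{z. cmod z < 1 \<and> cmod z \<in> N} \<in> null_sets lebesgue"
    by (rule null_sets_completion_subset[OF _ null_sets.Un[OF F(3) F'(3)]])
  moreover have "{z. cmod z < 1 \<and> cmod z \<in> N} \<in> sets lborel" using N by measurable
  ultimately have "N \<inter> {0<..<1} \<in> null_sets lborel"
    using null_sets_cmod_vimage_iff[OF N] by (simp add: null_sets_completion_iff)
  moreover have "N \<inter> {0<..<1} = N" by (auto simp: N_def)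
  ultimately have "N \<in> null_sets lborel" by simp
  then have "E - F \<in> null_sets lebesgue"
    unfolding null_sets_completion_iff2 by (rule bexI[rotated]) (use E F'(2) in \<open>auto simp: N_def\<close>)
  moreover have "E = F \<union> (E - F)" using F(2) by auto
  moreover have "F \<in> sets lebesgue" using F(1) by (simp add: sets_completionI_sets)
  ultimately show ?thesis by (metis null_setsD2 sets.Un)
qed

text \<open>
  A radial weight is only Lebesgue measurable, while its tail integral evaluates it on the null
  set of positive reals. The Borel profile makes both integrals accessible to polar coordinates.
\<close>

lemma radial_borel_profile:
  fixes \<omega> :: "complex \<Rightarrow> real"
  assumes meas: "\<omega> \<in> borel_measurable (lebesgue_on (ball 0 1))"
    and nonneg: "\<And>z. cmod z < 1 \<Longrightarrow> 0 \<le> \<omega> z"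
    and radial: "\<And>z. cmod z < 1 \<Longrightarrow> \<omega> z = \<omega> (of_real (cmod z))"
  obtains G :: "real \<Rightarrow> real" where "G \<in> borel_measurable borel" "\<And>r. 0 \<le> G r"
    "AE r in lborel. r \<in> {0<..<1} \<longrightarrow> \<omega> (of_real r) = G r"
    "AE z in lborel. z \<in> ball 0 1 \<longrightarrow> \<omega> z = G (cmod z)"
proof -
  define g where "g r = (if r \<in> {0<..<1} then \<omega> (of_real r) else 0)" for r
  have g0: "0 \<le> g r" for r using nonneg by (auto simp: g_def)
  have "g \<in> borel_measurable lebesgue"
  proof (rule borel_measurableI_greater)
    fix y :: real
    show "{r \<in> space lebesgue. y < g r} \<in> sets lebesgue"
    proof (cases "y < 0")
      case True
      then have "{r. y < g r} = UNIV" using order.strict_trans2[OF _ g0] by blast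
      then show ?thesis by simp
    next
      case False
      have "{z. cmod z \<in> {r. y < g r}} = {z \<in> ball 0 1. y < \<omega> z} - {0}"
        using False by (auto simp: g_def radial[symmetric] split: if_splits)
      also have "\<dots> \<in> sets lebesgue"
      proof (intro sets.Diff)
        have "{z \<in> space (lebesgue_on (ball 0 1)). y < \<omega> z} \<in> sets (lebesgue_on (ball 0 1))"
          using borel_measurable_less[OF borel_measurable_const meas] .
        then show "{z \<in> ball 0 1. y < \<omega> z} \<in> sets lebesgue"
          by (auto simp: sets_restrict_space_iff)
      qed auto
      finally have "{r. y < g r} \<in> sets lebesgue"
        by (rule sets_lebesgue_of_cmod_vimage[rotated]) (use False in \<open>auto simp: g_def\<close>)
      then show ?thesis by simp
    qed
  qed
  then obtain G0 where G0: "G0 \<in> borel_measurable lborel" "AE r in lborel. g r = G0 r"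
    using completion_ex_borel_measurable_real by blast
  define G where "G r = max 0 (G0 r)" for r
  have G [measurable]: "G \<in> borel_measurable borel" using G0(1) by (simp add: G_def[abs_def])
  have AE: "AE r in lborel. g r = G r"
    using G0(2) by eventually_elim (metis G_def g0 max.absorb2)
  then obtain N where N: "N \<in> null_sets lborel" "{r. g r \<noteq> G r} \<subseteq> N"
    by (auto elim!: AE_E simp: null_sets_def)
  have "N \<inter> {0<..<1} \<in> null_sets lborel" using N(1) by (intro null_set_Int2) auto
  then have "{z. cmod z < 1 \<and> cmod z \<in> N} \<in> null_sets lborel"
    using null_sets_cmod_vimage_iff[of N] N(1) by auto
  from AE_not_in[OF this] have "AE z in lborel. \<not> (cmod z < 1 \<and> cmod z \<in> N)"
    by simp
  moreover have "AE z in lborel. z \<noteq> (0::complex)" by (rule AE_lborel_singleton)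
  ultimately have "AE z in lborel. z \<in> ball 0 1 \<longrightarrow> \<omega> z = G (cmod z)"
  proof eventually_elim
    case (elim z)
    show ?case
    proof
      assume z: "z \<in> ball 0 1"
      then have "g (cmod z) = G (cmod z)" using elim N(2) by auto
      then show "\<omega> z = G (cmod z)" using z elim(2) radial[of z] by (simp add: g_def)
    qed
  qed
  moreover have "AE r in lborel. r \<in> {0<..<1} \<longrightarrow> \<omega> (of_real r) = G r"
    using AE by eventually_elim (auto simp: g_def)
  ultimately show ?thesis using that[of G] G by (auto simp: G_def)
qed

section \<open>The measure of a doubling weight\<close>

text \<open>
  The properties of the measure \<open>\<omega> dA\<close> that the estimates use. The factor \<open>2\<close> in the doubling
  inequality is the distance to the circle being doubled; for \<open>t > 1/2\<close> the left-hand side is the total mass.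
\<close>

locale doubling_disc_measure =
  fixes \<mu> :: "complex measure" and D :: real
  assumes sets_eq: "sets \<mu> = sets borel"
    and finite: "emeasure \<mu> UNIV < \<infinity>"
    and disc: "emeasure \<mu> (- ball 0 1) = 0"
    and rotation: "\<And>c. cmod c = 1 \<Longrightarrow> distr \<mu> borel ((*) c) = \<mu>"
    and nontrivial: "0 < measure \<mu> UNIV"
    and doubling: "\<And>t. 0 < t \<Longrightarrow> t \<le> 1 \<Longrightarrow>
      measure \<mu> {z. 1 - 2 * t < cmod z} \<le> D * measure \<mu> {z. 1 - t < cmod z}"

definition radial_measure :: "(real \<Rightarrow> real) \<Rightarrow> complex measure" where
  "radial_measure G = density lborel (\<lambda>z. ennreal (G (cmod z) / pi) * indicator (ball 0 1) z)"

context
  fixes G :: "real \<Rightarrow> real"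
  assumes G [measurable]: "G \<in> borel_measurable borel" and G0: "\<And>r. 0 \<le> G r"
begin

lemma sets_radial_measure: "sets (radial_measure G) = sets borel"
  by (simp add: radial_measure_def)

lemma space_radial_measure: "space (radial_measure G) = UNIV"
  by (simp add: radial_measure_def)

lemma ball_measurable [measurable]: "indicator (ball (0::complex) 1) \<in> borel_measurable borel"
  by (auto intro: borel_measurable_indicator)

lemma radial_measure_outside: "emeasure (radial_measure G) (- ball 0 1) = 0"
  unfolding radial_measure_def
  by (subst emeasure_density) (auto simp: nn_integral_0_iff_AE split: split_indicator)

lemma radial_measure_rotation:
  assumes c: "cmod c = 1"
  shows "distr (radial_measure G) borel ((*) c) = radial_measure G"
proof (rule measure_eqI)
  fix A assume "A \<in> sets (distr (radial_measure G) borel ((*) c))"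
  then have A [measurable]: "A \<in> sets borel" by simp
  have [measurable]: "(*) c -` A \<in> sets borel"
    using measurable_sets[of "(*) c" borel borel A] by simp
  have "orthogonal_transformation ((*) c)"
    unfolding orthogonal_transformation
    using c by (auto simp: norm_mult intro!: linearI simp: algebra_simps)
  then have lb: "distr lborel borel ((*) c) = lborel" by (rule lborel_distr_orthogonal)
  have "emeasure (distr (radial_measure G) borel ((*) c)) A
      = (\<integral>\<^sup>+z. ennreal (G (cmod (c * z)) / pi) * indicator (ball 0 1) (c * z) * indicator A (c * z) \<partial>lborel)"
    unfolding radial_measure_def
    by (subst emeasure_distr, simp, simp, subst emeasure_density)
       (auto simp: norm_mult c intro!: nn_integral_cong split: split_indicator)
  also have "\<dots> = (\<integral>\<^sup>+z. ennreal (G (cmod z) / pi) * indicator (ball 0 1) z * indicator A z \<partial>distr lborel borel ((*) c))"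
    by (subst nn_integral_distr) auto
  finally show "emeasure (distr (radial_measure G) borel ((*) c)) A = emeasure (radial_measure G) A"
    by (simp add: lb radial_measure_def emeasure_density)
qed (simp add: sets_radial_measure)

lemma radial_measure_tail:
  "emeasure (radial_measure G) {z. r < cmod z} = (\<integral>\<^sup>+s. ennreal (2 * s * G s) * indicator {0<..<1} s * indicator {r<..} s \<partial>lborel)"
proof -
  have "emeasure (radial_measure G) {z. r < cmod z}
      = (\<integral>\<^sup>+z. indicator (ball 0 1) z * (ennreal (G (cmod z) / pi) * indicator {r<..} (cmod z)) \<partial>lborel)"
    unfolding radial_measure_def
    by (subst emeasure_density) (auto simp: mult_ac intro!: nn_integral_cong split: split_indicator)
  also have "\<dots> = (\<integral>\<^sup>+z. ennreal (G (cmod z) / pi) * indicator {r<..} (cmod z) \<partial>density lborel (indicator (ball (0::complex) 1)))"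
    by (subst nn_integral_density) auto
  also have "\<dots> = (\<integral>\<^sup>+s. ennreal (G s / pi) * indicator {r<..} s \<partial>distr (density lborel (indicator (ball (0::complex) 1))) borel cmod)"
    by (subst nn_integral_distr) auto
  also have "\<dots> = (\<integral>\<^sup>+s. (ennreal (2 * pi * s) * indicator {0<..<1} s) * (ennreal (G s / pi) * indicator {r<..} s) \<partial>lborel)"
    unfolding distr_cmod_lborel by (subst nn_integral_density) auto
  also have "\<dots> = (\<integral>\<^sup>+s. ennreal (2 * s * G s) * indicator {0<..<1} s * indicator {r<..} s \<partial>lborel)"
    by (intro nn_integral_cong) (auto simp: ennreal_mult'[symmetric] G0 split: split_indicator)
  finally show ?thesis .
qed

lemma radial_measure_tail_nonpos:
  assumes "r \<le> 0"
  shows "emeasure (radial_measure G) {z. r < cmod z} = emeasure (radial_measure G) UNIV"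
proof -
  have "emeasure (radial_measure G) {z. -1 < cmod z} = emeasure (radial_measure G) {z. r < cmod z}"
    unfolding radial_measure_tail using assms
    by (intro nn_integral_cong) (auto split: split_indicator)
  moreover have "{z::complex. -1 < cmod z} = UNIV" by (auto intro: less_le_trans[of _ 0])
  ultimately show ?thesis by simp
qed

text \<open>
  The planar tail carries the polar density \<open>2s\<close>, which lies between \<open>1\<close> and \<open>2\<close> for
  \<open>s \<ge> 1/2\<close>; this lemma and the next compare it with the tail integral on the line.
\<close>

lemma radial_measure_tail_le:
  "emeasure (radial_measure G) {z. r < cmod z} \<le> 2 * (\<integral>\<^sup>+s. ennreal (G s) * indicator {0<..<1} s * indicator {r<..} s \<partial>lborel)"
proof -
  have "emeasure (radial_measure G) {z. r < cmod z} \<le> (\<integral>\<^sup>+s. 2 * (ennreal (G s) * indicator {0<..<1} s * indicator {r<..} s) \<partial>lborel)"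
    unfolding radial_measure_tail
  proof (intro nn_integral_mono)
    fix s :: real
    have "ennreal (2 * s * G s) \<le> 2 * ennreal (G s)" if "0 < s" "s < 1"
    proof -
      have "2 * s * G s \<le> 2 * G s" using that G0[of s] by (simp add: mult_left_le_one_le)
      then have "ennreal (2 * s * G s) \<le> ennreal (2 * G s)" by (rule ennreal_leI)
      then show ?thesis by (simp add: ennreal_mult' G0)
    qed
    then show "ennreal (2 * s * G s) * indicator {0<..<1} s * indicator {r<..} s \<le> 2 * (ennreal (G s) * indicator {0<..<1} s * indicator {r<..} s)"
      by (auto split: split_indicator)
  qed
  then show ?thesis by (simp add: nn_integral_cmult)
qed

lemma radial_measure_tail_ge:
  assumes "1/2 \<le> r"
  shows "(\<integral>\<^sup>+s. ennreal (G s) * indicator {0<..<1} s * indicator {r<..} s \<partial>lborel) \<le> emeasure (radial_measure G) {z. r < cmod z}"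
  unfolding radial_measure_tail
proof (intro nn_integral_mono)
  fix s :: real
  have "ennreal (G s) \<le> ennreal (2 * s * G s)" if "r < s"
    using that G0[of s] assms mult_right_mono[of 1 "2 * s" "G s"] by (intro ennreal_leI) auto
  then show "ennreal (G s) * indicator {0<..<1} s * indicator {r<..} s \<le> ennreal (2 * s * G s) * indicator {0<..<1} s * indicator {r<..} s"
    by (auto split: split_indicator)
qed

lemma nn_integral_radial_measure:
  assumes [measurable]: "\<omega> \<in> borel_measurable (lebesgue_on (ball 0 1))" "h \<in> borel_measurable borel"
    and AE: "AE z in lborel. z \<in> ball 0 1 \<longrightarrow> \<omega> z = G (cmod z)"
  shows "(\<integral>\<^sup>+z. h z * ennreal (\<omega> z) \<partial>area_measure) = (\<integral>\<^sup>+z. h z \<partial>radial_measure G)"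
proof -
  have [measurable]: "h \<in> borel_measurable (lebesgue_on (ball 0 1))"
    by (intro measurable_restrict_space1 measurable_completion) simp
  have "(\<integral>\<^sup>+z. h z * ennreal (\<omega> z) \<partial>area_measure) = ennreal (1/pi) * (\<integral>\<^sup>+z. h z * ennreal (\<omega> z) \<partial>lebesgue_on (ball 0 1))"
    unfolding area_measure_def by (rule nn_integral_scale_measure) simp
  also have "(\<integral>\<^sup>+z. h z * ennreal (\<omega> z) \<partial>lebesgue_on (ball 0 1)) = (\<integral>\<^sup>+z. h z * ennreal (\<omega> z) * indicator (ball 0 1) z \<partial>lebesgue)"
    by (subst nn_integral_restrict_space) auto
  also have "\<dots> = (\<integral>\<^sup>+z. h z * ennreal (G (cmod z)) * indicator (ball 0 1) z \<partial>lebesgue)"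
    using AE_completion[OF AE] by (intro nn_integral_cong_AE) (auto elim!: eventually_mono split: split_indicator)
  also have "\<dots> = (\<integral>\<^sup>+z. h z * ennreal (G (cmod z)) * indicator (ball 0 1) z \<partial>lborel)"
    by (rule nn_integral_completion)
  also have "ennreal (1/pi) * \<dots> = (\<integral>\<^sup>+z. ennreal (1/pi) * (h z * ennreal (G (cmod z)) * indicator (ball 0 1) z) \<partial>lborel)"
    by (rule nn_integral_cmult[symmetric]) simp
  also have "\<dots> = (\<integral>\<^sup>+z. (ennreal (G (cmod z) / pi) * indicator (ball 0 1) z) * h z \<partial>lborel)"
  proof (intro nn_integral_cong)
    fix z :: complex
    have "ennreal (G (cmod z) / pi) = ennreal (1/pi) * ennreal (G (cmod z))"
      by (subst ennreal_mult[symmetric]) (auto simp: G0)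
    then show "ennreal (1/pi) * (h z * ennreal (G (cmod z)) * indicator (ball 0 1) z)
        = (ennreal (G (cmod z) / pi) * indicator (ball 0 1) z) * h z"
      by (simp only: mult_ac)
  qed
  also have "\<dots> = (\<integral>\<^sup>+z. h z \<partial>radial_measure G)"
    unfolding radial_measure_def by (subst nn_integral_density) auto
  finally show ?thesis .
qed

end

lemma weight_tail_profile:
  assumes [measurable]: "G \<in> borel_measurable borel" and r: "0 \<le> r" "r < 1"
    and AE: "AE r in lborel. r \<in> {0<..<1} \<longrightarrow> \<omega> (of_real r) = G r"
  shows "weight_tail \<omega> (of_real r) = (\<integral>\<^sup>+s. ennreal (G s) * indicator {0<..<1} s * indicator {r<..} s \<partial>lborel)"
proof -
  have "AE s in lborel. s \<noteq> r" by (rule AE_lborel_singleton)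
  then have "AE s in lborel. ennreal (\<omega> (of_real s)) * indicator {r..<1} s
      = ennreal (G s) * indicator {0<..<1} s * indicator {r<..} s"
    using AE by eventually_elim (use r in \<open>auto split: split_indicator\<close>)
  then have "weight_tail \<omega> (of_real r) = (\<integral>\<^sup>+s. ennreal (G s) * indicator {0<..<1} s * indicator {r<..} s \<partial>lebesgue)"
    unfolding weight_tail_def using r by (intro nn_integral_cong_AE AE_completion) auto
  then show ?thesis by (simp add: nn_integral_completion)
qed

lemma measurable_of_weight: "weight \<omega> \<Longrightarrow> \<omega> \<in> borel_measurable (lebesgue_on (ball 0 1))"
  unfolding weight_def area_measure_def using borel_measurable_integrable by force

text \<open>
  For \<open>r = max 0 (1 - 2t)\<close> the midpoint \<open>(1 + r)/2\<close> is at least \<open>1/2\<close> and at least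
  \<open>1 - t\<close>, so doubling of the tail integral transfers to planar tails with twice the constant. The truncation
  at \<open>0\<close> is harmless, because the origin has measure zero.
\<close>

lemma doubling_weight_measure:
  assumes "\<omega> \<in> doubling_weights"
  obtains \<mu> D where "doubling_disc_measure \<mu> D"
    "\<And>h. h \<in> borel_measurable borel \<Longrightarrow> (\<integral>\<^sup>+z. h z * ennreal (\<omega> z) \<partial>area_measure) = (\<integral>\<^sup>+z. h z \<partial>\<mu>)"
proof -
  have w: "weight \<omega>" and rad: "\<And>z. cmod z < 1 \<Longrightarrow> \<omega> z = \<omega> (of_real (cmod z))"
    and nz: "\<not> (AE z in area_measure. \<omega> z = 0)"
    proof -
    from assms have r: "radial_weight \<omega>" by (simp add: doubling_weights_def)
    then show "weight \<omega>" "\<not> (AE z in area_measure. \<omega> z = 0)" by (simp_all add: radial_weight_def)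
    show "\<omega> z = \<omega> (of_real (cmod z))" if "cmod z < 1" for z
      using r that unfolding radial_weight_def by (metis dist_0_norm mem_ball)
  qed
  obtain C where C: "1 \<le> C"
      "\<And>r. 0 \<le> r \<Longrightarrow> r < 1 \<Longrightarrow> weight_tail \<omega> (of_real r) \<le> ennreal C * weight_tail \<omega> (of_real ((1 + r) / 2))"
  proof -
    obtain C where "1 \<le> C" "\<forall>r\<in>{0..<1}. weight_tail \<omega> (of_real r) \<le> ennreal C * weight_tail \<omega> (of_real ((1 + r) / 2))"
      using assms unfolding doubling_weights_def by blast
    then show thesis by (intro that[of C]) auto
  qed
  note meas = measurable_of_weight[OF w]
  have w0: "0 \<le> \<omega> z" if "cmod z < 1" for z using w that by (auto simp: weight_def)
  obtain G where G: "G \<in> borel_measurable borel" "\<And>r. 0 \<le> G r"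
    "AE r in lborel. r \<in> {0<..<1} \<longrightarrow> \<omega> (of_real r) = G r"
    "AE z in lborel. z \<in> ball 0 1 \<longrightarrow> \<omega> z = G (cmod z)"
    by (rule radial_borel_profile[OF meas w0 rad]) (auto intro: that)
  define \<mu> where "\<mu> = radial_measure G"
  have int: "(\<integral>\<^sup>+z. h z * ennreal (\<omega> z) \<partial>area_measure) = (\<integral>\<^sup>+z. h z \<partial>\<mu>)" if "h \<in> borel_measurable borel" for h
    unfolding \<mu>_def by (rule nn_integral_radial_measure[OF G(1,2) meas that G(4)])
  have total: "emeasure \<mu> UNIV = (\<integral>\<^sup>+z. ennreal (\<omega> z) \<partial>area_measure)"
    using int[of "\<lambda>_. 1"] by (simp add: \<mu>_def space_radial_measure[OF G(1,2)])
  have fin: "emeasure \<mu> UNIV < \<infinity>"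
  proof -
    have "integrable area_measure \<omega>" using w by (simp add: weight_def)
    then have "(\<integral>\<^sup>+z. ennreal (norm (\<omega> z)) \<partial>area_measure) < \<infinity>" by (simp add: integrable_iff_bounded)
    moreover have "(\<integral>\<^sup>+z. ennreal (\<omega> z) \<partial>area_measure) \<le> (\<integral>\<^sup>+z. ennreal (norm (\<omega> z)) \<partial>area_measure)"
      by (intro nn_integral_mono ennreal_leI) auto
    ultimately show ?thesis by (simp add: total)
  qed
  interpret finite_measure \<mu>
    using fin by (intro finite_measureI) (simp add: \<mu>_def space_radial_measure[OF G(1,2)])
  have nontriv: "0 < measure \<mu> UNIV"
  proof (rule ccontr)
    assume "\<not> 0 < measure \<mu> UNIV"
    then have "emeasure \<mu> UNIV = 0" by (simp add: emeasure_eq_measure zero_less_measure_iff)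
    moreover have "(\<lambda>z. ennreal (\<omega> z)) \<in> borel_measurable area_measure"
      using w by (auto simp: weight_def)
    ultimately have "AE z in area_measure. ennreal (\<omega> z) = 0"
      by (simp add: total nn_integral_0_iff_AE)
    moreover have "AE z in area_measure. z \<in> space area_measure" by (rule AE_space)
    ultimately have "AE z in area_measure. \<omega> z = 0"
      by eventually_elim (use w0 in \<open>auto simp: ennreal_eq_0_iff area_measure_def space_scale_measure space_restrict_space intro: antisym\<close>)
    then show False using nz by simp
  qed
  define W where "W r = (\<integral>\<^sup>+s. ennreal (G s) * indicator {0<..<1} s * indicator {r<..} s \<partial>lborel)" for r
  have W: "weight_tail \<omega> (of_real r) = W r" if "0 \<le> r" "r < 1" for r
    unfolding W_def by (rule weight_tail_profile[OF G(1) that G(3)])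
  have dbl: "measure \<mu> {z. 1 - 2 * t < cmod z} \<le> 2 * C * measure \<mu> {z. 1 - t < cmod z}"
    if t: "0 < t" "t \<le> 1" for t
  proof -
    define r where "r = max 0 (1 - 2 * t)"
    have r: "0 \<le> r" "r < 1" "1/2 \<le> (1 + r) / 2" "(1 + r) / 2 < 1" "1 - t \<le> (1 + r) / 2"
      using t by (auto simp: r_def)
    have "emeasure \<mu> {z. 1 - 2 * t < cmod z} = emeasure \<mu> {z. r < cmod z}"
      using radial_measure_tail_nonpos[OF G(1,2), of "1 - 2 * t"] radial_measure_tail_nonpos[OF G(1,2), of 0]
      unfolding r_def \<mu>_def by (cases "0 \<le> 1 - 2 * t") (simp_all only: max.absorb1 max.absorb2 linear)
    also have "\<dots> \<le> 2 * W r" unfolding \<mu>_def W_def by (rule radial_measure_tail_le[OF G(1,2)])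
    also have "W r \<le> ennreal C * W ((1 + r) / 2)" using C(2)[OF r(1,2)] W[of r] W[of "(1 + r) / 2"] r by (simp del: of_real_divide of_real_add)
    also have "W ((1 + r) / 2) \<le> emeasure \<mu> {z. (1 + r) / 2 < cmod z}"
      unfolding W_def \<mu>_def by (rule radial_measure_tail_ge[OF G(1,2) r(3)])
    also have "\<dots> \<le> emeasure \<mu> {z. 1 - t < cmod z}"
      using r(5) by (intro emeasure_mono) (auto simp: \<mu>_def sets_radial_measure[OF G(1,2)])
    finally have "emeasure \<mu> {z. 1 - 2 * t < cmod z} \<le> 2 * (ennreal C * emeasure \<mu> {z. 1 - t < cmod z})"
      by (simp add: mult_left_mono)
    also have "\<dots> = ennreal (2 * C * measure \<mu> {z. 1 - t < cmod z})"
      using C(1) by (simp add: emeasure_eq_measure ennreal_mult mult.assoc)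
    finally show ?thesis using C(1) by (simp add: emeasure_eq_measure)
  qed
  have "doubling_disc_measure \<mu> (2 * C)"
    using fin nontriv dbl
    by unfold_locales
       (auto simp: \<mu>_def sets_radial_measure[OF G(1,2)] radial_measure_outside[OF G(1,2)] radial_measure_rotation[OF G(1,2)])
  then show ?thesis using that int by blast
qed

section \<open>Means of powers of holomorphic functions\<close>

text \<open>
  A zero-free \<open>f\<close> has the form \<open>exp l\<close>, so \<open>exp (p l)\<close> is holomorphic with modulus \<open>|f|\<^sup>p\<close>, and
  Cauchy's formula applies to it with kernel bounded by \<open>1 / (1 - |b|)\<close>. Zeros on the unit circle are allowed;
  they are avoided by working on smaller circles and passing to the limit.
\<close>

lemma power_mean_zero_free:
  fixes f :: "complex \<Rightarrow> complex"
  assumes holf: "f holomorphic_on ball 0 1" and contf: "continuous_on (cball 0 1) f"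
    and nz: "\<And>z. cmod z < 1 \<Longrightarrow> f z \<noteq> 0" and b: "cmod b < 1" and p: "0 < p"
  shows "2 * pi * (1 - cmod b) * cmod (f b) powr p
           \<le> integral {0..2*pi} (\<lambda>t. cmod (f (cis t)) powr p)"
proof -
  obtain l where l: "l holomorphic_on ball 0 1" "\<And>z. z \<in> ball 0 1 \<Longrightarrow> exp (l z) = f z"
    using holomorphic_logarithm_exists[of "ball 0 1" f 0] holf nz by auto
  define g where "g z = exp (of_real p * l z)" for z
  have holg: "g holomorphic_on ball 0 1"
    unfolding g_def by (intro holomorphic_intros l)
  have normg: "cmod (g z) = cmod (f z) powr p" if "cmod z < 1" for z
  proof -
    have "cmod (f z) = exp (Re (l z))" using l(2)[of z] that by (metis dist_0_norm mem_ball norm_exp_eq_Re)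
    then show ?thesis by (simp add: g_def powr_def mult.commute)
  qed
  \<comment> \<open>The inequality on the circle of radius \<open>s < 1\<close>, where \<open>g\<close> is holomorphic up to the boundary.\<close>
  have inner: "2 * pi * (1 - cmod b) * cmod (f (of_real s * b)) powr p
      \<le> integral {0..2*pi} (\<lambda>t. cmod (f (of_real s * cis t)) powr p)"
    if s: "s \<in> {0<..<1}" for s
  proof -
    have sb: "cmod (of_real s * z) < 1" if "cmod z \<le> 1" for z
    proof -
      have "s * cmod z \<le> s * 1" using that s by (intro mult_left_mono) auto
      moreover have "s < 1" using s by auto
      ultimately have "s * cmod z < 1" by linarith
      then show ?thesis using s by (simp add: norm_mult)
    qed
    define G where "G z = g (of_real s * z)" for z
    have holG: "G holomorphic_on cball 0 1"
      unfolding G_def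
      by (rule holomorphic_on_compose_gen[OF _ holg, unfolded o_def]) (auto intro!: holomorphic_intros sb)
    have "((\<lambda>u. G u / (u - b)) has_contour_integral (2 * of_real pi * \<i> * G b)) (part_circlepath 0 1 0 (2 * pi))"
      using Cauchy_integral_circlepath_simple[OF holG, of b] b by (simp add: circlepath_def)
    then have int: "((\<lambda>t. G (cis t) / (cis t - b) * \<i> * cis t) has_integral (2 * of_real pi * \<i> * G b)) {0..2*pi}"
      by (subst (asm) has_contour_integral_part_circlepath_iff) auto
    have contG: "continuous_on {0..2*pi} (\<lambda>t. cmod (G (cis t)))"
      by (intro continuous_intros continuous_on_compose2[OF holomorphic_on_imp_continuous_on[OF holG]]) auto
    have "cmod (2 * of_real pi * \<i> * G b) \<le> integral {0..2*pi} (\<lambda>t. cmod (G (cis t)) / (1 - cmod b))"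
      unfolding integral_unique[OF int, symmetric]
    proof (rule integral_norm_bound_integral)
      show "(\<lambda>t. cmod (G (cis t)) / (1 - cmod b)) integrable_on {0..2*pi}"
        using b by (intro integrable_continuous_real continuous_on_divide[OF contG continuous_on_const]) auto
      show "cmod (G (cis t) / (cis t - b) * \<i> * cis t) \<le> cmod (G (cis t)) / (1 - cmod b)" for t
      proof -
        have "1 - cmod b \<le> cmod (cis t - b)" using norm_triangle_ineq2[of "cis t" b] by simp
        moreover have "0 < 1 - cmod b" using b by simp
        ultimately have "cmod (G (cis t)) / cmod (cis t - b) \<le> cmod (G (cis t)) / (1 - cmod b)"
          by (intro divide_left_mono mult_pos_pos) auto
        then show ?thesis by (simp add: norm_mult norm_divide)
      qed
    qed (use int in auto)
    also have "\<dots> = integral {0..2*pi} (\<lambda>t. cmod (G (cis t))) / (1 - cmod b)"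
      by simp
    finally have "2 * pi * (1 - cmod b) * cmod (G b) \<le> integral {0..2*pi} (\<lambda>t. cmod (G (cis t)))"
      using b by (simp add: norm_mult field_simps)
    then show ?thesis using sb b by (simp add: G_def normg)
  qed
  define H where "H s = integral {0..2*pi} (\<lambda>t. cmod (f (of_real s * cis t)) powr p)
     - 2 * pi * (1 - cmod b) * cmod (f (of_real s * b)) powr p" for s
  have cb: "cmod (of_real s * z) \<le> 1" if "cmod z \<le> 1" "0 \<le> s" "s \<le> 1" for s z
    using mult_mono[of s 1 "cmod z" 1] that by (simp add: norm_mult)
  have cont: "continuous_on A (\<lambda>x. cmod (f (h x)) powr p)"
    if "continuous_on A h" "\<And>x. x \<in> A \<Longrightarrow> cmod (h x) \<le> 1" for A :: "'a::topological_space set" and h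
    using that p by (intro continuous_on_powr' continuous_intros continuous_on_compose2[OF contf]) auto
  have "continuous_on ({0..1} \<times> cbox 0 (2*pi)) (\<lambda>x. cmod (f (of_real (fst x) * cis (snd x))) powr p)"
    by (rule cont) (auto intro!: cb continuous_intros)
  then have "continuous_on {0..1} (\<lambda>s. integral (cbox 0 (2*pi)) (\<lambda>t. cmod (f (of_real s * cis t)) powr p))"
    by (intro integral_continuous_on_param) (simp add: case_prod_unfold)
  moreover have "continuous_on {0..1} (\<lambda>s. cmod (f (of_real s * b)) powr p)"
    by (rule cont) (use b in \<open>auto intro!: cb continuous_intros\<close>)
  ultimately have "continuous_on {0..1} H"
    unfolding H_def cbox_interval[symmetric] by (intro continuous_on_diff continuous_on_mult_left)
  moreover have "0 \<le> H s" if "s \<in> {0<..<1}" for s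
    using inner[OF that] by (simp add: H_def)
  moreover have "closure {0<..<1::real} = {0..1}" by (rule closure_greaterThanLessThan) simp
  ultimately have "0 \<le> H 1"
    using continuous_ge_on_closure[of "{0<..<1}" H 1 0] by simp
  then show ?thesis by (simp add: H_def)
qed

lemma cmod_Blaschke_identity:
  "(cmod (1 - cnj \<zeta> * w))\<^sup>2 - (cmod (w - \<zeta>))\<^sup>2 = (1 - (cmod \<zeta>)\<^sup>2) * (1 - (cmod w)\<^sup>2)"
  unfolding cmod_power2 by (simp add: power2_eq_square algebra_simps)

text \<open>
  Dividing \<open>f\<close> by the Blaschke factor of one of its zeros, raised to the multiplicity, removes that
  zero, leaves the modulus on the circle unchanged and increases it inside. So the inequality for the
  quotient implies the one for \<open>f\<close>.
\<close>

lemma power_mean_finite_zeros: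
  fixes f :: "complex \<Rightarrow> complex"
  assumes "f holomorphic_on ball 0 R" "1 < R" "finite {z. cmod z < 1 \<and> f z = 0}"
    and b: "cmod b < 1" and p: "0 < p"
  shows "2 * pi * (1 - cmod b) * cmod (f b) powr p
           \<le> integral {0..2*pi} (\<lambda>t. cmod (f (cis t)) powr p)"
  using assms(1-3)
proof (induction "card {z. cmod z < 1 \<and> f z = 0}" arbitrary: f)
  case 0
  then have "{z. cmod z < 1 \<and> f z = 0} = {}" by simp
  moreover have "f holomorphic_on cball 0 1" "f holomorphic_on ball 0 1"
    using 0 by (auto elim!: holomorphic_on_subset)
  ultimately show ?case
    by (intro power_mean_zero_free b p) (auto intro: holomorphic_on_imp_continuous_on)
next
  case (Suc m)
  then obtain \<zeta> where \<zeta>: "cmod \<zeta> < 1" "f \<zeta> = 0"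
    by (metis (mono_tags, lifting) card.empty empty_Collect_eq nat.distinct(1))
  have sub: "ball 0 1 \<subseteq> ball (0::complex) R" using \<open>1 < R\<close> by auto
  have nonconst: "\<not> f constant_on ball 0 R"
  proof
    assume "f constant_on ball 0 R"
    then obtain c where "\<And>z. z \<in> ball 0 R \<Longrightarrow> f z = c" unfolding constant_on_def by blast
    moreover have "\<zeta> \<in> ball 0 R" using \<zeta>(1) sub by auto
    ultimately have "f z = 0" if "z \<in> ball 0 1" for z
      using \<zeta>(2) sub that by (metis subsetD)
    then have "ball 0 1 \<subseteq> {z. cmod z < 1 \<and> f z = 0}" by auto
    then have "finite (ball (0::complex) 1)" using Suc.prems(3) finite_subset by blast
    then show False using uncountable_ball[of 1 "0::complex"] by (simp add: countable_finite)
  qed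
  have \<zeta>R: "\<zeta> \<in> ball 0 R" using \<zeta>(1) sub by auto
  obtain g r k where g: "0 < k" "0 < r" "ball \<zeta> r \<subseteq> ball 0 R" "g holomorphic_on ball \<zeta> r"
      "\<And>w. w \<in> ball \<zeta> r \<Longrightarrow> f w = (w - \<zeta>) ^ k * g w" "\<And>w. w \<in> ball \<zeta> r \<Longrightarrow> g w \<noteq> 0"
    by (rule holomorphic_factor_zero_nonconstant[OF Suc.prems(1) open_ball connected_ball \<zeta>R \<zeta>(2) nonconst]) (rule that)
  define q where "q w = (if w \<in> ball \<zeta> r then g w else f w / (w - \<zeta>) ^ k)" for w
  have q: "f w = (w - \<zeta>) ^ k * q w" for w
    using g(2) by (auto simp: q_def g(5))
  have q': "q w = f w / (w - \<zeta>) ^ k" if "w \<noteq> \<zeta>" for w using q[of w] that by simp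
  have "q holomorphic_on ball \<zeta> r \<union> (ball 0 R - {\<zeta>})"
  proof (rule holomorphic_on_Un)
    show "q holomorphic_on ball \<zeta> r"
      using g(4) by (rule holomorphic_transform) (auto simp: q_def)
    show "q holomorphic_on ball 0 R - {\<zeta>}"
      by (rule holomorphic_transform[of "\<lambda>w. f w / (w - \<zeta>) ^ k"])
         (auto simp: q' intro!: holomorphic_intros holomorphic_on_subset[OF Suc.prems(1)])
  qed auto
  moreover have "ball \<zeta> r \<union> (ball 0 R - {\<zeta>}) = ball 0 R" using g(2,3) by auto
  ultimately have holq: "q holomorphic_on ball 0 R" by simp
  \<comment> \<open>\<open>F\<close> is \<open>f\<close> divided by the \<open>k\<close>-th power of the Blaschke factor at \<open>\<zeta>\<close>, with the singularity removed.\<close>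
  define F where "F w = (1 - cnj \<zeta> * w) ^ k * q w" for w
  have holF: "F holomorphic_on ball 0 R" unfolding F_def by (intro holomorphic_intros holq)
  have \<zeta>2: "(cmod \<zeta>)\<^sup>2 < 1" using \<zeta>(1) by (simp add: abs_square_less_1)
  have lower: "cmod (w - \<zeta>) < cmod (1 - cnj \<zeta> * w)" if "cmod w < 1" for w
  proof -
    have "0 < (1 - (cmod \<zeta>)\<^sup>2) * (1 - (cmod w)\<^sup>2)"
      using \<zeta>2 that by (intro mult_pos_pos) (auto simp: abs_square_less_1)
    then show ?thesis unfolding cmod_Blaschke_identity[symmetric] by (simp add: power2_less_imp_less)
  qed
  have circ: "cmod (F w) = cmod (f w)" if "cmod w = 1" for w
  proof -
    have "cmod (1 - cnj \<zeta> * w) = cmod (w - \<zeta>)"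
      using cmod_Blaschke_identity[of \<zeta> w] that by (simp add: power2_eq_iff_nonneg)
    then show ?thesis by (simp add: F_def q[of w] norm_mult norm_power)
  qed
  have le: "cmod (f w) \<le> cmod (F w)" if "cmod w < 1" for w
    unfolding F_def q[of w] norm_mult norm_power
    using lower[OF that] by (intro mult_right_mono power_mono) auto
  have "{z. cmod z < 1 \<and> F z = 0} = {z. cmod z < 1 \<and> f z = 0} - {\<zeta>}"
  proof -
    have "q \<zeta> \<noteq> 0" using g(2,6) by (auto simp: q_def)
    moreover have "1 - cnj \<zeta> * z \<noteq> 0" if "cmod z < 1" for z
      using lower[OF that] by fastforce
    ultimately show ?thesis using g(1) by (auto simp: F_def q)
  qed
  then have fin: "finite {z. cmod z < 1 \<and> F z = 0}" and card: "m = card {z. cmod z < 1 \<and> F z = 0}"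
    using Suc.prems(3) Suc.hyps(2) \<zeta> by (auto simp: card_Diff_singleton)
  have "2 * pi * (1 - cmod b) * cmod (f b) powr p \<le> 2 * pi * (1 - cmod b) * cmod (F b) powr p"
    using le[OF b] b p by (intro mult_left_mono powr_mono2) auto
  also have "\<dots> \<le> integral {0..2*pi} (\<lambda>t. cmod (F (cis t)) powr p)"
    by (rule Suc.hyps(1)[OF card holF \<open>1 < R\<close> fin])
  finally show ?case by (simp add: circ)
qed

lemma power_mean_disc:
  fixes f :: "complex \<Rightarrow> complex"
  assumes holf: "f holomorphic_on ball 0 R" and R: "1 < R"
    and b: "cmod b < 1" and p: "0 < p"
  shows "2 * pi * (1 - cmod b) * cmod (f b) powr p
           \<le> integral {0..2*pi} (\<lambda>t. cmod (f (cis t)) powr p)"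
proof (cases "f constant_on ball 0 R")
  case False
  have "finite {z \<in> cball 0 1. f z = 0}"
  proof (rule holomorphic_compact_finite_zeros[OF holf open_ball connected_ball compact_cball _ False])
    show "cball (0::complex) 1 \<subseteq> ball 0 R" using R by (auto intro: le_less_trans)
  qed
  then have "finite {z. cmod z < 1 \<and> f z = 0}" by (rule finite_subset[rotated]) auto
  then show ?thesis by (rule power_mean_finite_zeros[OF holf R _ b p])
next
  case True
  then obtain c where "\<forall>z\<in>ball 0 R. f z = c" unfolding constant_on_def by blast
  then have c: "f z = c" if "cmod z < R" for z using that by simp
  then have "f b = c" "f (cis t) = c" for t using b R by auto
  moreover have "2 * pi * (1 - cmod b) * cmod c powr p \<le> 2 * pi * 1 * cmod c powr p"
    by (intro mult_right_mono mult_left_mono) auto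
  ultimately show ?thesis by simp
qed

text \<open>
  The substitution \<open>w \<mapsto> f(w z)\<close> turns the circle through \<open>z\<close> into the unit circle and \<open>a\<close> into
  \<open>a / z\<close>.
\<close>

lemma power_mean_circle:
  fixes f :: "complex \<Rightarrow> complex"
  assumes holf: "f holomorphic_on ball 0 1" and az: "cmod a < cmod z" and z: "cmod z < 1" and p: "0 < p"
  shows "2 * pi * (1 - cmod a / cmod z) * cmod (f a) powr p
           \<le> integral {0..2*pi} (\<lambda>t. cmod (f (cis t * z)) powr p)"
proof -
  have z0: "z \<noteq> 0" using az by auto
  have "(\<lambda>w. f (w * z)) holomorphic_on ball 0 (1 / cmod z)"
    using z0
    by (intro holomorphic_on_compose_gen[of "\<lambda>w. w * z" _ f "ball 0 1", unfolded o_def] holf holomorphic_intros)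
       (auto simp: norm_mult field_simps)
  from power_mean_disc[OF this _ _ p, of "a / z"] show ?thesis
    using z0 z az by (simp add: norm_divide)
qed

section \<open>Angles of Carleson squares\<close>

lemma borel_measurable_Arg [measurable]: "Arg \<in> borel_measurable borel"
proof -
  have meas: "\<real>\<^sub>\<le>\<^sub>0 \<in> sets (borel :: complex measure)" by (rule borel_closed) (rule closed_nonpos_Reals_complex)
  have "(\<lambda>z. if z \<in> - \<real>\<^sub>\<le>\<^sub>0 then Arg z else if z \<in> {0} then 0 else pi) \<in> borel_measurable borel"
  proof (subst measurable_If_restrict_space_iff)
    show "Arg \<in> borel_measurable (restrict_space borel {z. z \<in> - \<real>\<^sub>\<le>\<^sub>0}) \<and>
      (\<lambda>z::complex. if z \<in> {0} then 0 else pi) \<in> borel_measurable (restrict_space borel {z. \<not> z \<in> - \<real>\<^sub>\<le>\<^sub>0})"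
    proof
      show "Arg \<in> borel_measurable (restrict_space borel {z. z \<in> - \<real>\<^sub>\<le>\<^sub>0})"
        by (rule borel_measurable_continuous_on_restrict) (use continuous_on_Arg in \<open>simp add: Compl_eq\<close>)
      have "(\<lambda>z::complex. if z \<in> {0} then 0 else pi) \<in> borel_measurable borel"
        by (rule measurable_If_set) auto
      then show "(\<lambda>z::complex. if z \<in> {0} then 0 else pi) \<in> borel_measurable (restrict_space borel {z. \<not> z \<in> - \<real>\<^sub>\<le>\<^sub>0})"
        by (rule measurable_restrict_space1)
    qed
  qed (use borel_comp[OF meas] in \<open>simp add: Compl_eq\<close>)
  moreover have "(\<lambda>z. if z \<in> - \<real>\<^sub>\<le>\<^sub>0 then Arg z else if z \<in> {0} then 0 else pi) = Arg"
  proof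
    fix z show "(if z \<in> - \<real>\<^sub>\<le>\<^sub>0 then Arg z else if z \<in> {0} then 0 else pi) = Arg z"
    proof (cases "z \<in> \<real>\<^sub>\<le>\<^sub>0 \<and> z \<noteq> 0")
      case True
      then obtain x where "z = of_real x" "x < 0" by (auto simp: nonpos_Reals_def less_le)
      then show ?thesis using True by (simp add: Arg_of_real)
    qed (auto simp: Arg_zero)
  qed
  ultimately show ?thesis by simp
qed

lemma carleson_square_measurable [measurable]: "carleson_square a \<in> sets borel"
proof (cases "a = 0")
  case False
  have "{\<zeta> \<in> space borel. cmod \<zeta> < 1 \<and> cmod a < cmod \<zeta> \<and>
      (\<exists>k::int. \<bar>Arg \<zeta> - Arg a - 2 * pi * of_int k\<bar> < (1 - cmod a) / 2)} \<in> sets borel"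
    by measurable
  then show ?thesis using False by (simp add: carleson_square_def)
qed (simp add: carleson_square_def)

lemma Arg_cis_mult:
  assumes "z \<noteq> 0"
  obtains m :: int where "Arg (cis t * z) = t + Arg z + 2 * pi * of_int m"
proof -
  have "cis (Arg (cis t * z)) = cis (t + Arg z)"
    using assms by (simp add: cis_Arg sgn_mult cis_mult[symmetric])
  then have "exp (\<i> * of_real (Arg (cis t * z))) = exp (\<i> * of_real (t + Arg z))"
    by (simp add: cis_conv_exp)
  then obtain m :: int where "\<i> * of_real (Arg (cis t * z)) = \<i> * of_real (t + Arg z) + (of_int (2 * m) * pi) * \<i>"
    unfolding exp_eq by blast
  from arg_cong[OF this, of Im] have "Arg (cis t * z) = t + Arg z + of_int (2 * m) * pi"
    by simp
  then have "Arg (cis t * z) = t + Arg z + 2 * pi * of_int m" by simp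
  then show ?thesis by (rule that)
qed

text \<open>
  Along a circle, membership in a Carleson square is a condition on the rotation angle alone,
  modulo \<open>2\<pi>\<close>.
\<close>

lemma carleson_square_angle:
  assumes "a \<noteq> 0" "cmod a < cmod z" "cmod z < 1"
  shows "cis t * z \<in> carleson_square a \<longleftrightarrow>
    (\<exists>k::int. \<bar>t + (Arg z - Arg a) - 2 * pi * of_int k\<bar> < (1 - cmod a) / 2)"
proof -
  have "z \<noteq> 0" using assms(2) by auto
  then obtain m :: int where m: "Arg (cis t * z) = t + Arg z + 2 * pi * of_int m" by (rule Arg_cis_mult)
  have eq: "Arg (cis t * z) - Arg a - 2 * pi * of_int k = t + (Arg z - Arg a) - 2 * pi * of_int (k - m)" for k
    unfolding m by (simp add: algebra_simps)
  have "(\<exists>k::int. \<bar>Arg (cis t * z) - Arg a - 2 * pi * of_int k\<bar> < (1 - cmod a) / 2)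
    \<longleftrightarrow> (\<exists>k::int. \<bar>t + (Arg z - Arg a) - 2 * pi * of_int k\<bar> < (1 - cmod a) / 2)"
    unfolding eq by (metis add_diff_cancel_right')
  then show ?thesis using assms by (simp add: carleson_square_def norm_mult)
qed

text \<open>
  Up to the end points of \<open>[0, 2\<pi>]\<close> this is one arc of length \<open>2\<delta>\<close>. The arc may be cut
  at the end points, so a sub-interval of length \<open>\<delta>\<close> is exhibited for the lower bound and four translates
  cover it for the upper bound.
\<close>

lemma emeasure_angles_near:
  fixes c \<delta> :: real
  assumes c: "\<bar>c\<bar> < 2 * pi" and \<delta>: "0 < \<delta>" "\<delta> \<le> 1"
  defines "T \<equiv> {t \<in> {0..2*pi}. \<exists>k::int. \<bar>t + c - 2 * pi * of_int k\<bar> < \<delta>}"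
  shows "T \<in> sets borel" "ennreal \<delta> \<le> emeasure lborel T" "emeasure lborel T \<le> ennreal (8 * \<delta>)"
proof -
  have "{t \<in> space borel. t \<in> {0..2*pi} \<and> (\<exists>k::int. \<bar>t + c - 2 * pi * of_int k\<bar> < \<delta>)} \<in> sets borel"
    by measurable
  then show T: "T \<in> sets borel" by (simp add: T_def)
  have "T \<subseteq> (\<Union>k\<in>{-1,0,1,2::int}. {2 * pi * of_int k - c - \<delta>..2 * pi * of_int k - c + \<delta>})"
  proof
    fix t assume "t \<in> T"
    then obtain k :: int where t: "0 \<le> t" "t \<le> 2 * pi" and k: "\<bar>t + c - 2 * pi * of_int k\<bar> < \<delta>"
      by (auto simp: T_def)
    have "1 < pi" using pi_gt3 by simp
    have "2 * pi * of_int k > 2 * pi * (-2)" "2 * pi * of_int k < 2 * pi * 3"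
      using k t c \<delta> \<open>1 < pi\<close> by linarith+
    then have "of_int k > (-2::real)" "of_int k < (3::real)"
      using pi_gt_zero by (simp_all only: mult_less_cancel_left_pos mult_pos_pos zero_less_numeral)
    then have "k \<in> {-1,0,1,2}" by auto
    then show "t \<in> (\<Union>k\<in>{-1,0,1,2::int}. {2 * pi * of_int k - c - \<delta>..2 * pi * of_int k - c + \<delta>})"
      using k by (intro UN_I[of k]) (auto simp: abs_less_iff)
  qed
  then have "emeasure lborel T \<le> emeasure lborel (\<Union>k\<in>{-1,0,1,2::int}. {2 * pi * of_int k - c - \<delta>..2 * pi * of_int k - c + \<delta>})"
    by (intro emeasure_mono) auto
  also have "\<dots> \<le> (\<Sum>k\<in>{-1,0,1,2::int}. emeasure lborel {2 * pi * of_int k - c - \<delta>..2 * pi * of_int k - c + \<delta>})"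
    by (intro emeasure_subadditive_finite) auto
  also have "\<dots> = (\<Sum>k\<in>{-1,0,1,2::int}. ennreal (2 * \<delta>))"
    using \<delta> by (intro sum.cong) auto
  also have "\<dots> = ennreal (8 * \<delta>)"
  proof -
    have "ennreal (8 * \<delta>) = ennreal 4 * ennreal (2 * \<delta>)"
      using \<delta> by (subst ennreal_mult[symmetric]) auto
    then show ?thesis by simp
  qed
  finally show "emeasure lborel T \<le> ennreal (8 * \<delta>)" .
  \<comment> \<open>This \<open>k\<close> puts the centre \<open>2\<pi>k - c\<close> of an arc into \<open>[0, 2\<pi>)\<close>.\<close>
  define k where "k = \<lceil>c / (2 * pi)\<rceil>"
  define x where "x = 2 * pi * of_int k - c"
  have "c / (2 * pi) \<le> of_int k" "of_int k < c / (2 * pi) + 1"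
    unfolding k_def by linarith+
  then have x: "0 \<le> x" "x < 2 * pi"
    using pi_gt_zero by (auto simp: x_def field_simps)
  have near: "t \<in> T" if "\<bar>t - x\<bar> < \<delta>" "0 \<le> t" "t \<le> 2 * pi" for t
    using that unfolding T_def x_def by (auto intro!: exI[of _ k] simp: algebra_simps)
  obtain l where "{l<..<l + \<delta>} \<subseteq> T"
  proof (cases "x \<le> pi")
    case True
    have "{x<..<x + \<delta>} \<subseteq> T"
      using True x \<delta> pi_gt3 by (auto intro!: near)
    then show ?thesis by (rule that)
  next
    case False
    have "{x - \<delta><..<x - \<delta> + \<delta>} \<subseteq> T"
      using False x \<delta> pi_gt3 by (auto intro!: near)
    then show ?thesis by (rule that)
  qed
  then have "emeasure lborel {l<..<l + \<delta>} \<le> emeasure lborel T"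
    using T by (intro emeasure_mono) auto
  then show "ennreal \<delta> \<le> emeasure lborel T" using \<delta> by simp
qed


section \<open>Circular means of Cauchy kernels\<close>

text \<open>
  On the unit circle \<open>cis t - cnj w = cis t * cnj (1 - w * cis t)\<close>, so Cauchy's formula for
  \<open>1 / (1 - w u)\<close> at the point \<open>cnj w\<close> is the integral of the Poisson kernel.
\<close>

lemma integral_Poisson:
  assumes w: "cmod w < 1"
  shows "((\<lambda>t. 1 / (cmod (1 - w * cis t))\<^sup>2) has_integral 2 * pi / (1 - (cmod w)\<^sup>2)) {0..2*pi}"
proof -
  have nz: "1 - w * u \<noteq> 0" if "cmod u \<le> 1" for u
  proof
    assume "1 - w * u = 0"
    then have "cmod w * cmod u = 1" by (metis eq_iff_diff_eq_0 norm_mult norm_one)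
    moreover have "cmod w * cmod u \<le> cmod w * 1" using that by (intro mult_left_mono) auto
    ultimately show False using w by simp
  qed
  have "(\<lambda>u. 1 / (1 - w * u)) holomorphic_on cball 0 1"
    by (intro holomorphic_intros) (use nz in auto)
  from Cauchy_integral_circlepath_simple[OF this, of "cnj w"]
  have "((\<lambda>u. 1 / (1 - w * u) / (u - cnj w)) has_contour_integral (2 * of_real pi * \<i> * (1 / (1 - w * cnj w))))
      (part_circlepath 0 1 0 (2 * pi))"
    using w by (simp add: circlepath_def)
  then have "((\<lambda>t. 1 / (1 - w * cis t) / (cis t - cnj w) * \<i> * cis t) has_integral
      (2 * of_real pi * \<i> * (1 / (1 - w * cnj w)))) {0..2*pi}"
    by (subst (asm) has_contour_integral_part_circlepath_iff) auto
  then have "((\<lambda>t. Im (1 / (1 - w * cis t) / (cis t - cnj w) * \<i> * cis t)) has_integral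
      Im (2 * of_real pi * \<i> * (1 / (1 - w * cnj w)))) {0..2*pi}"
    by (rule has_integral_Im)
  moreover have "1 / (1 - w * cis t) / (cis t - cnj w) * \<i> * cis t = \<i> * of_real (1 / (cmod (1 - w * cis t))\<^sup>2)" for t
  proof -
    have "cis t * cnj (cis t) = 1" by (simp add: cis_cnj cis_mult)
    then have e: "cis t - cnj w = cis t * cnj (1 - w * cis t)" by (simp add: algebra_simps)
    have "1 / (1 - w * cis t) / (cis t - cnj w) * \<i> * cis t = \<i> / ((1 - w * cis t) * cnj (1 - w * cis t))"
    proof -
      have c: "1 / A / (c * B) * \<i> * c = \<i> / (A * B)" if "c \<noteq> 0" for A B c :: complex
        using that by (simp add: field_simps)
      show ?thesis unfolding e by (rule c) simp
    qed
    then show ?thesis unfolding complex_norm_square[symmetric] by simp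
  qed
  moreover have "2 * of_real pi * \<i> * (1 / (1 - w * cnj w)) = \<i> * of_real (2 * pi / (1 - (cmod w)\<^sup>2))"
    unfolding complex_norm_square[symmetric] by simp
  ultimately show ?thesis by (simp only: Im_i_times Re_complex_of_real)
qed

text \<open>
  Powers beyond the second are absorbed by \<open>|1 - w cis t| \<ge> 1 - |w|\<close>, which leaves the Poisson
  kernel.
\<close>

lemma mean_Cauchy_kernel_power:
  assumes w: "cmod w < 1" and q: "2 \<le> q"
  shows "(\<integral>\<^sup>+t. ennreal ((1 / cmod (1 - w * cis t)) powr q) * indicator {0..2*pi} t \<partial>lborel)
     \<le> ennreal (2 * pi * (1 - cmod w) powr (1 - q))"
proof -
  have le: "1 - cmod w \<le> cmod (1 - w * cis t)" for t
    using norm_triangle_ineq2[of 1 "w * cis t"] by (simp add: norm_mult)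
  have pt: "(1 / cmod (1 - w * cis t)) powr q \<le> (1 - cmod w) powr (2 - q) * (1 / (cmod (1 - w * cis t))\<^sup>2)" for t
  proof -
    define x where "x = cmod (1 - w * cis t)"
    have x: "0 < 1 - cmod w" "1 - cmod w \<le> x" using w le by (auto simp: x_def)
    have "(1 / x) powr q = x powr (2 - q) * x powr (-2)"
    proof -
      have "(1 / x) powr q = x powr ((2 - q) + (-2))"
        using x by (simp add: powr_divide powr_minus_divide)
      then show ?thesis by (simp only: powr_add)
    qed
    also have "\<dots> \<le> (1 - cmod w) powr (2 - q) * x powr (-2)"
      using x q by (intro mult_right_mono powr_mono2') auto
    also have "x powr (-2) = 1 / x\<^sup>2" using x by (simp add: powr_minus_divide powr_numeral)
    finally show ?thesis by (simp add: x_def)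
  qed
  have "(\<integral>\<^sup>+t. ennreal ((1 / cmod (1 - w * cis t)) powr q) * indicator {0..2*pi} t \<partial>lborel)
     \<le> (\<integral>\<^sup>+t. ennreal ((1 - cmod w) powr (2 - q) * (1 / (cmod (1 - w * cis t))\<^sup>2)) * indicator {0..2*pi} t \<partial>lborel)"
    by (intro nn_integral_mono mult_right_mono ennreal_leI pt) auto
  also have "\<dots> = ennreal ((1 - cmod w) powr (2 - q) * (2 * pi / (1 - (cmod w)\<^sup>2)))"
    by (intro nn_integral_has_integral_lebesgue' has_integral_mult_right integral_Poisson w) auto
  also have "\<dots> \<le> ennreal ((1 - cmod w) powr (2 - q) * (2 * pi / (1 - cmod w)))"
  proof (intro ennreal_leI mult_left_mono divide_left_mono mult_pos_pos)
    have "(cmod w)\<^sup>2 \<le> cmod w" using w by (simp add: power2_eq_square mult_left_le_one_le)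
    then show "1 - cmod w \<le> 1 - (cmod w)\<^sup>2" by simp
    show "0 < 1 - (cmod w)\<^sup>2" using w by (simp add: abs_square_less_1)
  qed (use w in auto)
  also have "(1 - cmod w) powr (2 - q) * (2 * pi / (1 - cmod w)) = 2 * pi * (1 - cmod w) powr (1 - q)"
  proof -
    have "(1 - cmod w) powr (2 - q) = (1 - cmod w) powr ((1 - q) + 1)" by simp
    also have "\<dots> = (1 - cmod w) powr (1 - q) * (1 - cmod w)" using w by (simp only: powr_add) simp
    finally show ?thesis using w by simp
  qed
  finally show ?thesis .
qed



section \<open>Averaging over rotations and the mass of Carleson squares\<close>

context doubling_disc_measure
begin

sublocale finite_measure \<mu>
  using finite by (intro finite_measureI) (simp add: sets_eq_imp_space_eq[OF sets_eq])

lemmas [measurable_cong] = sets_eq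

lemma space_eq [simp]: "space \<mu> = UNIV"
  using sets_eq_imp_space_eq[OF sets_eq] by simp

text \<open>
  The inequality is strict so that \<open>V r\<close> is the total mass for every negative \<open>r\<close>, which spares case
  distinctions when doubling moves past the origin.
\<close>

definition V :: "real \<Rightarrow> real" where "V r = measure \<mu> {z. r < cmod z}"

lemma AE_disc: "AE z in \<mu>. cmod z < 1"
proof (rule AE_I)
  show "emeasure \<mu> (- ball 0 1) = 0" by (rule disc)
qed (auto simp: sets_eq)

lemma V_antimono: "r \<le> s \<Longrightarrow> V s \<le> V r"
  unfolding V_def by (intro finite_measure_mono) (auto simp: sets_eq)

lemma V_nonneg: "0 \<le> V r" by (simp add: V_def)

lemma V_le_total: "V r \<le> measure \<mu> UNIV"
  unfolding V_def by (intro finite_measure_mono) (auto simp: sets_eq)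

lemma V_negative: "r < 0 \<Longrightarrow> V r = measure \<mu> UNIV"
  unfolding V_def by (rule arg_cong[of _ _ "measure \<mu>"]) (auto intro: less_le_trans)

lemma D_ge_1: "1 \<le> D"
proof -
  have "measure \<mu> UNIV \<le> D * V 0"
    using doubling[of 1] V_negative[of "-1"] by (simp add: V_def)
  moreover have "0 < D" using calculation nontrivial V_nonneg[of 0]
    by (metis less_le_trans less_eq_real_def mult_nonpos_nonneg not_less)
  moreover have "D * V 0 \<le> D * measure \<mu> UNIV"
    using \<open>0 < D\<close> V_le_total by (intro mult_left_mono) auto
  ultimately show ?thesis using nontrivial
    by (metis mult_le_cancel_right1 not_less order_trans)
qed

text \<open>
  For \<open>t > 1\<close> both sides involve the total mass, so doubling holds at every positive \<open>t\<close> and can be iterated.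
\<close>

lemma V_doubling: "0 < t \<Longrightarrow> V (1 - 2 * t) \<le> D * V (1 - t)"
proof (cases "t \<le> 1")
  case False
  then have "V (1 - 2 * t) = V (1 - t)" by (simp add: V_negative)
  then show ?thesis using mult_right_mono[OF D_ge_1 V_nonneg[of "1 - t"]] by simp
qed (use doubling in \<open>simp add: V_def\<close>)

lemma V_doubling_iterated: "0 < t \<Longrightarrow> V (1 - 2 ^ j * t) \<le> D ^ j * V (1 - t)"
proof (induction j)
  case (Suc j)
  have "V (1 - 2 ^ Suc j * t) \<le> D * V (1 - 2 ^ j * t)"
    using V_doubling[of "2 ^ j * t"] Suc.prems by (simp add: mult.assoc)
  also have "\<dots> \<le> D * (D ^ j * V (1 - t))"
    using Suc D_ge_1 by (intro mult_left_mono) auto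
  finally show ?case by (simp add: mult.assoc)
qed simp

lemma V_pos: "r < 1 \<Longrightarrow> 0 < V r"
proof (rule ccontr)
  assume r: "r < 1" and "\<not> 0 < V r"
  then have V: "V (1 - (1 - r)) = 0" using V_nonneg[of r] by simp
  obtain j where "1 / (1 - r) < 2 ^ j" using real_arch_pow[of 2 "1 / (1 - r)"] by auto
  then have "1 - 2 ^ j * (1 - r) < 0" using r by (simp add: field_simps)
  then have "measure \<mu> UNIV \<le> D ^ j * V (1 - (1 - r))"
    using V_doubling_iterated[of "1 - r" j] r by (simp add: V_negative)
  then show False using V nontrivial by simp
qed

lemma nn_integral_rotate:
  assumes [measurable]: "h \<in> borel_measurable borel" and c: "cmod c = 1"
  shows "(\<integral>\<^sup>+z. h (c * z) \<partial>\<mu>) = (\<integral>\<^sup>+z. h z \<partial>\<mu>)"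
  by (subst (2) rotation[OF c, symmetric], subst nn_integral_distr) auto

text \<open>
  The workhorse: integrals against \<open>\<mu>\<close> may be computed by first averaging over circles.
\<close>

lemma rotation_average:
  fixes h :: "complex \<Rightarrow> ennreal"
  assumes [measurable]: "h \<in> borel_measurable borel"
  shows "ennreal (2*pi) * (\<integral>\<^sup>+z. h z \<partial>\<mu>)
      = (\<integral>\<^sup>+z. (\<integral>\<^sup>+t. h (cis t * z) * indicator {0..2*pi} t \<partial>lborel) \<partial>\<mu>)"
proof -
  interpret pair_sigma_finite \<mu> "lborel :: real measure" ..
  have [measurable]: "cis \<in> borel_measurable borel"
    by (intro borel_measurable_continuous_onI continuous_intros)
  have "(\<integral>\<^sup>+z. (\<integral>\<^sup>+t. h (cis t * z) * indicator {0..2*pi} t \<partial>lborel) \<partial>\<mu>)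
      = (\<integral>\<^sup>+t. (\<integral>\<^sup>+z. h (cis t * z) * indicator {0..2*pi} t \<partial>\<mu>) \<partial>lborel)"
    by (rule Fubini'[symmetric]) measurable
  also have "\<dots> = (\<integral>\<^sup>+t. (\<integral>\<^sup>+z. h z \<partial>\<mu>) * indicator {0..2*pi} t \<partial>lborel)"
    by (intro nn_integral_cong) (simp add: nn_integral_multc nn_integral_rotate)
  also have "\<dots> = ennreal (2*pi) * (\<integral>\<^sup>+z. h z \<partial>\<mu>)"
    by (simp add: nn_integral_cmult mult.commute)
  finally show ?thesis ..
qed

lemma carleson_average:
  assumes "a \<noteq> 0" "cmod a < 1"
  shows "(1 - cmod a) / (4 * pi) * V (cmod a) \<le> measure \<mu> (carleson_square a)"
    and "measure \<mu> (carleson_square a) \<le> 2 * (1 - cmod a) / pi * V (cmod a)"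
proof -
  define \<delta> where "\<delta> = (1 - cmod a) / 2"
  have \<delta>: "0 < \<delta>" "\<delta> \<le> 1"
    unfolding \<delta>_def using assms norm_ge_zero[of a] by (auto simp del: norm_ge_zero)
  define I where "I z = (\<integral>\<^sup>+t. indicator (carleson_square a) (cis t * z) * indicator {0..2*pi} t \<partial>lborel)" for z
  have avg: "ennreal (2*pi) * emeasure \<mu> (carleson_square a) = (\<integral>\<^sup>+z. I z \<partial>\<mu>)"
    using rotation_average[of "indicator (carleson_square a)"] by (simp add: I_def sets_eq)
  have I: "ennreal \<delta> \<le> I z" "I z \<le> ennreal (8 * \<delta>)" if z: "cmod a < cmod z" "cmod z < 1" for z
  proof -
    define c where "c = Arg z - Arg a"
    have c: "\<bar>c\<bar> < 2 * pi"
      using Arg_bounded[of z] Arg_bounded[of a] by (auto simp: c_def)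
    have "I z = (\<integral>\<^sup>+t. indicator {t \<in> {0..2*pi}. \<exists>k::int. \<bar>t + c - 2 * pi * of_int k\<bar> < \<delta>} t \<partial>lborel)"
      unfolding I_def
      by (intro nn_integral_cong)
         (auto simp: carleson_square_angle[OF assms(1) z] c_def \<delta>_def split: split_indicator)
    also have "\<dots> = emeasure lborel {t \<in> {0..2*pi}. \<exists>k::int. \<bar>t + c - 2 * pi * of_int k\<bar> < \<delta>}"
      using emeasure_angles_near(1)[OF c \<delta>] by simp
    finally show "ennreal \<delta> \<le> I z" "I z \<le> ennreal (8 * \<delta>)"
      using emeasure_angles_near(2,3)[OF c \<delta>] by simp_all
  qed
  have I0: "I z = 0" if "\<not> cmod a < cmod z" for z
    using that assms by (auto simp: I_def carleson_square_def norm_mult)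
  have mass: "(\<integral>\<^sup>+z. ennreal k * indicator {z. cmod a < cmod z} z \<partial>\<mu>) = ennreal (k * V (cmod a))" if "0 \<le> k" for k
    using that by (subst nn_integral_cmult_indicator) (auto simp: sets_eq V_def emeasure_eq_measure ennreal_mult)
  have "ennreal (\<delta> * V (cmod a)) \<le> ennreal (2*pi) * emeasure \<mu> (carleson_square a)"
    unfolding avg mass[symmetric, OF less_imp_le[OF \<delta>(1)]]
    by (rule nn_integral_mono_AE) (use AE_disc in \<open>auto elim!: eventually_mono intro: I split: split_indicator\<close>)
  then have "\<delta> * V (cmod a) \<le> 2 * pi * measure \<mu> (carleson_square a)"
    by (simp add: emeasure_eq_measure ennreal_mult'[symmetric])
  then show "(1 - cmod a) / (4 * pi) * V (cmod a) \<le> measure \<mu> (carleson_square a)"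
    by (simp add: \<delta>_def field_simps)
  have "8 * \<delta> \<ge> 0" using \<delta> by simp
  have "ennreal (2*pi) * emeasure \<mu> (carleson_square a) \<le> ennreal (8 * \<delta> * V (cmod a))"
    unfolding avg mass[symmetric, OF \<open>8 * \<delta> \<ge> 0\<close>]
    by (rule nn_integral_mono_AE) (use AE_disc in \<open>auto elim!: eventually_mono intro: I simp: I0 split: split_indicator\<close>)
  then have "2 * pi * measure \<mu> (carleson_square a) \<le> 8 * \<delta> * V (cmod a)"
    using \<delta> V_nonneg by (simp add: emeasure_eq_measure ennreal_mult'[symmetric])
  then show "measure \<mu> (carleson_square a) \<le> 2 * (1 - cmod a) / pi * V (cmod a)"
    by (simp add: \<delta>_def field_simps)
qed

text \<open>
  At the origin the square is the whole disc, whose mass is compared with \<open>V 0\<close> by doubling; this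
  is where the upper constant depends on \<open>D\<close>.
\<close>

lemma carleson_square_comparable:
  assumes "cmod a < 1"
  shows "(1 - cmod a) / (4 * pi) * V (cmod a) \<le> measure \<mu> (carleson_square a)"
    and "measure \<mu> (carleson_square a) \<le> D\<^sup>2 * (1 - cmod a) * V (cmod a)"
proof -
  have "(1 - cmod a) / (4 * pi) * V (cmod a) \<le> measure \<mu> (carleson_square a) \<and>
    measure \<mu> (carleson_square a) \<le> D\<^sup>2 * (1 - cmod a) * V (cmod a)"
  proof (cases "a = 0")
    case False
    have "2 / pi \<le> 1" using pi_gt3 by simp
    also have "1 \<le> D\<^sup>2" by (rule one_le_power[OF D_ge_1])
    finally have "2 / pi \<le> D\<^sup>2" .
    then have *: "2 / pi * ((1 - cmod a) * V (cmod a)) \<le> D\<^sup>2 * ((1 - cmod a) * V (cmod a))"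
      using assms V_nonneg by (intro mult_right_mono) auto
    have "2 * (1 - cmod a) / pi * V (cmod a) = 2 / pi * ((1 - cmod a) * V (cmod a))" by simp
    also note *
    also have "D\<^sup>2 * ((1 - cmod a) * V (cmod a)) = D\<^sup>2 * (1 - cmod a) * V (cmod a)" by (rule mult.assoc[symmetric])
    finally show ?thesis using carleson_average[OF False assms] by (auto intro: order_trans)
  next
    case True
    have "measure \<mu> (ball 0 1) = measure \<mu> UNIV"
      by (rule finite_measure_eq_AE) (use AE_disc in \<open>auto simp: sets_eq\<close>)
    then have sq: "measure \<mu> (carleson_square a) = measure \<mu> UNIV"
      by (simp add: True carleson_square_def)
    have "measure \<mu> UNIV \<le> D * V 0"
      using V_doubling[of 1] by (simp add: V_negative)
    also have "\<dots> \<le> D\<^sup>2 * V 0"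
      using D_ge_1 V_nonneg by (intro mult_right_mono) (auto simp: power2_eq_square)
    finally have "measure \<mu> UNIV \<le> D\<^sup>2 * V 0" .
    moreover have "V 0 / (4 * pi) \<le> V 0 / 1"
      using V_nonneg[of 0] pi_gt3 by (intro divide_left_mono) auto
    then have "V 0 / (4 * pi) \<le> measure \<mu> UNIV" using V_le_total[of 0] by linarith
    ultimately show ?thesis using sq[unfolded True] by (simp add: True)
  qed
  then show "(1 - cmod a) / (4 * pi) * V (cmod a) \<le> measure \<mu> (carleson_square a)"
    and "measure \<mu> (carleson_square a) \<le> D\<^sup>2 * (1 - cmod a) * V (cmod a)" by auto
qed

lemma carleson_square_pos: "cmod a < 1 \<Longrightarrow> 0 < measure \<mu> (carleson_square a)"
  using carleson_square_comparable(1)[of a] V_pos[of "cmod a"]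
  by (intro less_le_trans[OF _ carleson_square_comparable(1)]) auto

end

section \<open>Pointwise estimates\<close>

context doubling_disc_measure
begin

text \<open>
  The indicator removes the values of \<open>f\<close> outside the disc, which are arbitrary and need not be
  measurable.
\<close>

definition p_integral :: "real \<Rightarrow> (complex \<Rightarrow> complex) \<Rightarrow> ennreal" where
  "p_integral p f = (\<integral>\<^sup>+z. ennreal (indicator (ball 0 1) z * cmod (f z) powr p) \<partial>\<mu>)"

lemma borel_measurable_cmod_powr:
  assumes "f holomorphic_on ball 0 1" "0 < p"
  shows "(\<lambda>z. indicator (ball 0 1) z * cmod (f z) powr p) \<in> borel_measurable borel"
proof -
  have "continuous_on (ball 0 1) (\<lambda>z. cmod (f z) powr p)"
    by (rule continuous_on_powr'[OF continuous_on_norm[OF holomorphic_on_imp_continuous_on[OF assms(1)]] continuous_on_const])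
       (use assms(2) in auto)
  then have "(\<lambda>z. indicator (ball 0 1) z *\<^sub>R (cmod (f z) powr p)) \<in> borel_measurable borel"
    by (rule borel_measurable_continuous_on_indicator[rotated]) simp
  then show ?thesis by (simp only: real_scaleR_def)
qed

text \<open>
  The circle inequality is integrated over the circles of radius greater than \<open>(1 + |a|)/2\<close>,
  where its constant is at least \<open>(1 - |a|)/2\<close>.
\<close>

lemma p_integral_ge:
  assumes holf: "f holomorphic_on ball 0 1" and p: "0 < p" and a: "cmod a < 1"
  shows "ennreal ((1 - cmod a) / 2 * cmod (f a) powr p * V ((1 + cmod a) / 2)) \<le> p_integral p f"
proof -
  define h where "h z = ennreal (indicator (ball 0 1) z * cmod (f z) powr p)" for z
  have h: "h \<in> borel_measurable borel"
    unfolding h_def by (rule measurable_compose[OF borel_measurable_cmod_powr[OF holf p] measurable_ennreal])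
  define s where "s = (1 + cmod a) / 2"
  have s: "cmod a < s" "s < 1" "s - cmod a = (1 - cmod a) / 2" "0 < s"
    using a norm_ge_zero[of a] by (auto simp: s_def field_simps simp del: norm_ge_zero)
  define K where "K = 2 * pi * ((1 - cmod a) / 2) * cmod (f a) powr p"
  have K: "0 \<le> K" using a by (simp add: K_def)
  have inner: "ennreal K \<le> (\<integral>\<^sup>+t. h (cis t * z) * indicator {0..2*pi} t \<partial>lborel)"
    if z: "s < cmod z" "cmod z < 1" for z
  proof -
    have "continuous_on {0..2*pi} (\<lambda>t. cmod (f (cis t * z)) powr p)"
      using p z by (intro continuous_on_powr' continuous_intros
          continuous_on_compose2[OF holomorphic_on_imp_continuous_on[OF holf]]) (auto simp: norm_mult)
    then have "((\<lambda>t. cmod (f (cis t * z)) powr p) has_integral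
        integral {0..2*pi} (\<lambda>t. cmod (f (cis t * z)) powr p)) {0..2*pi}"
      by (intro integrable_integral integrable_continuous_real)
    then have "(\<integral>\<^sup>+t. ennreal (cmod (f (cis t * z)) powr p) * indicator {0..2*pi} t \<partial>lborel)
        = ennreal (integral {0..2*pi} (\<lambda>t. cmod (f (cis t * z)) powr p))"
      by (intro nn_integral_has_integral_lebesgue') auto
    moreover have "(\<integral>\<^sup>+t. h (cis t * z) * indicator {0..2*pi} t \<partial>lborel)
        = (\<integral>\<^sup>+t. ennreal (cmod (f (cis t * z)) powr p) * indicator {0..2*pi} t \<partial>lborel)"
      using z by (simp add: h_def norm_mult)
    moreover have "K \<le> integral {0..2*pi} (\<lambda>t. cmod (f (cis t * z)) powr p)"
    proof -
      have "cmod a / cmod z \<le> cmod a / s"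
        using s z by (intro divide_left_mono mult_pos_pos) auto
      moreover have "(1 - cmod a) / 2 \<le> 1 - cmod a / s"
      proof -
        have "s * ((1 - cmod a) / 2) \<le> 1 * ((1 - cmod a) / 2)"
          using s a by (intro mult_right_mono) auto
        then have "(1 - cmod a) / 2 * s \<le> s - cmod a" using s(3) by (simp add: mult.commute)
        then show ?thesis using s(4) by (simp add: field_simps)
      qed
      ultimately have "(1 - cmod a) / 2 \<le> 1 - cmod a / cmod z" by linarith
      then have "K \<le> 2 * pi * (1 - cmod a / cmod z) * cmod (f a) powr p"
        unfolding K_def by (intro mult_right_mono mult_left_mono) auto
      also have "\<dots> \<le> integral {0..2*pi} (\<lambda>t. cmod (f (cis t * z)) powr p)"
        using z s by (intro power_mean_circle holf p) auto
      finally show ?thesis .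
    qed
    ultimately show ?thesis by (simp add: ennreal_leI)
  qed
  have "ennreal (K * V s) = (\<integral>\<^sup>+z. ennreal K * indicator {z. s < cmod z} z \<partial>\<mu>)"
    using K by (subst nn_integral_cmult_indicator) (auto simp: sets_eq V_def emeasure_eq_measure ennreal_mult)
  also have "\<dots> \<le> (\<integral>\<^sup>+z. (\<integral>\<^sup>+t. h (cis t * z) * indicator {0..2*pi} t \<partial>lborel) \<partial>\<mu>)"
    by (rule nn_integral_mono_AE) (use AE_disc in \<open>auto elim!: eventually_mono intro: inner split: split_indicator\<close>)
  also have "\<dots> = ennreal (2 * pi) * p_integral p f"
    unfolding rotation_average[OF h, symmetric] by (simp only: h_def[abs_def] p_integral_def)
  finally have le: "ennreal (K * V s) \<le> ennreal (2 * pi) * p_integral p f" .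
  have "ennreal (2 * pi) * ennreal ((1 - cmod a) / 2 * cmod (f a) powr p * V s) = ennreal (K * V s)"
    using a V_nonneg by (subst ennreal_mult[symmetric]) (auto simp: K_def mult_ac)
  then have "ennreal (2 * pi) * ennreal ((1 - cmod a) / 2 * cmod (f a) powr p * V s) \<le> ennreal (2 * pi) * p_integral p f"
    using le by simp
  then show ?thesis
    unfolding s_def[symmetric] by (subst (asm) ennreal_mult_le_mult_iff) auto
qed

end

section \<open>Integrals of Cauchy kernels\<close>

context doubling_disc_measure
begin

lemma dyadic_bound:
  fixes t x q :: real
  assumes t: "0 < t" and x: "t \<le> x" and q: "1 \<le> q"
  obtains j :: nat where "x powr (1 - q) \<le> (2 ^ j * t) powr (1 - q)" "x < 2 ^ Suc j * t"
proof -
  define N where "N = (LEAST n::nat. x / t < 2 ^ n)"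
  obtain n where "x / t < 2 ^ n" using real_arch_pow[of 2 "x / t"] by auto
  then have N: "x / t < 2 ^ N" unfolding N_def by (rule LeastI)
  have "N \<noteq> 0" using N t x by (intro notI) (simp add: field_simps)
  then obtain j where j: "N = Suc j" by (cases N) auto
  have "\<not> x / t < 2 ^ j"
    using not_less_Least[of j "\<lambda>n. x / t < 2 ^ n"] by (simp add: N_def[symmetric] j)
  then have "2 ^ j * t \<le> x" using t by (simp add: field_simps)
  then have "x powr (1 - q) \<le> (2 ^ j * t) powr (1 - q)"
    using t q by (intro powr_mono2') auto
  moreover have "x < 2 ^ Suc j * t" using N t by (simp add: j field_simps)
  ultimately show ?thesis by (rule that)
qed

text \<open>
  After the angular average the integrand is
  \<open>(1 - |a|)\<^sup>q (1 - |a||z|)\<^sup>1\<^sup>-\<^sup>q\<close>. On the annulus where \<open>1 - |a||z|\<close> is about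
  \<open>2\<^sup>j (1 - |a|)\<close> it is about \<open>2\<^sup>j\<^sup>(\<^sup>1\<^sup>-\<^sup>q\<^sup>) (1 - |a|)\<close>, while doubling bounds the mass of
  the annulus by \<open>D\<^sup>j\<^sup>+\<^sup>1 V(|a|)\<close>. The choice of \<open>q\<close> makes the resulting geometric series have
  ratio at most \<open>1/2\<close>.
\<close>

lemma kernel_integral_le:
  assumes q: "2 \<le> q" and Dq: "D * 2 powr (1 - q) \<le> 1 / 2" and a: "cmod a < 1"
  shows "(\<integral>\<^sup>+z. ennreal (((1 - cmod a) / cmod (1 - cnj a * z)) powr q) \<partial>\<mu>)
     \<le> ennreal (2 * D * (1 - cmod a) * V (cmod a))"
proof -
  define t where "t = 1 - cmod a"
  have t: "0 < t" "t \<le> 1" using a by (auto simp: t_def)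
  define h where "h z = ennreal ((t / cmod (1 - cnj a * z)) powr q)" for z
  have h: "h \<in> borel_measurable borel" unfolding h_def by measurable
  define g where "g z = t powr q * (1 - cmod a * cmod z) powr (1 - q)" for z
  have inner: "(\<integral>\<^sup>+s. h (cis s * z) * indicator {0..2*pi} s \<partial>lborel) \<le> ennreal (2 * pi) * ennreal (g z)"
    if z: "cmod z < 1" for z
  proof -
    have "cmod a * cmod z \<le> 1 * cmod z" using a by (intro mult_right_mono) auto
    then have w: "cmod (cnj a * z) < 1" using z by (simp add: norm_mult)
    have "(\<integral>\<^sup>+s. h (cis s * z) * indicator {0..2*pi} s \<partial>lborel)
       = (\<integral>\<^sup>+s. ennreal (t powr q) * (ennreal ((1 / cmod (1 - cnj a * z * cis s)) powr q) * indicator {0..2*pi} s) \<partial>lborel)"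
    proof (intro nn_integral_cong)
      fix s :: real
      have comm: "cnj a * (cis s * z) = cnj a * z * cis s" by simp
      have split: "(t / x) powr q = t powr q * (1 / x) powr q" if "0 \<le> x" for x
        using t that powr_mult[of t "1 / x" q] by simp
      have "h (cis s * z) = ennreal (t powr q) * ennreal ((1 / cmod (1 - cnj a * z * cis s)) powr q)"
        unfolding h_def comm split[OF norm_ge_zero] by (rule ennreal_mult) auto
      then show "h (cis s * z) * indicator {0..2*pi} s
        = ennreal (t powr q) * (ennreal ((1 / cmod (1 - cnj a * z * cis s)) powr q) * indicator {0..2*pi} s)"
        by (simp only: mult.assoc)
    qed
    also have "\<dots> = ennreal (t powr q) * (\<integral>\<^sup>+s. ennreal ((1 / cmod (1 - cnj a * z * cis s)) powr q) * indicator {0..2*pi} s \<partial>lborel)"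
    proof (rule nn_integral_cmult)
      have [measurable]: "cis \<in> borel_measurable borel"
        by (intro borel_measurable_continuous_onI continuous_intros)
      show "(\<lambda>s. ennreal ((1 / cmod (1 - cnj a * z * cis s)) powr q) * indicator {0..2*pi} s) \<in> borel_measurable lborel"
        by measurable
    qed
    also have "\<dots> \<le> ennreal (t powr q) * ennreal (2 * pi * (1 - cmod (cnj a * z)) powr (1 - q))"
      by (intro mult_left_mono mean_Cauchy_kernel_power w q) auto
    also have "\<dots> = ennreal (2 * pi) * ennreal (g z)"
      by (subst (1 2) ennreal_mult[symmetric]) (auto simp: g_def norm_mult)
    finally show ?thesis .
  qed
  have [measurable]: "g \<in> borel_measurable borel" unfolding g_def by measurable
  have "ennreal (2 * pi) * (\<integral>\<^sup>+z. h z \<partial>\<mu>) \<le> (\<integral>\<^sup>+z. ennreal (2 * pi) * ennreal (g z) \<partial>\<mu>)"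
    unfolding rotation_average[OF h]
    by (rule nn_integral_mono_AE) (use AE_disc in \<open>auto elim!: eventually_mono intro: inner\<close>)
  also have "\<dots> = ennreal (2 * pi) * (\<integral>\<^sup>+z. ennreal (g z) \<partial>\<mu>)"
    by (rule nn_integral_cmult) measurable
  finally have "(\<integral>\<^sup>+z. h z \<partial>\<mu>) \<le> (\<integral>\<^sup>+z. ennreal (g z) \<partial>\<mu>)"
    by (subst (asm) ennreal_mult_le_mult_iff) auto
  also have "\<dots> \<le> (\<integral>\<^sup>+z. (\<Sum>j. ennreal (t powr q * (2 ^ j * t) powr (1 - q)) * indicator {z. 1 - 2 ^ Suc j * t < cmod z} z) \<partial>\<mu>)"
  proof (rule nn_integral_mono_AE, use AE_disc in eventually_elim)
    fix z assume z: "cmod z < 1"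
    \<comment> \<open>A convenient lower bound for \<open>1 - |a||z|\<close> that is at least \<open>t\<close>, so that dyadic multiples of \<open>t\<close> reach it.\<close>
    define x where "x = max t (1 - cmod z)"
    have ax: "x \<le> 1 - cmod a * cmod z"
      using a z mult_right_mono[of "cmod a" 1 "cmod z"] mult_left_mono[of "cmod z" 1 "cmod a"]
      by (auto simp: x_def t_def)
    have x: "t \<le> x" by (simp add: x_def)
    have q1: "1 \<le> q" using q by simp
    obtain j :: nat where j: "x powr (1 - q) \<le> (2 ^ j * t) powr (1 - q)" "x < 2 ^ Suc j * t"
      using dyadic_bound[OF t(1) x q1] by blast
    have "(1 - cmod a * cmod z) powr (1 - q) \<le> x powr (1 - q)"
      using ax x t q by (intro powr_mono2') auto
    with j(1) have "g z \<le> t powr q * (2 ^ j * t) powr (1 - q)"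
      unfolding g_def by (intro mult_left_mono) auto
    moreover have "1 - 2 ^ Suc j * t < cmod z" using j(2) by (auto simp: x_def)
    moreover define summand where "summand i = ennreal (t powr q * (2 ^ i * t) powr (1 - q)) * indicator {z. 1 - 2 ^ Suc i * t < cmod z} z" for i :: nat
    ultimately have "ennreal (g z) \<le> summand j"
      by (simp add: ennreal_leI)
    also have "summand j \<le> suminf summand"
      using sum_le_suminf[of summand "{j}"] by simp
    finally show "ennreal (g z) \<le> (\<Sum>j. ennreal (t powr q * (2 ^ j * t) powr (1 - q)) * indicator {z. 1 - 2 ^ Suc j * t < cmod z} z)"
      unfolding summand_def[abs_def] .
  qed
  also have "\<dots> = (\<Sum>j. (\<integral>\<^sup>+z. ennreal (t powr q * (2 ^ j * t) powr (1 - q)) * indicator {z. 1 - 2 ^ Suc j * t < cmod z} z \<partial>\<mu>))"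
    by (rule nn_integral_suminf) (auto simp: sets_eq)
  also have "\<dots> \<le> (\<Sum>j. ennreal (D * t * V (cmod a) * (1 / 2) ^ j))"
  proof (intro suminf_le)
    fix j
    have eq: "t powr q * (2 ^ j * t) powr (1 - q) = t * (2 powr (1 - q)) ^ j"
    proof -
      have "t powr q * (2 ^ j * t) powr (1 - q) = (t powr q * t powr (1 - q)) * (2 ^ j) powr (1 - q)"
        using t by (simp add: powr_mult)
      also have "t powr q * t powr (1 - q) = t" using t by (simp add: powr_add[symmetric])
      also have "(2 ^ j) powr (1 - q) = (2 powr (1 - q)) ^ j"
        by (simp add: powr_realpow[symmetric] powr_powr mult.commute)
      finally show ?thesis .
    qed
    have "(t * (2 powr (1 - q)) ^ j) * V (1 - 2 ^ Suc j * t) \<le> (t * (2 powr (1 - q)) ^ j) * (D ^ Suc j * V (1 - t))"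
      using t by (intro mult_left_mono V_doubling_iterated) auto
    also have "\<dots> = D * t * V (cmod a) * (D * 2 powr (1 - q)) ^ j"
      by (simp add: t_def power_mult_distrib mult_ac)
    also have "\<dots> \<le> D * t * V (cmod a) * (1 / 2) ^ j"
      using Dq D_ge_1 t V_nonneg by (intro mult_left_mono power_mono) auto
    finally have le: "(t * (2 powr (1 - q)) ^ j) * V (1 - 2 ^ Suc j * t) \<le> D * t * V (cmod a) * (1 / 2) ^ j" .
    have "(\<integral>\<^sup>+z. ennreal (t powr q * (2 ^ j * t) powr (1 - q)) * indicator {z. 1 - 2 ^ Suc j * t < cmod z} z \<partial>\<mu>)
       = ennreal ((t * (2 powr (1 - q)) ^ j) * V (1 - 2 ^ Suc j * t))"
      unfolding eq using t
      by (subst nn_integral_cmult_indicator) (auto simp: sets_eq V_def emeasure_eq_measure ennreal_mult)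
    also have "\<dots> \<le> ennreal (D * t * V (cmod a) * (1 / 2) ^ j)" using le by (rule ennreal_leI)
    finally show "(\<integral>\<^sup>+z. ennreal (t powr q * (2 ^ j * t) powr (1 - q)) * indicator {z. 1 - 2 ^ Suc j * t < cmod z} z \<partial>\<mu>)
       \<le> ennreal (D * t * V (cmod a) * (1 / 2) ^ j)" .
  qed auto
  also have "\<dots> = ennreal (D * t * V (cmod a) * 2)"
  proof (rule suminf_ennreal_eq)
    show "0 \<le> D * t * V (cmod a) * (1 / 2) ^ j" for j
      using D_ge_1 t V_nonneg by auto
    show "(\<lambda>j. D * t * V (cmod a) * (1 / 2) ^ j) sums (D * t * V (cmod a) * 2)"
      using sums_mult[OF geometric_sums[of "1/2::real"]] by simp
  qed
  finally show ?thesis unfolding h_def[abs_def] t_def by (simp only: mult_ac)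
qed

end


lemma higher_deriv_inverse_power:
  fixes c :: complex
  assumes c: "cmod c \<le> 1" and z: "cmod z < 1"
  shows "(deriv ^^ n) (\<lambda>z. A / (1 - c * z) ^ m) z
     = A * pochhammer (of_nat m) n * c ^ n / (1 - c * z) ^ (m + n)"
  using z
proof (induction n arbitrary: z)
  case (Suc n)
  have nz: "1 - c * w \<noteq> 0" if "w \<in> ball 0 1" for w
  proof
    assume "1 - c * w = 0"
    then have "cmod (c * w) = 1" by (metis eq_iff_diff_eq_0 norm_one)
    moreover have "cmod c * cmod w \<le> 1 * cmod w" using c by (intro mult_right_mono) auto
    ultimately show False using that by (simp add: norm_mult)
  qed
  define B where "B = A * pochhammer (of_nat m) n * c ^ n"
  have der: "((\<lambda>w. B / (1 - c * w) ^ (m + n)) has_field_derivative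
      B * (of_nat (m + n) * c) / (1 - c * z) ^ (m + Suc n)) (at z)"
  proof (cases "m + n = 0")
    case False
    then obtain k where k: "m + n = Suc k" by (cases "m + n") auto
    define u where "u = 1 - c * z"
    have u: "u \<noteq> 0" using nz[of z] Suc.prems by (simp add: u_def)
    have "((\<lambda>w. 1 - c * w) has_field_derivative - c) (at z)"
      by (auto intro!: derivative_eq_intros)
    from DERIV_cmult[OF DERIV_inverse'[OF DERIV_power[OF this, of "Suc k"]], of B]
    have "((\<lambda>w. B * inverse ((1 - c * w) ^ Suc k)) has_field_derivative
        B * - (inverse (u ^ Suc k) * (of_nat (Suc k) * (- c * u ^ (Suc k - Suc 0))) * inverse (u ^ Suc k))) (at z)"
      using u by (simp add: u_def)
    moreover have "B * - (inverse (u ^ Suc k) * (of_nat (Suc k) * (- c * u ^ (Suc k - Suc 0))) * inverse (u ^ Suc k))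
        = B * (of_nat (Suc k) * c) / u ^ Suc (Suc k)"
      using u by (simp add: field_simps)
    ultimately show ?thesis
      unfolding add_Suc_right k u_def by (simp only: divide_inverse)
  qed auto
  have "(deriv ^^ Suc n) (\<lambda>z. A / (1 - c * z) ^ m) z = deriv (\<lambda>w. B / (1 - c * w) ^ (m + n)) z"
    unfolding funpow.simps o_def
  proof (rule deriv_cong_ev)
    have "eventually (\<lambda>w. w \<in> ball 0 1) (nhds z)"
      using Suc.prems by (intro eventually_nhds_in_open) auto
    then show "\<forall>\<^sub>F w in nhds z. (deriv ^^ n) (\<lambda>z. A / (1 - c * z) ^ m) w = B / (1 - c * w) ^ (m + n)"
      by eventually_elim (simp add: Suc.IH B_def)
  qed simp
  also have "\<dots> = B * (of_nat (m + n) * c) / (1 - c * z) ^ (m + Suc n)"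
    using der by (rule DERIV_imp_deriv)
  finally show ?case
    by (simp add: B_def pochhammer_Suc mult_ac)
qed simp


context doubling_disc_measure
begin

text \<open>
  All points of the circle of radius \<open>(1 - |a|)/2\<close> about \<open>a\<close> satisfy the pointwise bound with
  \<open>V (1 - (1 - |a|)/4)\<close>, which two doublings compare with \<open>V |a|\<close>, hence with the Carleson square at \<open>a\<close>;
  Cauchy's inequality then yields the derivative.
\<close>

lemma higher_deriv_le:
  assumes holf: "f holomorphic_on ball 0 1" and p: "0 < p"
    and fin: "p_integral p f = ennreal (N powr p)" and N: "0 \<le> N" and a: "cmod a < 1"
  shows "cmod ((deriv ^^ n) f a)
    \<le> fact n * 2 ^ n * (4 * D ^ 4) powr (1/p) * N / (measure \<mu> (carleson_square a) powr (1/p) * (1 - cmod a) ^ n)"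
proof -
  define t where "t = 1 - cmod a"
  have t: "0 < t" "t \<le> 1" using a by (auto simp: t_def)
  define S where "S = measure \<mu> (carleson_square a)"
  have S: "0 < S" unfolding S_def using a by (rule carleson_square_pos)
  define B where "B = (4 * D ^ 4) powr (1/p) * N / S powr (1/p)"
  have bound: "cmod (f z) \<le> B" if z: "cmod (a - z) = t / 2" for z
  proof -
    have "cmod z \<le> cmod a + t / 2"
      using norm_triangle_ineq2[of z a] z by (simp add: norm_minus_commute)
    then have za: "t / 2 \<le> 1 - cmod z" "cmod z < 1" using t by (auto simp: t_def field_simps)
    have "(1 + cmod z) / 2 \<le> 1 - t / 4" using za by (simp add: field_simps)
    then have V1: "V (1 - t / 4) \<le> V ((1 + cmod z) / 2)" by (rule V_antimono)
    have V2: "V (1 - t) \<le> D ^ 2 * V (1 - t / 4)"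
      using V_doubling_iterated[of "t / 4" 2] t by simp
    have "S \<le> D ^ 2 * t * V (1 - t)"
      using carleson_square_comparable(2)[OF a] by (simp add: S_def t_def)
    also have "\<dots> \<le> D ^ 2 * t * (D ^ 2 * V ((1 + cmod z) / 2))"
      using V1 V2 t D_ge_1 by (intro mult_left_mono order_trans[OF V2] mult_left_mono[OF V1]) auto
    finally have S_le: "S \<le> D ^ 4 * t * V ((1 + cmod z) / 2)"
      by (simp add: power2_eq_square power4_eq_xxxx mult_ac)
    have I: "(1 - cmod z) / 2 * cmod (f z) powr p * V ((1 + cmod z) / 2) \<le> N powr p"
      using p_integral_ge[OF holf p za(2)] unfolding fin by simp
    have "t / 4 * V ((1 + cmod z) / 2) \<le> (1 - cmod z) / 2 * V ((1 + cmod z) / 2)"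
      using za V_nonneg by (intro mult_right_mono) auto
    then have "t / 4 * V ((1 + cmod z) / 2) * cmod (f z) powr p \<le> N powr p"
      using I mult_right_mono[of "t / 4 * V ((1 + cmod z) / 2)" "(1 - cmod z) / 2 * V ((1 + cmod z) / 2)" "cmod (f z) powr p"]
      by (simp add: mult_ac)
    then have "4 * D ^ 4 * (t / 4 * V ((1 + cmod z) / 2) * cmod (f z) powr p) \<le> 4 * D ^ 4 * N powr p"
      using D_ge_1 by (intro mult_left_mono) auto
    moreover have "S * cmod (f z) powr p \<le> D ^ 4 * t * V ((1 + cmod z) / 2) * cmod (f z) powr p"
      using S_le by (intro mult_right_mono) auto
    ultimately have "S * cmod (f z) powr p \<le> 4 * D ^ 4 * N powr p" by (simp add: mult_ac)
    then have "cmod (f z) powr p \<le> 4 * D ^ 4 * N powr p / S" using S by (simp add: field_simps)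
    then have "(cmod (f z) powr p) powr (1/p) \<le> (4 * D ^ 4 * N powr p / S) powr (1/p)"
      using p by (intro powr_mono2) auto
    then show ?thesis
      using p N S D_ge_1 by (simp add: powr_powr powr_mult powr_divide B_def)
  qed
  have sub: "cball a (t / 2) \<subseteq> ball 0 1"
  proof
    fix z assume "z \<in> cball a (t / 2)"
    then have "cmod z \<le> cmod a + t / 2"
      using norm_triangle_ineq2[of z a] by (simp add: dist_norm norm_minus_commute)
    then show "z \<in> ball 0 1" using t by (simp add: t_def field_simps)
  qed
  have "cmod ((deriv ^^ n) f a) \<le> fact n * B / (t / 2) ^ n"
  proof (rule Cauchy_inequality)
    show "f holomorphic_on ball a (t / 2)"
      by (rule holomorphic_on_subset[OF holf]) (use sub ball_subset_cball in blast)
    show "continuous_on (cball a (t / 2)) f"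
      by (rule holomorphic_on_imp_continuous_on[OF holomorphic_on_subset[OF holf sub]])
  qed (use t bound in auto)
  then show ?thesis by (simp add: B_def S_def t_def power_divide mult_ac)
qed

text \<open>
  The least exponent \<open>m\<close> with \<open>mp \<ge> 2 + log\<^sub>2 D\<close>: then \<open>q = mp\<close> is at least \<open>2\<close>, as the Poisson kernel
  requires, and \<open>2\<^sup>1\<^sup>-\<^sup>q D \<le> 1/2\<close>, as the dyadic summation requires.
\<close>

definition kernel_exponent :: "real \<Rightarrow> nat" where
  "kernel_exponent p = nat \<lceil>(2 + log 2 D) / p\<rceil>"

lemma kernel_exponent:
  assumes p: "0 < p"
  shows "2 \<le> real (kernel_exponent p) * p" "D * 2 powr (1 - real (kernel_exponent p) * p) \<le> 1 / 2"
proof -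
  have "(2 + log 2 D) / p \<le> real (kernel_exponent p)" unfolding kernel_exponent_def by linarith
  then have m: "2 + log 2 D \<le> real (kernel_exponent p) * p" using p by (simp add: field_simps)
  have "0 \<le> log 2 D" using D_ge_1 by simp
  then show "2 \<le> real (kernel_exponent p) * p" using m by linarith
  have "D * 2 powr (1 - real (kernel_exponent p) * p) = 2 powr (log 2 D + (1 - real (kernel_exponent p) * p))"
    using D_ge_1 by (simp add: powr_add)
  also have "\<dots> \<le> 2 powr (- 1)" using m by (intro powr_mono) auto
  finally show "D * 2 powr (1 - real (kernel_exponent p) * p) \<le> 1 / 2" by (simp add: powr_minus_divide)
qed

end

section \<open>Extremal functions for point evaluations of derivatives\<close>

context doubling_disc_measure
begin

lemma p_integral_le_total:
  assumes "0 < p" "0 \<le> K" "\<And>z. cmod z < 1 \<Longrightarrow> cmod (f z) powr p \<le> K"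
  shows "p_integral p f \<le> ennreal (K * measure \<mu> UNIV)"
proof -
  have "p_integral p f \<le> (\<integral>\<^sup>+z. ennreal K \<partial>\<mu>)"
    unfolding p_integral_def using assms
    by (intro nn_integral_mono ennreal_leI) (auto split: split_indicator)
  then show ?thesis using assms(2) by (simp add: emeasure_eq_measure ennreal_mult)
qed

lemma kernel_p_integral_le:
  assumes p: "0 < p" and a: "cmod a < 1"
  defines "m \<equiv> kernel_exponent p"
  shows "(\<integral>\<^sup>+z. ennreal (((1 - cmod a) / cmod (1 - cnj a * z)) powr (real m * p)) \<partial>\<mu>)
     \<le> ennreal (8 * pi * D * measure \<mu> (carleson_square a))"
proof -
  have "(1 - cmod a) * V (cmod a) \<le> 4 * pi * measure \<mu> (carleson_square a)"
    using carleson_square_comparable(1)[OF a] by (simp add: field_simps)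
  then have "2 * D * ((1 - cmod a) * V (cmod a)) \<le> 2 * D * (4 * pi * measure \<mu> (carleson_square a))"
    using D_ge_1 by (intro mult_left_mono) auto
  then have "ennreal (2 * D * (1 - cmod a) * V (cmod a)) \<le> ennreal (8 * pi * D * measure \<mu> (carleson_square a))"
  proof (intro ennreal_leI)
    have "2 * D * (1 - cmod a) * V (cmod a) = 2 * D * ((1 - cmod a) * V (cmod a))" by (rule mult.assoc)
    also assume "2 * D * ((1 - cmod a) * V (cmod a)) \<le> 2 * D * (4 * pi * measure \<mu> (carleson_square a))"
    finally show "2 * D * (1 - cmod a) * V (cmod a) \<le> 8 * pi * D * measure \<mu> (carleson_square a)"
      by (simp add: mult_ac)
  qed
  then show ?thesis
    using kernel_integral_le[OF kernel_exponent[OF p] a] unfolding m_def by (rule order_trans[rotated])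
qed

lemma kernel_base_bounds:
  assumes "cmod a < 1" "cmod z < 1"
  shows "1 - cmod a \<le> cmod (1 - cnj a * z)" "cmod (1 - cnj a * z) \<le> 2"
proof -
  have "cmod a * cmod z \<le> cmod a * 1" using assms by (intro mult_left_mono) auto
  then have az: "cmod (cnj a * z) \<le> cmod a" by (simp add: norm_mult)
  then show "1 - cmod a \<le> cmod (1 - cnj a * z)"
    using norm_triangle_ineq2[of 1 "cnj a * z"] by simp
  show "cmod (1 - cnj a * z) \<le> 2"
    using az norm_triangle_ineq4[of 1 "cnj a * z"] assms by simp
qed

text \<open>
  The kernel integral is bounded above by the mass of the Carleson square; it is bounded below
  because \<open>|1 - cnj a z| \<le> 2\<close> on the disc. So Carleson squares cannot shrink faster than a power.
\<close>

lemma carleson_square_power_lower_bound: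
  assumes p: "0 < p"
  obtains C where "0 < C"
    "\<And>a. cmod a < 1 \<Longrightarrow> (1 - cmod a) ^ kernel_exponent p \<le> C * measure \<mu> (carleson_square a) powr (1/p)"
proof
  define m where "m = kernel_exponent p"
  define W where "W = measure \<mu> UNIV"
  have W: "0 < W" using nontrivial by (simp add: W_def)
  show "0 < 2 ^ m * (8 * pi * D / W) powr (1/p)" using W D_ge_1 by simp
  fix a :: complex assume a: "cmod a < 1"
  define t where "t = 1 - cmod a"
  define S where "S = measure \<mu> (carleson_square a)"
  have t: "0 < t" using a by (simp add: t_def)
  have S: "0 < S" unfolding S_def using a by (rule carleson_square_pos)
  have "ennreal ((t / 2) powr (real m * p) * W) = (\<integral>\<^sup>+z. ennreal ((t / 2) powr (real m * p)) \<partial>\<mu>)"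
    by (simp add: emeasure_eq_measure ennreal_mult W_def)
  also have "\<dots> \<le> (\<integral>\<^sup>+z. ennreal ((t / cmod (1 - cnj a * z)) powr (real m * p)) \<partial>\<mu>)"
  proof (rule nn_integral_mono_AE, use AE_disc in eventually_elim)
    fix z assume z: "cmod z < 1"
    have "0 < cmod (1 - cnj a * z)" using kernel_base_bounds(1)[OF a z, folded t_def] t by linarith
    then have "t / 2 \<le> t / cmod (1 - cnj a * z)"
      using kernel_base_bounds(2)[OF a z] t by (intro divide_left_mono) auto
    then show "ennreal ((t / 2) powr (real m * p)) \<le> ennreal ((t / cmod (1 - cnj a * z)) powr (real m * p))"
      using t p by (intro ennreal_leI powr_mono2) auto
  qed
  also have "\<dots> \<le> ennreal (8 * pi * D * S)"
    unfolding t_def S_def m_def by (rule kernel_p_integral_le[OF p a])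
  finally have "(t / 2) powr (real m * p) * W \<le> 8 * pi * D * S"
    using S D_ge_1 by (subst (asm) ennreal_le_iff) auto
  then have "(t / 2) powr (real m * p) \<le> 8 * pi * D / W * S" using W by (simp add: field_simps)
  then have "((t / 2) powr (real m * p)) powr (1/p) \<le> (8 * pi * D / W * S) powr (1/p)"
    using p by (intro powr_mono2) auto
  also have "((t / 2) powr (real m * p)) powr (1/p) = (t / 2) ^ m"
    using p t by (simp add: powr_powr powr_realpow)
  also have "(8 * pi * D / W * S) powr (1/p) = (8 * pi * D / W) powr (1/p) * S powr (1/p)"
    by (rule powr_mult)
  finally have "(t / 2) ^ m \<le> (8 * pi * D / W) powr (1/p) * S powr (1/p)" .
  then have "2 ^ m * (t / 2) ^ m \<le> 2 ^ m * ((8 * pi * D / W) powr (1/p) * S powr (1/p))"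
    by (intro mult_left_mono) auto
  also have "2 ^ m * (t / 2) ^ m = t ^ m" by (simp add: power_divide)
  finally show "(1 - cmod a) ^ kernel_exponent p \<le> 2 ^ m * (8 * pi * D / W) powr (1/p) * measure \<mu> (carleson_square a) powr (1/p)"
    by (simp add: t_def m_def S_def mult.assoc)
qed

text \<open>
  The exponent exceeds by one what integrability requires; the surplus makes the kernels tend to
  zero away from the unit circle.
\<close>

definition normalized_kernel :: "real \<Rightarrow> complex \<Rightarrow> complex \<Rightarrow> complex" where
  "normalized_kernel p a = (\<lambda>z. of_real ((1 - cmod a) ^ Suc (kernel_exponent p)
      / (8 * pi * D * measure \<mu> (carleson_square a)) powr (1/p)) / (1 - cnj a * z) ^ Suc (kernel_exponent p))"

lemma normalized_kernel_holomorphic: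
  assumes "cmod a < 1"
  shows "normalized_kernel p a holomorphic_on ball 0 1"
proof -
  have "1 - cnj a * z \<noteq> 0" if "cmod z < 1" for z
  proof
    assume "1 - cnj a * z = 0"
    then have "cmod (1 - cnj a * z) = 0" by (simp only: norm_zero)
    then show False using kernel_base_bounds(1)[OF assms that] assms by linarith
  qed
  then show ?thesis
    unfolding normalized_kernel_def by (intro holomorphic_intros) auto
qed

lemma normalized_kernel_p_integral:
  assumes p: "0 < p" and a: "cmod a < 1"
  shows "p_integral p (normalized_kernel p a) \<le> 1"
proof -
  define m where "m = kernel_exponent p"
  define E where "E = 8 * pi * D * measure \<mu> (carleson_square a)"
  have E: "0 < E" using carleson_square_pos[OF a] D_ge_1 by (simp add: E_def)
  define t where "t = 1 - cmod a"
  have t: "0 < t" using a by (simp add: t_def)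
  have pt: "cmod (normalized_kernel p a z) powr p \<le> 1 / E * (t / cmod (1 - cnj a * z)) powr (real m * p)"
    if z: "cmod z < 1" for z
  proof -
    define x where "x = t / cmod (1 - cnj a * z)"
    have b: "t \<le> cmod (1 - cnj a * z)" using kernel_base_bounds(1)[OF a z] by (simp add: t_def)
    moreover have "0 < cmod (1 - cnj a * z)" using b t by linarith
    ultimately have x: "0 < x" "x \<le> 1" using t by (auto simp only: x_def divide_pos_pos divide_le_eq_1_pos)
    have "cmod (normalized_kernel p a z) = x ^ Suc m / E powr (1/p)"
      using t by (simp add: normalized_kernel_def E_def[symmetric] t_def[symmetric] m_def[symmetric] norm_divide norm_mult norm_power x_def power_divide)
    also have "\<dots> \<le> x ^ m / E powr (1/p)"
      using x by (intro divide_right_mono power_decreasing) auto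
    finally have "cmod (normalized_kernel p a z) powr p \<le> (x ^ m / E powr (1/p)) powr p"
      using p by (intro powr_mono2) auto
    also have "\<dots> = x powr (real m * p) / E"
      using x E p by (simp add: powr_divide powr_powr powr_realpow[symmetric])
    finally show ?thesis by (simp add: x_def)
  qed
  have "p_integral p (normalized_kernel p a) \<le> (\<integral>\<^sup>+z. ennreal (1 / E) * ennreal ((t / cmod (1 - cnj a * z)) powr (real m * p)) \<partial>\<mu>)"
    unfolding p_integral_def
  proof (rule nn_integral_mono)
    fix z
    have "indicator (ball 0 1) z * cmod (normalized_kernel p a z) powr p \<le> 1 / E * (t / cmod (1 - cnj a * z)) powr (real m * p)"
      using pt[of z] E by (auto split: split_indicator)
    then have "ennreal (indicator (ball 0 1) z * cmod (normalized_kernel p a z) powr p)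
        \<le> ennreal (1 / E * (t / cmod (1 - cnj a * z)) powr (real m * p))" by (rule ennreal_leI)
    also have "\<dots> = ennreal (1 / E) * ennreal ((t / cmod (1 - cnj a * z)) powr (real m * p))"
      using E by (intro ennreal_mult) auto
    finally show "ennreal (indicator (ball 0 1) z * cmod (normalized_kernel p a z) powr p)
        \<le> ennreal (1 / E) * ennreal ((t / cmod (1 - cnj a * z)) powr (real m * p))" .
  qed
  also have "\<dots> = ennreal (1 / E) * (\<integral>\<^sup>+z. ennreal ((t / cmod (1 - cnj a * z)) powr (real m * p)) \<partial>\<mu>)"
    by (rule nn_integral_cmult) measurable
  also have "\<dots> \<le> ennreal (1 / E) * ennreal E"
    unfolding t_def m_def E_def by (intro mult_left_mono kernel_p_integral_le p a) auto
  also have "\<dots> = 1" using E by (simp add: ennreal_mult[symmetric])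
  finally show ?thesis .
qed

lemma higher_deriv_normalized_kernel:
  assumes "cmod a < 1" "cmod z < 1"
  shows "cmod ((deriv ^^ n) (normalized_kernel p a) z)
    = (1 - cmod a) ^ Suc (kernel_exponent p) / (8 * pi * D * measure \<mu> (carleson_square a)) powr (1/p)
       * pochhammer (real (Suc (kernel_exponent p))) n * cmod a ^ n / cmod (1 - cnj a * z) ^ (Suc (kernel_exponent p) + n)"
proof -
  have "cmod (pochhammer (of_nat k :: complex) n) = pochhammer (real k) n" for k
    by (metis norm_of_nat pochhammer_of_nat)
  moreover define A where "A = (1 - cmod a) ^ Suc (kernel_exponent p) / (8 * pi * D * measure \<mu> (carleson_square a)) powr (1/p)"
  moreover have "0 \<le> A" using assms by (simp add: A_def)
  ultimately show ?thesis
    unfolding normalized_kernel_def A_def[symmetric] using assms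
    by (subst higher_deriv_inverse_power) (simp_all add: norm_mult norm_divide norm_power del: of_nat_Suc power_Suc)
qed

text \<open>
  At \<open>z = a\<close> the base of the denominator is \<open>1 - |a|\<^sup>2 \<le> 2 (1 - |a|)\<close>, so only the powers of
  \<open>1 - |a|\<close> that come from differentiation remain; the factor \<open>|a|\<^sup>n\<close> restricts the bound to \<open>|a| \<ge> 1/2\<close>.
\<close>

lemma normalized_kernel_deriv_lower:
  assumes p: "0 < p"
  obtains c where "0 < c"
    "\<And>a. cmod a < 1 \<Longrightarrow> 1/2 \<le> cmod a \<Longrightarrow>
      c / (measure \<mu> (carleson_square a) powr (1/p) * (1 - cmod a) ^ n) \<le> cmod ((deriv ^^ n) (normalized_kernel p a) a)"
proof
  define m where "m = Suc (kernel_exponent p)"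
  define c where "c = 1 / ((8 * pi * D) powr (1/p) * (2 ^ m * 2 ^ n * 2 ^ n))"
  show "0 < c" using D_ge_1 by (simp add: c_def)
  fix a :: complex assume a: "cmod a < 1" "1/2 \<le> cmod a"
  define t where "t = 1 - cmod a"
  define S where "S = measure \<mu> (carleson_square a)"
  have t: "0 < t" using a by (simp add: t_def)
  have S: "0 < S" unfolding S_def using a(1) by (rule carleson_square_pos)
  have "1 - cnj a * a = of_real (1 - (cmod a)\<^sup>2)" 
    unfolding of_real_diff complex_norm_square by (simp add: mult.commute)
  then have den: "cmod (1 - cnj a * a) = 1 - (cmod a)\<^sup>2"
    using a by (simp only: norm_of_real) (simp add: abs_square_le_1)
  have den2: "0 < 1 - (cmod a)\<^sup>2" "1 - (cmod a)\<^sup>2 \<le> 2 * t"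
  proof -
    show "0 < 1 - (cmod a)\<^sup>2" using a by (simp add: abs_square_less_1)
    have "0 \<le> (1 - cmod a)\<^sup>2" by simp
    then show "1 - (cmod a)\<^sup>2 \<le> 2 * t" unfolding power2_diff t_def by simp
  qed
  have poch: "1 \<le> pochhammer (real m) n"
    unfolding pochhammer_prod by (rule prod_ge_1) (auto simp: m_def)
  have "c / (S powr (1/p) * t ^ n) = t ^ m / (8 * pi * D * S) powr (1/p) * 1 * (1/2) ^ n / (2 * t) ^ (m + n)"
  proof -
    have alg: "1 / (e * (x * y * y)) / (s * v) = w / (e * s) * 1 * (1 / y) / ((x * w) * (y * v))"
      if "w \<noteq> 0" for e s x y v w :: real
      using that by (simp add: field_simps)
    have "(8 * pi * D * S) powr (1/p) = (8 * pi * D) powr (1/p) * S powr (1/p)"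
      by (rule powr_mult)
    moreover have "(2 * t) ^ (m + n) = (2 ^ m * t ^ m) * (2 ^ n * t ^ n)"
      by (simp only: power_add power_mult_distrib)
    ultimately show ?thesis
      unfolding c_def power_divide power_one using alg[of "t ^ m"] t by simp
  qed
  also have "\<dots> \<le> t ^ m / (8 * pi * D * S) powr (1/p) * pochhammer (real m) n * cmod a ^ n / (1 - (cmod a)\<^sup>2) ^ (m + n)"
    using t den2 poch a S D_ge_1 by (intro frac_le mult_mono power_mono zero_less_power mult_nonneg_nonneg) auto
  also have "\<dots> = cmod ((deriv ^^ n) (normalized_kernel p a) a)"
    unfolding higher_deriv_normalized_kernel[OF a(1) a(1)] den t_def S_def m_def ..
  finally show "c / (measure \<mu> (carleson_square a) powr (1/p) * (1 - cmod a) ^ n) \<le> cmod ((deriv ^^ n) (normalized_kernel p a) a)"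
    by (simp add: S_def t_def)
qed

text \<open>
  The kernel has one more power of \<open>1 - |a|\<close> than is needed to dominate
  \<open>\<omega>(S(a))\<^sup>1\<^sup>/\<^sup>p\<close>, and away from the unit circle its denominator is harmless.
\<close>

lemma normalized_kernel_deriv_decay:
  assumes p: "0 < p" and w: "cmod w < 1"
  obtains K where "\<And>a. cmod a < 1 \<Longrightarrow> cmod ((deriv ^^ n) (normalized_kernel p a) w) \<le> K * (1 - cmod a)"
proof -
  define m where "m = kernel_exponent p"
  obtain C where C: "0 < C" "\<And>a. cmod a < 1 \<Longrightarrow> (1 - cmod a) ^ m \<le> C * measure \<mu> (carleson_square a) powr (1/p)"
    unfolding m_def using carleson_square_power_lower_bound[OF p] by metis
  define K where "K = C / (8 * pi * D) powr (1/p) * pochhammer (real (Suc m)) n / (1 - cmod w) ^ (Suc m + n)"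
  have "cmod ((deriv ^^ n) (normalized_kernel p a) w) \<le> K * (1 - cmod a)" if a: "cmod a < 1" for a
  proof -
    define S where "S = measure \<mu> (carleson_square a)"
    define t where "t = 1 - cmod a"
    have t: "0 < t" using a by (simp add: t_def)
    have S: "0 < S" unfolding S_def using a by (rule carleson_square_pos)
    have E: "(8 * pi * D * S) powr (1/p) = (8 * pi * D) powr (1/p) * S powr (1/p)"
      by (rule powr_mult)
    have pos: "0 < (8 * pi * D) powr (1/p)" "0 < S powr (1/p)" using S D_ge_1 by auto
    have "cmod w * cmod a \<le> cmod w * 1" using a by (intro mult_left_mono) auto
    then have "1 - cmod w \<le> cmod (1 - cnj a * w)"
      using norm_triangle_ineq2[of 1 "cnj a * w"] by (simp add: norm_mult mult.commute)
    moreover have "t ^ Suc m / (8 * pi * D * S) powr (1/p) \<le> C / (8 * pi * D) powr (1/p) * t"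
    proof -
      have "t ^ m * t \<le> C * S powr (1/p) * t"
        using C(2)[OF a] t by (intro mult_right_mono) (auto simp: S_def t_def)
      then have "t ^ Suc m / ((8 * pi * D) powr (1/p) * S powr (1/p)) \<le> C * S powr (1/p) * t / ((8 * pi * D) powr (1/p) * S powr (1/p))"
        using pos by (intro divide_right_mono) (auto simp: mult.commute)
      also have "\<dots> = C / (8 * pi * D) powr (1/p) * t" using pos by (simp add: field_simps)
      finally show ?thesis by (simp only: E)
    qed
    moreover have "0 \<le> pochhammer (real (Suc m)) n" by (intro pochhammer_nonneg) auto
    moreover have "cmod a ^ n \<le> 1" using a by (intro power_le_one) auto
    ultimately have "cmod ((deriv ^^ n) (normalized_kernel p a) w)
        \<le> C / (8 * pi * D) powr (1/p) * t * pochhammer (real (Suc m)) n * 1 / (1 - cmod w) ^ (Suc m + n)"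
      unfolding higher_deriv_normalized_kernel[OF a w] S_def[symmetric] t_def[symmetric] m_def[symmetric]
      using w C(1) t pos
      by (intro frac_le mult_mono power_mono zero_less_power mult_nonneg_nonneg divide_nonneg_nonneg) auto
    then show ?thesis by (simp add: K_def t_def mult_ac)
  qed
  then show ?thesis by (rule that)
qed

text \<open>
  For \<open>|a| < 1/2\<close> the monomial \<open>z\<^sup>n\<close> serves, since its \<open>n\<close>-th derivative is constant and the
  Carleson squares there have mass bounded below.
\<close>

lemma extremal_function:
  assumes p: "0 < p"
  obtains c where "0 < c"
    "\<And>a. cmod a < 1 \<Longrightarrow> \<exists>h. h holomorphic_on ball 0 1 \<and> p_integral p h \<le> 1 \<and>
      c / (measure \<mu> (carleson_square a) powr (1/p) * (1 - cmod a) ^ n) \<le> cmod ((deriv ^^ n) h a)"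
proof -
  define W where "W = measure \<mu> UNIV"
  have W: "0 < W" using nontrivial by (simp add: W_def)
  obtain c1 where c1: "0 < c1" "\<And>a. cmod a < 1 \<Longrightarrow> 1/2 \<le> cmod a \<Longrightarrow>
      c1 / (measure \<mu> (carleson_square a) powr (1/p) * (1 - cmod a) ^ n) \<le> cmod ((deriv ^^ n) (normalized_kernel p a) a)"
    using normalized_kernel_deriv_lower[OF p] by metis
  define c2 where "c2 = fact n / W powr (1/p) * ((V (1/2) / (8 * pi)) powr (1/p) * (1/2) ^ n)"
  have V: "0 < V (1/2)" by (rule V_pos) simp
  have c2: "0 < c2" using W V by (simp add: c2_def)
  define b where "b = W powr (1/p)"
  have b: "0 < b" using W by (simp add: b_def)
  define h where "h z = of_real (1 / b) * z ^ n" for z :: complex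
  have h: "h holomorphic_on ball 0 1" unfolding h_def by (intro holomorphic_intros)
  have "p_integral p h \<le> ennreal (1 / W * measure \<mu> UNIV)"
  proof (rule p_integral_le_total[OF p])
    fix z :: complex assume z: "cmod z < 1"
    have "cmod (h z) = cmod z ^ n / W powr (1/p)" using b by (simp add: h_def norm_divide norm_mult norm_power b_def)
    also have "\<dots> \<le> 1 / W powr (1/p)" using z by (intro divide_right_mono power_le_one) auto
    finally have "cmod (h z) powr p \<le> (1 / W powr (1/p)) powr p" using p by (intro powr_mono2) auto
    also have "\<dots> = 1 / W" using W p by (simp add: powr_divide powr_powr)
    finally show "cmod (h z) powr p \<le> 1 / W" .
  qed (use W in auto)
  then have hI: "p_integral p h \<le> 1" using W by (simp add: W_def[symmetric])
  have hd: "cmod ((deriv ^^ n) h a) = fact n / W powr (1/p)" for a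
  proof -
    have "(deriv ^^ n) h a = of_real (1 / b) * (deriv ^^ n) (\<lambda>z. z ^ n) a"
      unfolding h_def[abs_def] by (rule higher_deriv_cmult[of _ UNIV]) (auto intro: holomorphic_intros)
    also have "(deriv ^^ n) (\<lambda>z::complex. z ^ n) a = fact n"
      using higher_deriv_power[of n 0 n a] by (simp add: pochhammer_fact)
    finally show ?thesis using b by (simp add: norm_divide norm_mult b_def)
  qed
  have small: "c2 / (measure \<mu> (carleson_square a) powr (1/p) * (1 - cmod a) ^ n) \<le> cmod ((deriv ^^ n) h a)"
    if a: "cmod a < 1/2" for a
  proof -
    define S where "S = measure \<mu> (carleson_square a)"
    have "(1/2) / (4 * pi) * V (1/2) \<le> (1 - cmod a) / (4 * pi) * V (cmod a)"
      using a V by (intro mult_mono divide_right_mono V_antimono) auto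
    then have "V (1/2) / (8 * pi) \<le> S"
      using carleson_square_comparable(1)[of a] a by (simp add: S_def)
    then have "(V (1/2) / (8 * pi)) powr (1/p) * (1/2) ^ n \<le> S powr (1/p) * (1 - cmod a) ^ n"
      using a V p by (intro mult_mono powr_mono2 power_mono) auto
    moreover have "0 < (V (1/2) / (8 * pi)) powr (1/p) * (1/2) ^ n" using V by simp
    ultimately have "c2 / (S powr (1/p) * (1 - cmod a) ^ n) \<le> c2 / ((V (1/2) / (8 * pi)) powr (1/p) * (1/2) ^ n)"
      using c2 by (intro frac_le) auto
    also have "\<dots> = fact n / W powr (1/p)" using V by (simp add: c2_def)
    finally show ?thesis by (simp add: hd S_def)
  qed
  show ?thesis
  proof (rule that[of "min c1 c2"])
    show "0 < min c1 c2" using c1(1) c2 by simp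
    fix a :: complex assume a: "cmod a < 1"
    have mono: "min c1 c2 / (measure \<mu> (carleson_square a) powr (1/p) * (1 - cmod a) ^ n)
        \<le> k / (measure \<mu> (carleson_square a) powr (1/p) * (1 - cmod a) ^ n)" if "min c1 c2 \<le> k" for k
      using that a by (intro divide_right_mono) auto
    show "\<exists>h. h holomorphic_on ball 0 1 \<and> p_integral p h \<le> 1 \<and>
      min c1 c2 / (measure \<mu> (carleson_square a) powr (1/p) * (1 - cmod a) ^ n) \<le> cmod ((deriv ^^ n) h a)"
    proof (cases "1/2 \<le> cmod a")
      case True
      then show ?thesis
        using normalized_kernel_holomorphic[OF a] normalized_kernel_p_integral[OF p a] order_trans[OF mono c1(2)[OF a True]]
        by (intro exI[of _ "normalized_kernel p a"]) simp
    next
      case False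
      then show ?thesis using h hI order_trans[OF mono small[of a]] by (intro exI[of _ h]) simp
    qed
  qed
qed

text \<open>
  The unit ball is a normal family: on a compact part of the disc the masses of Carleson squares are
  bounded below, so the pointwise estimate is uniform there.
\<close>

lemma locally_bounded_evaluation:
  assumes p: "0 < p" and r: "0 \<le> r" "r < 1"
  obtains B where "\<And>f N a. f holomorphic_on ball 0 1 \<Longrightarrow> p_integral p f = ennreal (N powr p) \<Longrightarrow> 0 \<le> N \<Longrightarrow> cmod a \<le> r
    \<Longrightarrow> cmod (f a) \<le> B * N"
proof
  fix f N a assume f: "f holomorphic_on ball 0 1" "p_integral p f = ennreal (N powr p)" "0 \<le> N" and a: "cmod a \<le> r"
  define s where "s = (1 - r) / (4 * pi) * V r"
  have s: "0 < s" using r V_pos[of r] by (simp add: s_def)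
  have "s \<le> (1 - cmod a) / (4 * pi) * V (cmod a)"
    unfolding s_def using a r V_nonneg by (intro mult_mono divide_right_mono V_antimono) auto
  also have "\<dots> \<le> measure \<mu> (carleson_square a)"
    using a r by (intro carleson_square_comparable) auto
  finally have "s powr (1/p) \<le> measure \<mu> (carleson_square a) powr (1/p)"
    using s p by (intro powr_mono2) auto
  moreover have "0 < s powr (1/p)" using s by simp
  ultimately have "(4 * D ^ 4) powr (1/p) * N / measure \<mu> (carleson_square a) powr (1/p) \<le> (4 * D ^ 4) powr (1/p) * N / s powr (1/p)"
    using f(3) by (intro divide_left_mono mult_pos_pos) (auto intro: less_le_trans)
  then show "cmod (f a) \<le> (4 * D ^ 4) powr (1/p) / s powr (1/p) * N"
    using higher_deriv_le[OF f(1) p f(2,3), of a 0] a r by simp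
qed

end

section \<open>Boundedness and compactness from derivative estimates\<close>

definition vanishes_at_circle :: "(complex \<Rightarrow> complex) \<Rightarrow> (complex \<Rightarrow> real) \<Rightarrow> bool" where
  "vanishes_at_circle \<phi> Q \<longleftrightarrow> (\<forall>\<epsilon>>0. \<exists>r. 0 < r \<and> r < 1 \<and>
     (\<forall>z\<in>unit_disc. r < cmod (\<phi> z) \<and> cmod (\<phi> z) < 1 \<longrightarrow> Q z < \<epsilon>))"

text \<open>
  Sharp two-sided bounds, with constants \<open>C\<close> and \<open>c\<close>, for the evaluation of the \<open>n\<close>-th derivative.
  The functions of the lower bound are arbitrary, while \<open>k a\<close> attains it for \<open>|a| \<ge> 1/2\<close> with derivatives that tend to zero pointwise as \<open>|a| \<rightarrow> 1\<close>.
\<close>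

locale bergman_derivative_estimates =
  fixes p :: real and \<omega> :: "complex \<Rightarrow> real" and n :: nat and d :: "complex \<Rightarrow> real"
    and C c :: real and k :: "complex \<Rightarrow> complex \<Rightarrow> complex"
  defines "d \<equiv> \<lambda>a. weight_of \<omega> (carleson_square a) powr (1 / p) * (1 - cmod a) ^ n"
  assumes d_pos: "cmod a < 1 \<Longrightarrow> 0 < d a"
    and C_pos: "0 < C" and c_pos: "0 < c"
    and upper: "f \<in> bergman p \<omega> \<Longrightarrow> cmod a < 1 \<Longrightarrow> cmod ((deriv ^^ n) f a) \<le> C * bergman_norm p \<omega> f / d a"
    and lower: "cmod a < 1 \<Longrightarrow> \<exists>h\<in>bergman p \<omega>. bergman_norm p \<omega> h \<le> 1 \<and> c / d a \<le> cmod ((deriv ^^ n) h a)"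
    and locally_bounded: "0 \<le> r \<Longrightarrow> r < 1 \<Longrightarrow>
        \<exists>B. \<forall>f\<in>bergman p \<omega>. \<forall>a. cmod a \<le> r \<longrightarrow> cmod (f a) \<le> B * bergman_norm p \<omega> f"
    and kernel: "cmod a < 1 \<Longrightarrow> k a \<in> bergman p \<omega>" "cmod a < 1 \<Longrightarrow> bergman_norm p \<omega> (k a) \<le> 1"
    and kernel_lower: "cmod a < 1 \<Longrightarrow> 1/2 \<le> cmod a \<Longrightarrow> c / d a \<le> cmod ((deriv ^^ n) (k a) a)"
    and kernel_decay: "cmod w < 1 \<Longrightarrow> \<exists>K. \<forall>a. cmod a < 1 \<longrightarrow> cmod ((deriv ^^ n) (k a) w) \<le> K * (1 - cmod a)"
begin

lemma norm_nonneg: "0 \<le> bergman_norm p \<omega> f"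
  by (simp add: bergman_norm_def)

context
  fixes \<phi> u :: "complex \<Rightarrow> complex"
  assumes \<phi>: "self_map \<phi>" and u: "u \<in> H_infinity"
begin

abbreviation T :: operator where "T \<equiv> weighted_diff_comp n \<phi> u"

abbreviation q :: "complex \<Rightarrow> real" where "q \<equiv> test_quotient p \<omega> n \<phi> u"

lemma q_eq: "q z = cmod (u z) / d (\<phi> z)"
  by (simp add: test_quotient_def d_def)

lemma \<phi>_disc: "cmod z < 1 \<Longrightarrow> cmod (\<phi> z) < 1"
  using \<phi> by (auto simp: self_map_def image_subset_iff)

lemma q_nonneg: "cmod z < 1 \<Longrightarrow> 0 \<le> q z"
  using d_pos[OF \<phi>_disc] by (simp add: q_eq less_imp_le)

lemma T_holomorphic:
  assumes "f holomorphic_on ball 0 1"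
  shows "T f holomorphic_on ball 0 1"
proof -
  have "(deriv ^^ n) f holomorphic_on ball 0 1"
    using assms by (intro holomorphic_higher_deriv) auto
  moreover have "\<phi> holomorphic_on ball 0 1" "\<phi> ` ball 0 1 \<subseteq> ball 0 1"
    using \<phi> by (auto simp: self_map_def)
  ultimately have "(\<lambda>z. (deriv ^^ n) f (\<phi> z)) holomorphic_on ball 0 1"
    using holomorphic_on_compose_gen[of \<phi> "ball 0 1" "(deriv ^^ n) f" "ball 0 1"] by (simp add: o_def)
  then show ?thesis
    unfolding weighted_diff_comp_def using u by (intro holomorphic_on_mult) (auto simp: H_infinity_def)
qed

lemma T_le_of_deriv_le:
  assumes "cmod z < 1" "cmod ((deriv ^^ n) f (\<phi> z)) \<le> K / d (\<phi> z)"
  shows "cmod (T f z) \<le> K * q z"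
proof -
  have "cmod (T f z) \<le> cmod (u z) * (K / d (\<phi> z))"
    unfolding weighted_diff_comp_def norm_mult using assms(2) by (intro mult_left_mono) auto
  then show ?thesis by (simp add: q_eq mult.commute)
qed

lemma T_le: "f \<in> bergman p \<omega> \<Longrightarrow> cmod z < 1 \<Longrightarrow> cmod (T f z) \<le> C * bergman_norm p \<omega> f * q z"
  by (intro T_le_of_deriv_le upper \<phi>_disc)

lemma T_ge:
  assumes "cmod z < 1" "c / d (\<phi> z) \<le> cmod ((deriv ^^ n) f (\<phi> z))"
  shows "c * q z \<le> cmod (T f z)"
proof -
  have "cmod (u z) * (c / d (\<phi> z)) \<le> cmod (T f z)"
    unfolding weighted_diff_comp_def norm_mult using assms(2) by (intro mult_left_mono) auto
  then show ?thesis by (simp add: q_eq mult.commute)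
qed

lemma le_sup_norm: "f \<in> H_infinity \<Longrightarrow> cmod z < 1 \<Longrightarrow> cmod (f z) \<le> sup_norm f"
  unfolding sup_norm_def
proof (rule cSUP_upper)
  assume "f \<in> H_infinity"
  then have "bounded ((\<lambda>z. cmod (f z)) ` ball 0 1)"
    unfolding H_infinity_def bounded_iff by simp
  then show "bdd_above ((\<lambda>z. cmod (f z)) ` ball 0 1)" by (rule bounded_imp_bdd_above)
qed simp

lemma H_infinityI:
  "f holomorphic_on ball 0 1 \<Longrightarrow> (\<And>z. cmod z < 1 \<Longrightarrow> cmod (f z) \<le> K) \<Longrightarrow> f \<in> H_infinity"
  unfolding H_infinity_def by (auto intro!: boundedI)

lemma sup_norm_le: "(\<And>z. cmod z < 1 \<Longrightarrow> cmod (f z) \<le> K) \<Longrightarrow> sup_norm f \<le> K"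
  unfolding sup_norm_def by (rule cSUP_least) auto

lemma bergmanD: "f \<in> bergman p \<omega> \<Longrightarrow> f holomorphic_on ball 0 1"
  by (simp add: bergman_def)

lemma sup_norm_T_le:
  assumes bdd: "bdd_above (q ` ball 0 1)" and f: "f \<in> bergman p \<omega>"
  shows "T f \<in> H_infinity" "sup_norm (T f) \<le> C * (SUP z\<in>ball 0 1. q z) * bergman_norm p \<omega> f"
proof -
  have le: "cmod (T f z) \<le> C * (SUP z\<in>ball 0 1. q z) * bergman_norm p \<omega> f" if z: "cmod z < 1" for z
  proof -
    have "q z \<le> (SUP z\<in>ball 0 1. q z)" using z by (intro cSUP_upper bdd) auto
    then have "C * bergman_norm p \<omega> f * q z \<le> C * bergman_norm p \<omega> f * (SUP z\<in>ball 0 1. q z)"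
      using C_pos norm_nonneg by (intro mult_left_mono) auto
    then show ?thesis using T_le[OF f z] by (simp add: mult_ac)
  qed
  then show "sup_norm (T f) \<le> C * (SUP z\<in>ball 0 1. q z) * bergman_norm p \<omega> f"
    by (rule sup_norm_le)
  show "T f \<in> H_infinity"
    using T_holomorphic[OF bergmanD[OF f]] le by (rule H_infinityI)
qed

lemma bounded_operatorI:
  assumes "bdd_above (q ` ball 0 1)"
  shows "bounded_operator p \<omega> T"
  unfolding bounded_operator_def using sup_norm_T_le[OF assms] by blast

lemma sup_norm_le_operator_norm:
  assumes bd: "bounded_operator p \<omega> T" and f: "f \<in> bergman p \<omega>" "bergman_norm p \<omega> f \<le> 1"
  shows "sup_norm (T f) \<le> operator_norm p \<omega> T"
  unfolding operator_norm_def
proof (rule cSUP_upper)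
  obtain M where M: "\<And>f. f \<in> bergman p \<omega> \<Longrightarrow> sup_norm (T f) \<le> M * bergman_norm p \<omega> f"
    using bd by (auto simp: bounded_operator_def)
  have "sup_norm (T g) \<le> \<bar>M\<bar>" if "g \<in> bergman p \<omega>" "bergman_norm p \<omega> g \<le> 1" for g
  proof -
    have "M * bergman_norm p \<omega> g \<le> \<bar>M\<bar> * 1"
      using that norm_nonneg[of g] by (intro mult_mono) auto
    then show ?thesis using M[OF that(1)] by simp
  qed
  then show "bdd_above ((\<lambda>f. sup_norm (T f)) ` {f \<in> bergman p \<omega>. bergman_norm p \<omega> f \<le> 1})"
    by (intro bdd_aboveI[of _ "\<bar>M\<bar>"]) auto
qed (use f in auto)

lemma q_le_operator_norm:
  assumes bd: "bounded_operator p \<omega> T" and z: "cmod z < 1"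
  shows "c * q z \<le> operator_norm p \<omega> T"
proof -
  obtain h where h: "h \<in> bergman p \<omega>" "bergman_norm p \<omega> h \<le> 1" "c / d (\<phi> z) \<le> cmod ((deriv ^^ n) h (\<phi> z))"
    using lower[OF \<phi>_disc[OF z]] by blast
  have "c * q z \<le> cmod (T h z)" by (rule T_ge[OF z h(3)])
  also have "\<dots> \<le> sup_norm (T h)"
    using bd h(1) by (intro le_sup_norm z) (auto simp: bounded_operator_def)
  also have "\<dots> \<le> operator_norm p \<omega> T" by (rule sup_norm_le_operator_norm[OF bd h(1,2)])
  finally show ?thesis .
qed

lemma bounded_operatorD:
  assumes "bounded_operator p \<omega> T"
  shows "bdd_above (q ` ball 0 1)"
proof (rule bdd_aboveI2)
  fix z :: complex assume "z \<in> ball 0 1"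
  then show "q z \<le> operator_norm p \<omega> T / c"
    using q_le_operator_norm[OF assms, of z] c_pos by (simp add: field_simps)
qed

lemma operator_norm_bounds:
  assumes bd: "bounded_operator p \<omega> T"
  shows "c * (SUP z\<in>ball 0 1. q z) \<le> operator_norm p \<omega> T"
    and "operator_norm p \<omega> T \<le> C * (SUP z\<in>ball 0 1. q z)"
proof -
  note bdd = bounded_operatorD[OF bd]
  have "(SUP z\<in>ball 0 1. q z) \<le> operator_norm p \<omega> T / c"
    using q_le_operator_norm[OF bd] c_pos by (intro cSUP_least) (auto simp: field_simps)
  then show "c * (SUP z\<in>ball 0 1. q z) \<le> operator_norm p \<omega> T"
    using c_pos by (simp add: field_simps)
  have "0 \<le> (SUP z\<in>ball 0 1. q z)"
    by (rule order_trans[OF q_nonneg[of 0] cSUP_upper[OF _ bdd]]) auto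
  then have CS: "0 \<le> C * (SUP z\<in>ball 0 1. q z)" using C_pos by simp
  have "sup_norm (T f) \<le> C * (SUP z\<in>ball 0 1. q z)" if "f \<in> bergman p \<omega>" "bergman_norm p \<omega> f \<le> 1" for f
  proof -
    have "sup_norm (T f) \<le> C * (SUP z\<in>ball 0 1. q z) * bergman_norm p \<omega> f"
      by (rule sup_norm_T_le(2)[OF bdd that(1)])
    also have "\<dots> \<le> C * (SUP z\<in>ball 0 1. q z) * 1" by (rule mult_left_mono[OF that(2) CS])
    finally show ?thesis by simp
  qed
  moreover obtain h where "h \<in> bergman p \<omega>" "bergman_norm p \<omega> h \<le> 1" using lower[of 0] by auto
  ultimately show "operator_norm p \<omega> T \<le> C * (SUP z\<in>ball 0 1. q z)"
    unfolding operator_norm_def by (intro cSUP_least) auto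
qed

abbreviation vanishing :: bool where "vanishing \<equiv> vanishes_at_circle \<phi> q"

lemma vanishingE:
  assumes "vanishing" "0 < \<epsilon>"
  obtains r where "0 < r" "r < 1" "\<And>z. cmod z < 1 \<Longrightarrow> r < cmod (\<phi> z) \<Longrightarrow> q z < \<epsilon>"
  using assms \<phi>_disc unfolding vanishes_at_circle_def by (metis dist_0_norm mem_ball)

lemma vanishing_of_range_away:
  assumes "(SUP z\<in>unit_disc. cmod (\<phi> z)) < 1"
  shows vanishing
proof -
  define s where "s = (SUP z\<in>unit_disc. cmod (\<phi> z))"
  have le: "cmod (\<phi> z) \<le> s" if "cmod z < 1" for z
    unfolding s_def using \<phi>_disc that
    by (intro cSUP_upper) (auto intro!: bdd_aboveI[of _ 1] less_imp_le)
  have "0 \<le> s" using le[of 0] norm_ge_zero[of "\<phi> 0"] by (auto simp del: norm_ge_zero)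
  then show ?thesis
    using assms le unfolding vanishes_at_circle_def s_def[symmetric]
    by (intro allI impI exI[of _ "(1 + s) / 2"]) force
qed

lemma u_bounded: obtains U where "0 \<le> U" "\<And>z. cmod z < 1 \<Longrightarrow> cmod (u z) \<le> U"
proof -
  obtain U where "\<And>z. cmod z < 1 \<Longrightarrow> cmod (u z) \<le> U"
    using u unfolding H_infinity_def bounded_iff by force
  moreover from this[of 0] have "0 \<le> U" by (auto intro: order_trans[OF norm_ge_zero])
  ultimately show ?thesis using that by blast
qed

text \<open>
  Besides Bergman functions this is applied to the limit of a bounded sequence of them, of which only
  the derivative bound is known. Near the circle that bound is compared with the quotient; elsewhere
  compactness of a smaller disc suffices.
\<close>

lemma T_in_H_infinity:
  assumes van: vanishing and f: "f holomorphic_on ball 0 1"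
    and K: "\<And>a. cmod a < 1 \<Longrightarrow> cmod ((deriv ^^ n) f a) \<le> K / d a"
  shows "T f \<in> H_infinity"
proof -
  obtain r where r: "0 < r" "r < 1" "\<And>z. cmod z < 1 \<Longrightarrow> r < cmod (\<phi> z) \<Longrightarrow> q z < 1"
    using vanishingE[OF van, of 1] by auto
  obtain U where U: "0 \<le> U" "\<And>z. cmod z < 1 \<Longrightarrow> cmod (u z) \<le> U" using u_bounded by blast
  have "(deriv ^^ n) f holomorphic_on ball 0 1" using f by (intro holomorphic_higher_deriv) auto
  then have "continuous_on (cball 0 r) ((deriv ^^ n) f)"
    using r by (intro holomorphic_on_imp_continuous_on) (auto elim!: holomorphic_on_subset)
  then have "bounded ((deriv ^^ n) f ` cball 0 r)"
    by (intro compact_imp_bounded compact_continuous_image compact_cball)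
  then obtain L where L: "\<And>a. cmod a \<le> r \<Longrightarrow> cmod ((deriv ^^ n) f a) \<le> L"
    unfolding bounded_iff by force
  have "0 \<le> K"
    using order_trans[OF norm_ge_zero K[of 0]] d_pos[of 0] by (simp add: zero_le_divide_iff)
  have "cmod (T f z) \<le> K + U * L" if z: "cmod z < 1" for z
  proof (cases "r < cmod (\<phi> z)")
    case True
    have "cmod (T f z) \<le> K * q z" by (intro T_le_of_deriv_le z K \<phi>_disc)
    also have "\<dots> \<le> K * 1" using r(3)[OF z True] \<open>0 \<le> K\<close> by (intro mult_left_mono) auto
    moreover have "0 \<le> U * L" using U(1) order_trans[OF norm_ge_zero L[of 0]] r by simp
    ultimately show ?thesis by simp
  next
    case False
    then have "cmod (T f z) \<le> U * L"
      unfolding weighted_diff_comp_def norm_mult using U z by (intro mult_mono L) auto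
    then show ?thesis using \<open>0 \<le> K\<close> by simp
  qed
  with T_holomorphic[OF f] show ?thesis by (rule H_infinityI)
qed

text \<open>
  A bounded sequence has a locally uniformly convergent subsequence, with limit \<open>g\<close> say. Where \<open>\<phi>\<close> stays in a
  smaller disc the images converge uniformly; where \<open>\<phi>\<close> is near the circle both \<open>T F\<close> and
  \<open>T g\<close> are small, because the bound on derivatives survives the pointwise limit.
\<close>

lemma compact_operatorI:
  assumes van: vanishing
  shows "compact_operator p \<omega> T"
  unfolding compact_operator_def
proof (intro conjI ballI allI impI)
  show TH: "T f \<in> H_infinity" if "f \<in> bergman p \<omega>" for f
    using upper[OF that] by (rule T_in_H_infinity[OF van bergmanD[OF that]])
  fix F :: "nat \<Rightarrow> complex \<Rightarrow> complex"
  assume "(\<forall>j. F j \<in> bergman p \<omega>) \<and> (\<exists>M. \<forall>j. bergman_norm p \<omega> (F j) \<le> M)"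
  then obtain M where F: "\<And>j. F j \<in> bergman p \<omega>" and M: "\<And>j. bergman_norm p \<omega> (F j) \<le> M" by blast
  have M0: "0 \<le> M" using M[of 0] norm_nonneg[of "F 0"] by linarith
  have holF: "F j holomorphic_on ball 0 1" for j by (rule bergmanD[OF F])
  obtain g s where g: "g holomorphic_on ball 0 1" and s: "strict_mono (s :: nat \<Rightarrow> nat)"
    and unif: "\<And>K. compact K \<Longrightarrow> K \<subseteq> ball 0 1 \<Longrightarrow> uniform_limit K (F \<circ> s) g sequentially"
  proof (rule Montel[of "ball 0 1" "range F" F])
    fix K :: "complex set" assume K: "compact K" "K \<subseteq> ball 0 1"
    show "\<exists>B. \<forall>h\<in>range F. \<forall>z\<in>K. cmod (h z) \<le> B"
    proof (cases "K = {}")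
      case False
      obtain x where x: "x \<in> K" "\<And>y. y \<in> K \<Longrightarrow> cmod y \<le> cmod x"
        using continuous_attains_sup[OF K(1) False continuous_on_norm[OF continuous_on_id]] by auto
      then have "cmod x < 1" using K(2) by auto
      then obtain B where B: "\<forall>f\<in>bergman p \<omega>. \<forall>a. cmod a \<le> cmod x \<longrightarrow> cmod (f a) \<le> B * bergman_norm p \<omega> f"
        using locally_bounded[of "cmod x"] by auto
      have "cmod (F j z) \<le> \<bar>B\<bar> * M" if "z \<in> K" for j z
      proof -
        have "cmod (F j z) \<le> B * bergman_norm p \<omega> (F j)" using B F x(2)[OF that] by blast
        also have "\<dots> \<le> \<bar>B\<bar> * M" using M norm_nonneg by (intro mult_mono) auto
        finally show ?thesis .
      qed
      then show ?thesis by blast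
    qed auto
  qed (use holF in auto)
  have deriv_unif: "\<exists>N. \<forall>j\<ge>N. \<forall>a. cmod a \<le> r \<longrightarrow> cmod ((deriv ^^ n) (F (s j)) a - (deriv ^^ n) g a) < \<delta>"
    if r: "r < 1" and \<delta>: "0 < \<delta>" for r \<delta>
  proof -
    \<comment> \<open>Discs of radius \<open>\<rho>\<close> about points of modulus at most \<open>r\<close> stay in a compact part of the unit disc.\<close>
    define \<rho> where "\<rho> = (1 - r) / 2"
    have \<rho>: "0 < \<rho>" "r + \<rho> < 1" using r by (auto simp: \<rho>_def field_simps)
    define \<eta> where "\<eta> = \<delta> * \<rho> ^ n / (2 * fact n)"
    have \<eta>: "0 < \<eta>" using \<rho> \<delta> by (simp add: \<eta>_def)
    have "cball 0 (r + \<rho>) \<subseteq> ball (0::complex) 1" using \<rho> by auto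
    from uniform_limitD[OF unif[OF compact_cball this] \<eta>]
    obtain N where N: "\<And>j z. j \<ge> N \<Longrightarrow> cmod z \<le> r + \<rho> \<Longrightarrow> cmod (F (s j) z - g z) < \<eta>"
      unfolding eventually_sequentially by (force simp: dist_norm)
    have "cmod ((deriv ^^ n) (F (s j)) a - (deriv ^^ n) g a) < \<delta>" if j: "j \<ge> N" and a: "cmod a \<le> r" for j a
    proof -
      have sub: "cball a \<rho> \<subseteq> ball 0 1" and sub': "\<And>z. cmod (a - z) = \<rho> \<Longrightarrow> cmod z \<le> r + \<rho>"
      proof -
        have *: "cmod z \<le> r + \<rho>" if "cmod (a - z) \<le> \<rho>" for z
          using that a norm_triangle_ineq2[of z a] by (simp add: norm_minus_commute)
        then show "cball a \<rho> \<subseteq> ball 0 1" using \<rho>(2) by (force simp: dist_norm)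
        show "\<And>z. cmod (a - z) = \<rho> \<Longrightarrow> cmod z \<le> r + \<rho>" using * by simp
      qed
      have hol: "(\<lambda>z. F (s j) z - g z) holomorphic_on ball 0 1" by (intro holomorphic_intros holF g)
      have "cmod ((deriv ^^ n) (\<lambda>z. F (s j) z - g z) a) \<le> fact n * \<eta> / \<rho> ^ n"
      proof (rule Cauchy_inequality)
        show "(\<lambda>z. F (s j) z - g z) holomorphic_on ball a \<rho>"
          by (rule holomorphic_on_subset[OF hol]) (use sub ball_subset_cball in blast)
        show "continuous_on (cball a \<rho>) (\<lambda>z. F (s j) z - g z)"
          by (rule holomorphic_on_imp_continuous_on[OF holomorphic_on_subset[OF hol sub]])
      qed (use \<rho> N[OF j sub'] in \<open>auto intro: less_imp_le\<close>)
      moreover have "(deriv ^^ n) (\<lambda>z. F (s j) z - g z) a = (deriv ^^ n) (F (s j)) a - (deriv ^^ n) g a"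
        using a r by (intro higher_deriv_diff[of _ "ball 0 1"] holF g) auto
      moreover have "fact n * \<eta> / \<rho> ^ n = \<delta> / 2" using \<rho> by (simp add: \<eta>_def)
      ultimately have "cmod ((deriv ^^ n) (F (s j)) a - (deriv ^^ n) g a) \<le> \<delta> / 2" by simp
      then show ?thesis using \<delta> by linarith
    qed
    then show ?thesis by blast
  qed
  have g_upper: "cmod ((deriv ^^ n) g a) \<le> C * M / d a" if a: "cmod a < 1" for a
  proof (rule field_le_epsilon)
    fix e :: real assume e: "0 < e"
    obtain j where j: "cmod ((deriv ^^ n) (F (s j)) a - (deriv ^^ n) g a) < e"
      using deriv_unif[OF a e] by (metis order_refl)
    have "cmod ((deriv ^^ n) g a) \<le> cmod ((deriv ^^ n) (F (s j)) a) + e"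
      using j norm_triangle_ineq2[of "(deriv ^^ n) g a" "(deriv ^^ n) (F (s j)) a"]
      by (simp add: norm_minus_commute)
    also have "cmod ((deriv ^^ n) (F (s j)) a) \<le> C * bergman_norm p \<omega> (F (s j)) / d a"
      by (rule upper[OF F a])
    also have "\<dots> \<le> C * M / d a"
      using C_pos M d_pos[OF a] by (intro divide_right_mono mult_left_mono) auto
    finally show "cmod ((deriv ^^ n) g a) \<le> C * M / d a + e" by simp
  qed
  have "(\<lambda>j. sup_norm (\<lambda>z. T (F (s j)) z - T g z)) \<longlonglongrightarrow> 0"
  proof (rule LIMSEQ_I)
    fix e :: real assume e: "0 < e"
    obtain U where U: "0 \<le> U" "\<And>z. cmod z < 1 \<Longrightarrow> cmod (u z) \<le> U" using u_bounded by blast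
    define \<epsilon> where "\<epsilon> = e / (4 * (C * M + 1))"
    define \<delta> where "\<delta> = e / (2 * (U + 1))"
    have CM: "0 \<le> C * M" using C_pos M0 by simp
    have \<epsilon>: "0 < \<epsilon>" "2 * (C * M) * \<epsilon> \<le> e / 2"
      using CM e by (auto simp: \<epsilon>_def field_simps)
    have \<delta>: "0 < \<delta>" "U * \<delta> \<le> e / 2"
      using U(1) e by (auto simp: \<delta>_def field_simps)
    obtain r where r: "0 < r" "r < 1" "\<And>z. cmod z < 1 \<Longrightarrow> r < cmod (\<phi> z) \<Longrightarrow> q z < \<epsilon>"
      using vanishingE[OF van \<epsilon>(1)] by auto
    obtain N where N: "\<And>j a. j \<ge> N \<Longrightarrow> cmod a \<le> r \<Longrightarrow> cmod ((deriv ^^ n) (F (s j)) a - (deriv ^^ n) g a) < \<delta>"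
      using deriv_unif[OF r(2) \<delta>(1)] by blast
    have "norm (sup_norm (\<lambda>z. T (F (s j)) z - T g z) - 0) < e" if j: "j \<ge> N" for j
    proof -
      have pt: "cmod (T (F (s j)) z - T g z) \<le> e / 2" if z: "cmod z < 1" for z
      proof (cases "r < cmod (\<phi> z)")
        case True
        have "cmod (T (F (s j)) z) \<le> C * bergman_norm p \<omega> (F (s j)) * q z" by (rule T_le[OF F z])
        also have "\<dots> \<le> C * M * q z"
          using C_pos M q_nonneg[OF z] by (intro mult_right_mono mult_left_mono) auto
        finally have "cmod (T (F (s j)) z) \<le> C * M * q z" .
        moreover have "cmod (T g z) \<le> C * M * q z" by (intro T_le_of_deriv_le z g_upper \<phi>_disc)
        ultimately have "cmod (T (F (s j)) z - T g z) \<le> 2 * (C * M) * q z"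
          using norm_triangle_ineq4[of "T (F (s j)) z" "T g z"] by simp
        also have "\<dots> \<le> 2 * (C * M) * \<epsilon>"
          using CM r(3)[OF z True] by (intro mult_left_mono) auto
        finally show ?thesis using \<epsilon>(2) by simp
      next
        case False
        have "T (F (s j)) z - T g z = u z * ((deriv ^^ n) (F (s j)) (\<phi> z) - (deriv ^^ n) g (\<phi> z))"
          by (simp add: weighted_diff_comp_def algebra_simps)
        then have "cmod (T (F (s j)) z - T g z) \<le> U * \<delta>"
          unfolding norm_mult using U z N[OF j, of "\<phi> z"] False
          by (simp add: norm_mult) (intro mult_mono, auto)
        then show ?thesis using \<delta>(2) by simp
      qed
      have "sup_norm (\<lambda>z. T (F (s j)) z - T g z) \<le> e / 2" using pt by (rule sup_norm_le)
      moreover have "cmod (T (F (s j)) 0 - T g 0) \<le> sup_norm (\<lambda>z. T (F (s j)) z - T g z)"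
        unfolding sup_norm_def using pt by (intro cSUP_upper bdd_aboveI[of _ "e / 2"]) auto
      then have "0 \<le> sup_norm (\<lambda>z. T (F (s j)) z - T g z)" by (rule order_trans[OF norm_ge_zero])
      ultimately show ?thesis using e by simp
    qed
    then show "\<exists>N. \<forall>j\<ge>N. norm (sup_norm (\<lambda>z. T (F (s j)) z - T g z) - 0) < e" by blast
  qed
  moreover have "T g \<in> H_infinity" by (rule T_in_H_infinity[OF van g g_upper])
  ultimately show "\<exists>r g. strict_mono (r :: nat \<Rightarrow> nat) \<and> g \<in> H_infinity \<and>
           (\<lambda>j. sup_norm (\<lambda>z. T (F (r j)) z - g z)) \<longlonglongrightarrow> 0"
    using s by blast
qed

lemma H_infinity_diff: "f \<in> H_infinity \<Longrightarrow> g \<in> H_infinity \<Longrightarrow> (\<lambda>z. f z - g z) \<in> H_infinity"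
  unfolding H_infinity_def by (auto intro!: holomorphic_intros bounded_minus_comp)

text \<open>
  If the quotient stays above \<open>\<epsilon>\<close> along \<open>\<phi>(z\<^sub>j)\<close> tending to the circle, the kernels at these points form a
  bounded sequence whose images tend to \<open>0\<close> pointwise. A uniform limit of a subsequence would then be \<open>0\<close>,
  but the images have sup norm at least \<open>c \<epsilon>\<close>.
\<close>

lemma compact_operatorD:
  assumes comp: "compact_operator p \<omega> T"
  shows vanishing
proof (rule ccontr)
  assume "\<not> vanishing"
  then obtain \<epsilon> where \<epsilon>: "0 < \<epsilon>"
    and bad: "\<And>r. 0 < r \<Longrightarrow> r < 1 \<Longrightarrow> \<exists>z. cmod z < 1 \<and> r < cmod (\<phi> z) \<and> \<epsilon> \<le> q z"
    unfolding vanishes_at_circle_def by (force simp: not_less)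
  have "\<exists>z. cmod z < 1 \<and> 1 - 1 / (real j + 2) < cmod (\<phi> z) \<and> \<epsilon> \<le> q z" for j
    by (rule bad) (auto simp: field_simps)
  then obtain z where z: "\<And>j. cmod (z j) < 1" "\<And>j. 1 - 1 / (real j + 2) < cmod (\<phi> (z j))" "\<And>j. \<epsilon> \<le> q (z j)"
    by metis
  define a where "a j = \<phi> (z j)" for j
  have a: "cmod (a j) < 1" for j unfolding a_def by (rule \<phi>_disc[OF z(1)])
  have half: "1/2 \<le> cmod (a j)" for j
  proof -
    have "1 / (real j + 2) \<le> 1 / 2" by (intro divide_left_mono) auto
    then show ?thesis using z(2)[of j] unfolding a_def by linarith
  qed
  have small: "1 - cmod (a j) \<le> 1 / (real j + 2)" for j using z(2)[of j] by (simp add: a_def)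
  have TH: "\<And>f. f \<in> bergman p \<omega> \<Longrightarrow> T f \<in> H_infinity"
    using comp by (simp add: compact_operator_def)
  have "\<exists>s g. strict_mono (s :: nat \<Rightarrow> nat) \<and> g \<in> H_infinity \<and>
           (\<lambda>j. sup_norm (\<lambda>w. T (k (a (s j))) w - g w)) \<longlonglongrightarrow> 0"
    using comp kernel[OF a] unfolding compact_operator_def
    by (elim conjE allE[of _ "\<lambda>j. k (a j)"] impE) auto
  then obtain s g where s: "strict_mono (s :: nat \<Rightarrow> nat)" and g: "g \<in> H_infinity"
    and lim: "(\<lambda>j. sup_norm (\<lambda>w. T (k (a (s j))) w - g w)) \<longlonglongrightarrow> 0" by blast
  have le: "cmod (T (k (a j)) w - g w) \<le> sup_norm (\<lambda>w. T (k (a j)) w - g w)" if "cmod w < 1" for w j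
    by (rule le_sup_norm[OF H_infinity_diff[OF TH[OF kernel(1)[OF a]] g] that])
  have g0: "g w = 0" if w: "cmod w < 1" for w
  proof -
    have "(\<lambda>j. T (k (a (s j))) w - g w) \<longlonglongrightarrow> 0"
      by (rule Lim_null_comparison[OF _ lim]) (use le[OF w] in simp)
    moreover have "(\<lambda>j. T (k (a (s j))) w) \<longlonglongrightarrow> 0"
    proof -
      obtain K where K: "\<And>b. cmod b < 1 \<Longrightarrow> cmod ((deriv ^^ n) (k b) (\<phi> w)) \<le> K * (1 - cmod b)"
        using kernel_decay[OF \<phi>_disc[OF w]] by blast
      have "(\<lambda>j. inverse (real j)) \<longlonglongrightarrow> 0" by (rule lim_inverse_n)
      then have "(\<lambda>j. cmod (u w) * \<bar>K\<bar> * inverse (real j)) \<longlonglongrightarrow> 0"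
        by (rule tendsto_mult_right_zero)
      then show ?thesis
      proof (rule Lim_null_comparison[rotated], intro eventually_sequentiallyI)
        fix j :: nat assume j: "1 \<le> j"
        have "1 - cmod (a (s j)) \<le> inverse (real j)"
        proof -
          have "1 / (real (s j) + 2) \<le> 1 / real j"
            using seq_suble[OF s, of j] j by (intro divide_left_mono) auto
          then show ?thesis using small[of "s j"] by (simp add: inverse_eq_divide)
        qed
        then have "\<bar>K\<bar> * (1 - cmod (a (s j))) \<le> \<bar>K\<bar> * inverse (real j)" by (intro mult_left_mono) auto
        moreover have "K * (1 - cmod (a (s j))) \<le> \<bar>K\<bar> * (1 - cmod (a (s j)))"
          using a[of "s j"] by (intro mult_right_mono) auto
        ultimately have "cmod ((deriv ^^ n) (k (a (s j))) (\<phi> w)) \<le> \<bar>K\<bar> * inverse (real j)"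
          using K[OF a, of "s j"] by linarith
        then show "cmod (T (k (a (s j))) w) \<le> cmod (u w) * \<bar>K\<bar> * inverse (real j)"
          unfolding weighted_diff_comp_def norm_mult mult.assoc by (rule mult_left_mono) simp
      qed
    qed
    ultimately have "(\<lambda>j. T (k (a (s j))) w - (T (k (a (s j))) w - g w)) \<longlonglongrightarrow> 0 - 0"
      by (intro tendsto_diff)
    then show ?thesis by (simp add: LIMSEQ_const_iff)
  qed
  have "c * \<epsilon> \<le> sup_norm (\<lambda>w. T (k (a (s j))) w - g w)" for j
  proof -
    have "c * \<epsilon> \<le> c * q (z (s j))" using z(3) c_pos by (intro mult_left_mono) auto
    also have "\<dots> \<le> cmod (T (k (a (s j))) (z (s j)))"
      using kernel_lower[OF a half, of "s j"] by (intro T_ge z(1)) (simp add: a_def)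
    also have "\<dots> \<le> sup_norm (\<lambda>w. T (k (a (s j))) w - g w)"
      using le[OF z(1)[of "s j"], of "s j"] g0[OF z(1)[of "s j"]] by simp
    finally show ?thesis .
  qed
  then have "c * \<epsilon> \<le> 0" by (intro LIMSEQ_le_const[OF lim]) auto
  then show False using c_pos \<epsilon> by (simp add: mult_le_0_iff)
qed

lemma compact_iff:
  "compact_operator p \<omega> T \<longleftrightarrow> (SUP z\<in>unit_disc. cmod (\<phi> z)) < 1 \<or> vanishing"
  using compact_operatorI compact_operatorD vanishing_of_range_away by blast

end

end

section \<open>Bergman spaces of doubling weights\<close>

lemma area_measure_measurable:
  "borel_measurable area_measure = borel_measurable (lebesgue_on (ball 0 1))"
  unfolding area_measure_def by (rule measurable_cong_sets) simp_all

lemma space_area_measure: "space area_measure = ball 0 1"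
  by (simp add: area_measure_def space_scale_measure)

context
  fixes \<omega> :: "complex \<Rightarrow> real" and \<mu> :: "complex measure" and D p :: real
  assumes dm: "doubling_disc_measure \<mu> D" and w: "weight \<omega>" and p: "0 < p"
    and int: "\<And>h. h \<in> borel_measurable borel \<Longrightarrow>
      (\<integral>\<^sup>+z. h z * ennreal (\<omega> z) \<partial>area_measure) = (\<integral>\<^sup>+z. h z \<partial>\<mu>)"
begin

interpretation doubling_disc_measure \<mu> D by (rule dm)

lemma weight_of_eq_measure:
  assumes [measurable]: "E \<in> sets borel"
  shows "weight_of \<omega> E = measure \<mu> E"
proof -
  have \<omega>: "\<omega> \<in> borel_measurable area_measure"
    using measurable_of_weight[OF w] by (simp add: area_measure_measurable)
  have E: "indicator E \<in> borel_measurable area_measure"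
    unfolding area_measure_measurable
    by (intro measurable_restrict_space1 measurable_completion) simp
  have "weight_of \<omega> E = enn2real (\<integral>\<^sup>+z. ennreal (indicator E z * \<omega> z) \<partial>area_measure)"
    unfolding weight_of_def set_lebesgue_integral_def real_scaleR_def
  proof (rule integral_eq_nn_integral)
    show "(\<lambda>z. indicator E z * \<omega> z) \<in> borel_measurable area_measure"
      by (intro borel_measurable_times \<omega> E)
    show "AE z in area_measure. 0 \<le> indicator E z * \<omega> z"
      by (rule AE_I2) (use w in \<open>auto simp: weight_def space_area_measure split: split_indicator\<close>)
  qed
  also have "(\<integral>\<^sup>+z. ennreal (indicator E z * \<omega> z) \<partial>area_measure) = (\<integral>\<^sup>+z. indicator E z * ennreal (\<omega> z) \<partial>area_measure)"
    by (intro nn_integral_cong) (auto split: split_indicator)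
  also have "\<dots> = emeasure \<mu> E"
    by (subst int) (auto simp: sets_eq)
  finally show ?thesis by (simp add: measure_def)
qed

text \<open>
  The function \<open>|f|\<^sup>p \<omega>\<close> is merely Lebesgue measurable and is integrated over the disc, so it is
  first replaced by the Borel function that vanishes off the disc times \<open>\<omega>\<close>.
\<close>

lemma bergman_p_integral:
  assumes f: "f holomorphic_on ball 0 1"
  shows "f \<in> bergman p \<omega> \<longleftrightarrow> p_integral p f < \<infinity>"
    and "bergman_norm p \<omega> f = enn2real (p_integral p f) powr (1 / p)"
proof -
  define g where "g z = indicator (ball 0 1) z * cmod (f z) powr p" for z
  have g: "g \<in> borel_measurable borel"
    unfolding g_def by (rule borel_measurable_cmod_powr[OF f p])
  have \<omega>: "\<omega> \<in> borel_measurable area_measure"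
    using measurable_of_weight[OF w] by (simp add: area_measure_measurable)
  have g': "g \<in> borel_measurable area_measure"
    unfolding area_measure_measurable
    by (intro measurable_restrict_space1 measurable_completion) (use g in simp)
  have eq: "cmod (f z) powr p * \<omega> z = g z * \<omega> z" if "z \<in> space area_measure" for z
    using that by (simp add: g_def space_area_measure)
  have meas: "(\<lambda>z. cmod (f z) powr p * \<omega> z) \<in> borel_measurable area_measure"
    using borel_measurable_times[OF g' \<omega>] by (subst measurable_cong[OF eq])
  have nonneg: "0 \<le> cmod (f z) powr p * \<omega> z" if "z \<in> space area_measure" for z
    using that w by (auto simp: weight_def space_area_measure)
  have nn: "(\<integral>\<^sup>+z. ennreal (cmod (f z) powr p * \<omega> z) \<partial>area_measure) = p_integral p f"
  proof -
    have "(\<integral>\<^sup>+z. ennreal (cmod (f z) powr p * \<omega> z) \<partial>area_measure) = (\<integral>\<^sup>+z. ennreal (g z) * ennreal (\<omega> z) \<partial>area_measure)"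
    proof (intro nn_integral_cong)
      fix z assume "z \<in> space area_measure"
      then show "ennreal (cmod (f z) powr p * \<omega> z) = ennreal (g z) * ennreal (\<omega> z)"
        by (simp add: eq g_def ennreal_mult')
    qed
    also have "\<dots> = p_integral p f"
      unfolding p_integral_def g_def[symmetric]
      by (rule int) (rule measurable_compose[OF g measurable_ennreal])
    finally show ?thesis .
  qed
  have "(\<integral>\<^sup>+z. ennreal (norm (cmod (f z) powr p * \<omega> z)) \<partial>area_measure) = p_integral p f"
    unfolding nn[symmetric] by (intro nn_integral_cong) (use nonneg in simp)
  then show "f \<in> bergman p \<omega> \<longleftrightarrow> p_integral p f < \<infinity>"
    unfolding bergman_def integrable_iff_bounded using f meas by simp
  have "(LINT z|area_measure. cmod (f z) powr p * \<omega> z) = enn2real (p_integral p f)"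
    unfolding nn[symmetric] by (rule integral_eq_nn_integral[OF meas]) (use nonneg in \<open>auto intro: AE_I2\<close>)
  then show "bergman_norm p \<omega> f = enn2real (p_integral p f) powr (1 / p)"
    by (simp add: bergman_norm_def)
qed

lemma p_integral_bergman_norm:
  assumes "f \<in> bergman p \<omega>"
  shows "f holomorphic_on ball 0 1" "p_integral p f = ennreal (bergman_norm p \<omega> f powr p)"
proof -
  show f: "f holomorphic_on ball 0 1" using assms by (simp add: bergman_def)
  then have "p_integral p f < \<infinity>" using assms bergman_p_integral(1) by simp
  then show "p_integral p f = ennreal (bergman_norm p \<omega> f powr p)"
    using p by (simp add: bergman_p_integral(2)[OF f] powr_powr)
qed

lemma bergman_unit_ballI:
  assumes f: "f holomorphic_on ball 0 1" and le: "p_integral p f \<le> 1"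
  shows "f \<in> bergman p \<omega>" "bergman_norm p \<omega> f \<le> 1"
proof -
  show "f \<in> bergman p \<omega>"
    unfolding bergman_p_integral(1)[OF f] using le by (rule le_less_trans) simp
  have "enn2real (p_integral p f) \<le> 1" using le enn2real_leI[of 1] by simp
  then have "enn2real (p_integral p f) powr (1 / p) \<le> 1 powr (1 / p)"
    using p by (intro powr_mono2) auto
  then show "bergman_norm p \<omega> f \<le> 1" by (simp add: bergman_p_integral(2)[OF f])
qed

lemma bergman_derivative_estimates_exist:
  "\<exists>C c. bergman_derivative_estimates p \<omega> n C c (normalized_kernel p)"
proof -
  define d where "d a = weight_of \<omega> (carleson_square a) powr (1 / p) * (1 - cmod a) ^ n" for a
  have d: "d a = measure \<mu> (carleson_square a) powr (1/p) * (1 - cmod a) ^ n" for a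
    by (simp add: d_def weight_of_eq_measure)
  define C where "C = fact n * 2 ^ n * (4 * D ^ 4) powr (1/p)"
  obtain c1 where c1: "0 < c1" "\<And>a. cmod a < 1 \<Longrightarrow> \<exists>h. h holomorphic_on ball 0 1 \<and> p_integral p h \<le> 1 \<and>
      c1 / d a \<le> cmod ((deriv ^^ n) h a)"
    unfolding d using extremal_function[OF p, of n] by blast
  obtain c2 where c2: "0 < c2" "\<And>a. cmod a < 1 \<Longrightarrow> 1/2 \<le> cmod a \<Longrightarrow>
      c2 / d a \<le> cmod ((deriv ^^ n) (normalized_kernel p a) a)"
    unfolding d using normalized_kernel_deriv_lower[OF p, of n] by blast
  have dpos: "0 < d a" if "cmod a < 1" for a
    using that carleson_square_pos[OF that] by (simp add: d)
  have "bergman_derivative_estimates p \<omega> n C (min c1 c2) (normalized_kernel p)"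
  proof (unfold_locales, fold d_def)
    show "0 < d a" if "cmod a < 1" for a by (rule dpos[OF that])
    show "0 < C" using D_ge_1 by (simp add: C_def)
    show "0 < min c1 c2" using c1 c2 by simp
    show "cmod ((deriv ^^ n) f a) \<le> C * bergman_norm p \<omega> f / d a"
      if "f \<in> bergman p \<omega>" "cmod a < 1" for f a
      unfolding C_def d
      by (rule higher_deriv_le[OF p_integral_bergman_norm(1)[OF that(1)] p p_integral_bergman_norm(2)[OF that(1)] _ that(2)])
         (simp add: bergman_norm_def)
    have min: "min c1 c2 / d a \<le> x" if "cmod a < 1" "c1 / d a \<le> x \<or> c2 / d a \<le> x" for a x
    proof -
      have "min c1 c2 / d a \<le> c1 / d a" "min c1 c2 / d a \<le> c2 / d a"
        using dpos[OF that(1)] by (auto intro!: divide_right_mono)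
      then show ?thesis using that(2) by linarith
    qed
    show "\<exists>h\<in>bergman p \<omega>. bergman_norm p \<omega> h \<le> 1 \<and> min c1 c2 / d a \<le> cmod ((deriv ^^ n) h a)"
      if "cmod a < 1" for a
      using c1(2)[OF that] bergman_unit_ballI min[OF that] by blast
    show "\<exists>B. \<forall>f\<in>bergman p \<omega>. \<forall>a. cmod a \<le> r \<longrightarrow> cmod (f a) \<le> B * bergman_norm p \<omega> f"
      if r: "0 \<le> r" "r < 1" for r
    proof -
      obtain B where "\<And>f N a. f holomorphic_on ball 0 1 \<Longrightarrow> p_integral p f = ennreal (N powr p) \<Longrightarrow> 0 \<le> N
          \<Longrightarrow> cmod a \<le> r \<Longrightarrow> cmod (f a) \<le> B * N"
        using locally_bounded_evaluation[OF p r] by blast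
      then show ?thesis
        using p_integral_bergman_norm by (intro exI[of _ B]) (simp add: bergman_norm_def)
    qed
    show "normalized_kernel p a \<in> bergman p \<omega>" "bergman_norm p \<omega> (normalized_kernel p a) \<le> 1"
      if "cmod a < 1" for a
      using bergman_unit_ballI[OF normalized_kernel_holomorphic[OF that] normalized_kernel_p_integral[OF p that]] by auto
    show "min c1 c2 / d a \<le> cmod ((deriv ^^ n) (normalized_kernel p a) a)"
      if "cmod a < 1" "1/2 \<le> cmod a" for a
      using c2(2)[OF that] min[OF that(1)] by blast
    show "\<exists>K. \<forall>a. cmod a < 1 \<longrightarrow> cmod ((deriv ^^ n) (normalized_kernel p a) w) \<le> K * (1 - cmod a)"
      if "cmod w < 1" for w
      using normalized_kernel_deriv_decay[OF p that, of n] by blast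
  qed
  then show ?thesis by blast
qed

end


theorem theorem4:
  fixes \<omega> :: "complex \<Rightarrow> real" and p :: real and n :: nat
  assumes "\<omega> \<in> doubling_weights" and "0 < p"
  shows
    "(\<forall>\<phi> u. self_map \<phi> \<and> u \<in> H_infinity \<longrightarrow>
        (bounded_operator p \<omega> (weighted_diff_comp n \<phi> u) \<longleftrightarrow>
         bdd_above (test_quotient p \<omega> n \<phi> u ` unit_disc))) \<and>
     (\<exists>C\<ge>1. \<forall>\<phi> u. self_map \<phi> \<and> u \<in> H_infinity \<and>
        bounded_operator p \<omega> (weighted_diff_comp n \<phi> u) \<longrightarrow>
        inverse C * (SUP z\<in>unit_disc. test_quotient p \<omega> n \<phi> u z)
          \<le> operator_norm p \<omega> (weighted_diff_comp n \<phi> u) \<and>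
        operator_norm p \<omega> (weighted_diff_comp n \<phi> u)
          \<le> C * (SUP z\<in>unit_disc. test_quotient p \<omega> n \<phi> u z)) \<and>
     (\<forall>\<phi> u. self_map \<phi> \<and> u \<in> H_infinity \<longrightarrow>
        (compact_operator p \<omega> (weighted_diff_comp n \<phi> u) \<longleftrightarrow>
         (SUP z\<in>unit_disc. cmod (\<phi> z)) < 1 \<or>
         (\<forall>\<epsilon>>0. \<exists>r. 0 < r \<and> r < 1 \<and>
            (\<forall>z\<in>unit_disc. r < cmod (\<phi> z) \<and> cmod (\<phi> z) < 1 \<longrightarrow>
               test_quotient p \<omega> n \<phi> u z < \<epsilon>))))"
proof -
  obtain \<mu> D where \<mu>: "doubling_disc_measure \<mu> D"
    "\<And>h. h \<in> borel_measurable borel \<Longrightarrow> (\<integral>\<^sup>+z. h z * ennreal (\<omega> z) \<partial>area_measure) = (\<integral>\<^sup>+z. h z \<partial>\<mu>)"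
    using doubling_weight_measure[OF assms(1)] by blast
  have "weight \<omega>" using assms(1) by (simp add: doubling_weights_def radial_weight_def)
  from bergman_derivative_estimates_exist[OF \<mu>(1) this assms(2) \<mu>(2)]
  obtain C c k where "bergman_derivative_estimates p \<omega> n C c k" by blast
  then interpret bergman_derivative_estimates p \<omega> n
    "\<lambda>a. weight_of \<omega> (carleson_square a) powr (1 / p) * (1 - cmod a) ^ n" C c k
    by simp
  define K where "K = max 1 (max C (1 / c))"
  have K: "1 \<le> K" "C \<le> K" "inverse K \<le> c"
  proof -
    show "1 \<le> K" "C \<le> K" by (auto simp: K_def)
    have "1 / c \<le> K" by (auto simp: K_def)
    then show "inverse K \<le> c" using c_pos \<open>1 \<le> K\<close> by (simp add: field_simps)
  qed
  have norms: "inverse K * (SUP z\<in>unit_disc. test_quotient p \<omega> n \<phi> u z) \<le> operator_norm p \<omega> (weighted_diff_comp n \<phi> u) \<and>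
        operator_norm p \<omega> (weighted_diff_comp n \<phi> u) \<le> K * (SUP z\<in>unit_disc. test_quotient p \<omega> n \<phi> u z)"
    if "self_map \<phi>" "u \<in> H_infinity" "bounded_operator p \<omega> (weighted_diff_comp n \<phi> u)" for \<phi> u
  proof -
    have "0 \<le> (SUP z\<in>unit_disc. test_quotient p \<omega> n \<phi> u z)"
      by (rule order_trans[OF q_nonneg[OF that(1,2), of 0] cSUP_upper[OF _ bounded_operatorD[OF that]]]) auto
    then have "inverse K * (SUP z\<in>unit_disc. test_quotient p \<omega> n \<phi> u z) \<le> c * (SUP z\<in>unit_disc. test_quotient p \<omega> n \<phi> u z)"
      and "C * (SUP z\<in>unit_disc. test_quotient p \<omega> n \<phi> u z) \<le> K * (SUP z\<in>unit_disc. test_quotient p \<omega> n \<phi> u z)"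
      using K(2,3) by (auto intro: mult_right_mono)
    then show ?thesis
      using operator_norm_bounds[OF that] by linarith
  qed
  show ?thesis
  proof (intro conjI allI impI)
    show "bounded_operator p \<omega> (weighted_diff_comp n \<phi> u) \<longleftrightarrow> bdd_above (test_quotient p \<omega> n \<phi> u ` unit_disc)"
      if "self_map \<phi> \<and> u \<in> H_infinity" for \<phi> u
      using bounded_operatorI[of \<phi> u] bounded_operatorD[of \<phi> u] that by (intro iffI) simp_all
    show "\<exists>C\<ge>1. \<forall>\<phi> u. self_map \<phi> \<and> u \<in> H_infinity \<and>
        bounded_operator p \<omega> (weighted_diff_comp n \<phi> u) \<longrightarrow>
        inverse C * (SUP z\<in>unit_disc. test_quotient p \<omega> n \<phi> u z)
          \<le> operator_norm p \<omega> (weighted_diff_comp n \<phi> u) \<and>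
        operator_norm p \<omega> (weighted_diff_comp n \<phi> u)
          \<le> C * (SUP z\<in>unit_disc. test_quotient p \<omega> n \<phi> u z)"
      using norms K(1) by (intro exI[of _ K] conjI allI impI) auto
    show "compact_operator p \<omega> (weighted_diff_comp n \<phi> u) \<longleftrightarrow>
         (SUP z\<in>unit_disc. cmod (\<phi> z)) < 1 \<or>
         (\<forall>\<epsilon>>0. \<exists>r. 0 < r \<and> r < 1 \<and>
            (\<forall>z\<in>unit_disc. r < cmod (\<phi> z) \<and> cmod (\<phi> z) < 1 \<longrightarrow>
               test_quotient p \<omega> n \<phi> u z < \<epsilon>))"
      if "self_map \<phi> \<and> u \<in> H_infinity" for \<phi> u
      using compact_iff[of \<phi> u] that unfolding vanishes_at_circle_def by simp
  qed
qed

end
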